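(* The mapping $\psi:U_{r,s}(\mathfrak{gl}_n)\to U(R)$ given by $$e_i\mapsto\frac{r}{r-s}E_{i,i+1},\quad f_i\mapsto\frac{s}{s-r}F_{i+1,i}\quad(1\le i<n),\quad a_1\mapsto K_1^+,\quad b_1\mapsto K_1^-,$$ and, for $2\le i\le n$, $$a_i\mapsto K_i^{+}\prod_{l=1}^{i-1}(K_{i-l}^{+}K_{i-l}^{-})^{(-1)^l},\qquad b_i\mapsto K_i^{-}\prod_{l=1}^{i-1}(K_{i-l}^{+}K_{i-l}^{-})^{(-1)^l},$$ is an isomorphism of algebras.
   Context: Let $n\ge 2$ and let $r,s\in\mathbb{C}$ be nonzero with $r\ne s$ and $r+s\neq 0$. The algebra $U(R)$. Let $V=\mathbb{C}^n$ with matrix units $e_{ij}$, and let $$R^{(+)}=s\sum_{i}e_{ii}\otimes e_{ii}+rs\sum_{i<j}e_{ii}\otimes e_{jj}+\sum_{i>j}e_{ii}\otimes e_{jj}+(s-r)\sum_{i<j}e_{ij}\otimes e_{ji}\in End(V\otimes V).$$ $U(R)$ is the unital associative $\mathbb{C}$-algebra with generators $l^+_{ij},l^-_{ji}$ ($1\le i\le j\le n$) subject to the relations $$R^{(+)}L_1^{\pm}L_2^{\pm}=L_2^{\pm}L_1^{\pm}R^{(+)},\qquad R^{(+)}L_1^{+}L_2^{-}=L_2^{-}L_1^{+}R^{(+)},$$ where $L^\pm=(l^\pm_{ij})_{1\le i,j\le n}$ are required to be invertible triangular matrices with $l^+_{ij}=l^-_{ji}=0$ for $1\le j<i\le n$ (so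 $L^+$ is upper triangular, $L^-$ lower triangular, and the inverses of the diagonal entries are adjoined), and $L_1^\pm=\sum l^\pm_{ij}\,e_{ij}\otimes 1$, $L_2^\pm=\sum l^\pm_{ij}\,1\otimes e_{ij}$. The elements $K_i^\pm$ ($1\le i\le n$), $E_{ij},F_{ji}$ ($i<j$) of $U(R)$ are defined by the Gauss decomposition $L^+=\mathrm{diag}(K_1^+,\ldots,K_n^+)\,E$, $L^-=F\,\mathrm{diag}(K_1^-,\ldots,K_n^-)$, where $E$ is upper unitriangular with entries $E_{ij}$ ($i<j$) and $F$ is lower unitriangular with entries $F_{ji}$ ($i<j$); that is, $l^\pm_{ii}=K_i^\pm$, $l^+_{ij}=K_i^+E_{ij}$, $l^-_{ji}=F_{ji}K_i^-$ for $i<j$. The elements $K_i^\pm$ are invertible and commute with one another. The algebra $U_{r,s}(\mathfrak{gl}_n)$. Let $\epsilon_1,\ldots,\epsilon_n$ be an orthonormal basis with respect to $\langle\ ,\ \rangle$ and $\alpha_j=\epsilon_j-\epsilon_{j+1}$. $U_{r,s}(\mathfrak{gl}_n)$ is the unital associative $\mathbb{C}$-algebra generated by $e_j,f_j$ ($1\le j<n$), $a_i^{\pm1},b_i^{\pm1}$ ($1\le i\le n$) with relations: (R1) the $a_i^{\pm1},b_j^{\pm1}$ all commute with each other and $a_ia_i^{-1}=b_ib_i^{-1}=1$; (R2) $a_ie_j=r^{\langle\epsilon_i,\alpha_j\rangle}e_ja_i$, $a_if_j=r^{-\langle\epsilon_i,\alpha_j\rangle}f_ja_i$; (R3) $b_ie_j=s^{\langle\epsilon_i,\alpha_j\rangle}e_jb_i$,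 $b_if_j=s^{-\langle\epsilon_i,\alpha_j\rangle}f_jb_i$; (R4) $[e_i,f_j]=\frac{\delta_{ij}}{r-s}(a_ib_{i+1}-a_{i+1}b_i)$; (R5) $[e_i,e_j]=[f_i,f_j]=0$ if $|i-j|>1$; (R6) $e_i^2e_{i+1}-(r+s)e_ie_{i+1}e_i+rs\,e_{i+1}e_i^2=0$ and $e_ie_{i+1}^2-(r+s)e_{i+1}e_ie_{i+1}+rs\,e_{i+1}^2e_i=0$; (R7) $f_i^2f_{i+1}-(r^{-1}+s^{-1})f_if_{i+1}f_i+r^{-1}s^{-1}f_{i+1}f_i^2=0$ and $f_if_{i+1}^2-(r^{-1}+s^{-1})f_{i+1}f_if_{i+1}+r^{-1}s^{-1}f_{i+1}^2f_i=0$. *)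

theory Defs
  imports Complex_Main "HOL-Library.Poly_Mapping" "HOL-Algebra.QuotRing" "HOL-Algebra.Module"
begin

section \<open>Unital associative complex algebras given by generators and relations\<close>

datatype 'g fword = FWord (letters: "'g list")

instantiation fword :: (type) monoid_add
begin

definition "0 = FWord []"
definition "u + v = FWord (letters u @ letters v)"

instance
  by standard (simp_all add: zero_fword_def plus_fword_def)

end

text \<open>
  Words are written additively only because the convolution product of \<open>Poly_Mapping\<close>
  is based on addition of exponents; with concatenation as (non-commutative) addition of words,
  that product is the one of the free associative algebra.
\<close>

type_synonym 'g ncpoly = "'g fword \<Rightarrow>\<^sub>0 complex"

definition gen :: "'g \<Rightarrow> 'g ncpoly"
  where "gen x = Poly_Mapping.single (FWord [x]) 1"

definition scal :: "complex \<Rightarrow> 'g ncpoly"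
  where "scal c = Poly_Mapping.single 0 c"

definition free_alg :: "'g set \<Rightarrow> 'g ncpoly ring"
  where "free_alg X =
    \<lparr>carrier = {p. \<forall>w\<in>Poly_Mapping.keys p. set (letters w) \<subseteq> X},
     mult = (*), one = 1, zero = 0, add = (+)\<rparr>"

text \<open>A relation \<^term>\<open>(p, q)\<close> stands for \<open>p = q\<close>. Ideals in \<open>HOL-Algebra\<close> are two-sided.\<close>

definition rel_ideal :: "'g set \<Rightarrow> ('g ncpoly \<times> 'g ncpoly) set \<Rightarrow> 'g ncpoly set"
  where "rel_ideal X Rels = Idl\<^bsub>free_alg X\<^esub> {p - q | p q. (p, q) \<in> Rels}"

definition rel_class :: "'g set \<Rightarrow> ('g ncpoly \<times> 'g ncpoly) set \<Rightarrow> 'g ncpoly \<Rightarrow> 'g ncpoly set"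
  where "rel_class X Rels p = rel_ideal X Rels +>\<^bsub>free_alg X\<^esub> p"

definition presented_alg ::
    "'g set \<Rightarrow> ('g ncpoly \<times> 'g ncpoly) set \<Rightarrow> (complex, 'g ncpoly set) module"
  where "presented_alg X Rels = (let Q = free_alg X Quot rel_ideal X Rels in
    \<lparr>carrier = carrier Q, mult = mult Q, one = one Q, zero = zero Q, add = add Q,
     smult = (\<lambda>c x. rel_class X Rels (scal c) \<otimes>\<^bsub>Q\<^esub> x)\<rparr>)"

definition alg_iso :: "(complex, 'a) module \<Rightarrow> (complex, 'b) module \<Rightarrow> ('a \<Rightarrow> 'b) set"
  where "alg_iso A B =
    {h \<in> ring_iso A B. \<forall>c. \<forall>x\<in>carrier A. h (c \<odot>\<^bsub>A\<^esub> x) = c \<odot>\<^bsub>B\<^esub> h x}"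


section \<open>The algebra \<open>U(R)\<close>\<close>

text \<open>
  Matrices are functions of a row and a column index, used for indices in \<^term>\<open>{1..n}\<close>.
  In \<open>End(V \<otimes> V)\<close> the index pair \<^term>\<open>(i, k)\<close> belongs to the basis vector
  \<open>v\<^sub>i \<otimes> v\<^sub>k\<close>, so that \<open>e\<^sub>i\<^sub>j \<otimes> e\<^sub>k\<^sub>l\<close> has its entry 1 in
  row \<^term>\<open>(i, k)\<close> and column \<^term>\<open>(j, l)\<close>.
\<close>

type_synonym 'a tmat = "nat \<times> nat \<Rightarrow> nat \<times> nat \<Rightarrow> 'a"

definition munit :: "nat \<Rightarrow> nat \<Rightarrow> nat \<Rightarrow> nat \<Rightarrow> 'a::zero_neq_one"
  where "munit i j = (\<lambda>k l. of_bool (k = i \<and> l = j))"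

definition mone :: "nat \<Rightarrow> nat \<Rightarrow> 'a::zero_neq_one"
  where "mone = (\<lambda>k l. of_bool (k = l))"

definition tens :: "(nat \<Rightarrow> nat \<Rightarrow> 'a::times) \<Rightarrow> (nat \<Rightarrow> nat \<Rightarrow> 'a) \<Rightarrow> 'a tmat"
  where "tens A B = (\<lambda>(i, k) (j, l). A i j * B k l)"

definition tmult :: "nat \<Rightarrow> 'a::semiring_0 tmat \<Rightarrow> 'a tmat \<Rightarrow> 'a tmat"
  where "tmult n A B = (\<lambda>x y. \<Sum>z\<in>{1..n} \<times> {1..n}. A x z * B z y)"

definition Rmat :: "nat \<Rightarrow> complex \<Rightarrow> complex \<Rightarrow> complex tmat"
  where "Rmat n r s = (\<lambda>x y.
      s * (\<Sum>i\<in>{1..n}. tens (munit i i) (munit i i) x y)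
    + r * s * (\<Sum>(i, j)\<in>{(i, j). 1 \<le> i \<and> i < j \<and> j \<le> n}. tens (munit i i) (munit j j) x y)
    + (\<Sum>(i, j)\<in>{(i, j). 1 \<le> j \<and> j < i \<and> i \<le> n}. tens (munit i i) (munit j j) x y)
    + (s - r) * (\<Sum>(i, j)\<in>{(i, j). 1 \<le> i \<and> i < j \<and> j \<le> n}. tens (munit i j) (munit j i) x y))"

text \<open>
  \<^term>\<open>LP i j\<close> and \<^term>\<open>LM j i\<close> are \<open>l\<^sup>+\<^sub>i\<^sub>j\<close> and \<open>l\<^sup>-\<^sub>j\<^sub>i\<close>;
  \<^term>\<open>LPinv i\<close> and \<^term>\<open>LMinv i\<close> are the adjoined inverses of
  \<open>l\<^sup>+\<^sub>i\<^sub>i\<close> and \<open>l\<^sup>-\<^sub>i\<^sub>i\<close>.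
\<close>

datatype lgen = LP nat nat | LM nat nat | LPinv nat | LMinv nat

definition UR_gens :: "nat \<Rightarrow> lgen set"
  where "UR_gens n =
      {LP i j | i j. 1 \<le> i \<and> i \<le> j \<and> j \<le> n} \<union> {LM j i | i j. 1 \<le> i \<and> i \<le> j \<and> j \<le> n}
    \<union> {LPinv i | i. 1 \<le> i \<and> i \<le> n} \<union> {LMinv i | i. 1 \<le> i \<and> i \<le> n}"

definition Lplus :: "nat \<Rightarrow> nat \<Rightarrow> lgen ncpoly"
  where "Lplus = (\<lambda>i j. if i \<le> j then gen (LP i j) else 0)"

definition Lminus :: "nat \<Rightarrow> nat \<Rightarrow> lgen ncpoly"
  where "Lminus = (\<lambda>i j. if j \<le> i then gen (LM i j) else 0)"

text \<open>The two sides of the matrix equation \<open>R L\<^sub>1 M\<^sub>2 = M\<^sub>2 L\<^sub>1 R\<close>, entry by entry.\<close>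

definition RLL_rels ::
    "nat \<Rightarrow> complex \<Rightarrow> complex \<Rightarrow> (nat \<Rightarrow> nat \<Rightarrow> lgen ncpoly) \<Rightarrow> (nat \<Rightarrow> nat \<Rightarrow> lgen ncpoly)
      \<Rightarrow> (lgen ncpoly \<times> lgen ncpoly) set"
  where "RLL_rels n r s L M =
    (let R = (\<lambda>x y. scal (Rmat n r s x y)); L1 = tens L mone; M2 = tens mone M in
      {(tmult n (tmult n R L1) M2 x y, tmult n (tmult n M2 L1) R x y) | x y.
         x \<in> {1..n} \<times> {1..n} \<and> y \<in> {1..n} \<times> {1..n}})"

definition UR_rels :: "nat \<Rightarrow> complex \<Rightarrow> complex \<Rightarrow> (lgen ncpoly \<times> lgen ncpoly) set"
  where "UR_rels n r s =
      RLL_rels n r s Lplus Lplus \<union> RLL_rels n r s Lminus Lminus \<union> RLL_rels n r s Lplus Lminus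
    \<union> (\<Union>i\<in>{1..n}. {(gen (LP i i) * gen (LPinv i), 1), (gen (LPinv i) * gen (LP i i), 1),
                     (gen (LM i i) * gen (LMinv i), 1), (gen (LMinv i) * gen (LM i i), 1)})"

definition UR :: "nat \<Rightarrow> complex \<Rightarrow> complex \<Rightarrow> (complex, lgen ncpoly set) module"
  where "UR n r s = presented_alg (UR_gens n) (UR_rels n r s)"

definition UR_el :: "nat \<Rightarrow> complex \<Rightarrow> complex \<Rightarrow> lgen \<Rightarrow> lgen ncpoly set"
  where "UR_el n r s x = rel_class (UR_gens n) (UR_rels n r s) (gen x)"

text \<open>
  Gauss decomposition: \<open>E\<close> and \<open>F\<close> are obtained by solving
  \<open>l\<^sup>+\<^sub>i\<^sub>j = K\<^sup>+\<^sub>i E\<^sub>i\<^sub>j\<close> and \<open>l\<^sup>-\<^sub>j\<^sub>i = F\<^sub>j\<^sub>i K\<^sup>-\<^sub>i\<close>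
  for \<open>i < j\<close>; see \<open>gauss_plus\<close> and \<open>gauss_minus\<close> below.
\<close>

definition Kplus :: "nat \<Rightarrow> complex \<Rightarrow> complex \<Rightarrow> nat \<Rightarrow> lgen ncpoly set"
  where "Kplus n r s i = UR_el n r s (LP i i)"

definition Kminus :: "nat \<Rightarrow> complex \<Rightarrow> complex \<Rightarrow> nat \<Rightarrow> lgen ncpoly set"
  where "Kminus n r s i = UR_el n r s (LM i i)"

definition Egauss :: "nat \<Rightarrow> complex \<Rightarrow> complex \<Rightarrow> nat \<Rightarrow> nat \<Rightarrow> lgen ncpoly set"
  where "Egauss n r s i j = inv\<^bsub>UR n r s\<^esub> (Kplus n r s i) \<otimes>\<^bsub>UR n r s\<^esub> UR_el n r s (LP i j)"

definition Fgauss :: "nat \<Rightarrow> complex \<Rightarrow> complex \<Rightarrow> nat \<Rightarrow> nat \<Rightarrow> lgen ncpoly set"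
  where "Fgauss n r s j i = UR_el n r s (LM j i) \<otimes>\<^bsub>UR n r s\<^esub> inv\<^bsub>UR n r s\<^esub> (Kminus n r s i)"

text \<open>
  The product \<open>\<Prod>\<^sub>l (K\<^sup>+\<^sub>i\<^sub>-\<^sub>l K\<^sup>-\<^sub>i\<^sub>-\<^sub>l)\<^bsup>(-1)^l\<^esup>\<close> over \<open>1 \<le> l \<le> i - 1\<close>, in increasing
  order of \<open>l\<close>. The factors commute, but \<^const>\<open>finprod\<close> is only usable in a commutative monoid.
\<close>

definition Kprod :: "nat \<Rightarrow> complex \<Rightarrow> complex \<Rightarrow> nat \<Rightarrow> lgen ncpoly set"
  where "Kprod n r s i =
    foldr (\<otimes>\<^bsub>UR n r s\<^esub>)
      (map (\<lambda>l. (Kplus n r s (i - l) \<otimes>\<^bsub>UR n r s\<^esub> Kminus n r s (i - l)) [^]\<^bsub>UR n r s\<^esub> ((-1) ^ l :: int))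
        [1..<i])
      \<one>\<^bsub>UR n r s\<^esub>"


section \<open>The algebra \<open>U\<^sub>r\<^sub>,\<^sub>s(gl\<^sub>n)\<close>\<close>

datatype ugen = Ge nat | Gf nat | Ga nat | Gainv nat | Gb nat | Gbinv nat

definition Urs_cartan_gens :: "nat \<Rightarrow> ugen set"
  where "Urs_cartan_gens n = (\<Union>i\<in>{1..n}. {Ga i, Gainv i, Gb i, Gbinv i})"

definition Urs_gens :: "nat \<Rightarrow> ugen set"
  where "Urs_gens n = (\<Union>i\<in>{1..<n}. {Ge i, Gf i}) \<union> Urs_cartan_gens n"

definition eps :: "nat \<Rightarrow> nat \<Rightarrow> int"
  where "eps i = (\<lambda>k. of_bool (k = i))"

definition alpha :: "nat \<Rightarrow> nat \<Rightarrow> int"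
  where "alpha j = (\<lambda>k. eps j k - eps (j + 1) k)"

definition pairing :: "nat \<Rightarrow> (nat \<Rightarrow> int) \<Rightarrow> (nat \<Rightarrow> int) \<Rightarrow> int"
  where "pairing n u v = (\<Sum>k\<in>{1..n}. u k * v k)"

abbreviation comm :: "'a::ring \<Rightarrow> 'a \<Rightarrow> 'a"
  where "comm x y \<equiv> x * y - y * x"

inductive_set Urs_rels :: "nat \<Rightarrow> complex \<Rightarrow> complex \<Rightarrow> (ugen ncpoly \<times> ugen ncpoly) set"
  for n :: nat and r s :: complex
  where
    R1_comm: "\<lbrakk>x \<in> Urs_cartan_gens n; y \<in> Urs_cartan_gens n\<rbrakk> \<Longrightarrow>
      (gen x * gen y, gen y * gen x) \<in> Urs_rels n r s"
  | R1_a: "i \<in> {1..n} \<Longrightarrow> (gen (Ga i) * gen (Gainv i), 1) \<in> Urs_rels n r s"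
  | R1_b: "i \<in> {1..n} \<Longrightarrow> (gen (Gb i) * gen (Gbinv i), 1) \<in> Urs_rels n r s"
  | R2_e: "\<lbrakk>i \<in> {1..n}; j \<in> {1..<n}\<rbrakk> \<Longrightarrow>
      (gen (Ga i) * gen (Ge j), scal (r powi (pairing n (eps i) (alpha j))) * gen (Ge j) * gen (Ga i))
        \<in> Urs_rels n r s"
  | R2_f: "\<lbrakk>i \<in> {1..n}; j \<in> {1..<n}\<rbrakk> \<Longrightarrow>
      (gen (Ga i) * gen (Gf j), scal (r powi (- pairing n (eps i) (alpha j))) * gen (Gf j) * gen (Ga i))
        \<in> Urs_rels n r s"
  | R3_e: "\<lbrakk>i \<in> {1..n}; j \<in> {1..<n}\<rbrakk> \<Longrightarrow>
      (gen (Gb i) * gen (Ge j), scal (s powi (pairing n (eps i) (alpha j))) * gen (Ge j) * gen (Gb i))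
        \<in> Urs_rels n r s"
  | R3_f: "\<lbrakk>i \<in> {1..n}; j \<in> {1..<n}\<rbrakk> \<Longrightarrow>
      (gen (Gb i) * gen (Gf j), scal (s powi (- pairing n (eps i) (alpha j))) * gen (Gf j) * gen (Gb i))
        \<in> Urs_rels n r s"
  | R4: "\<lbrakk>i \<in> {1..<n}; j \<in> {1..<n}\<rbrakk> \<Longrightarrow>
      (comm (gen (Ge i)) (gen (Gf j)),
       scal (of_bool (i = j) / (r - s)) * (gen (Ga i) * gen (Gb (i + 1)) - gen (Ga (i + 1)) * gen (Gb i)))
        \<in> Urs_rels n r s"
  | R5_e: "\<lbrakk>i \<in> {1..<n}; j \<in> {1..<n}; \<bar>int i - int j\<bar> > 1\<rbrakk> \<Longrightarrow>
      (comm (gen (Ge i)) (gen (Ge j)), 0) \<in> Urs_rels n r s"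
  | R5_f: "\<lbrakk>i \<in> {1..<n}; j \<in> {1..<n}; \<bar>int i - int j\<bar> > 1\<rbrakk> \<Longrightarrow>
      (comm (gen (Gf i)) (gen (Gf j)), 0) \<in> Urs_rels n r s"
  | R6_1: "\<lbrakk>1 \<le> i; i + 1 < n\<rbrakk> \<Longrightarrow>
      (gen (Ge i) ^ 2 * gen (Ge (i + 1))
        - scal (r + s) * gen (Ge i) * gen (Ge (i + 1)) * gen (Ge i)
        + scal (r * s) * gen (Ge (i + 1)) * gen (Ge i) ^ 2, 0) \<in> Urs_rels n r s"
  | R6_2: "\<lbrakk>1 \<le> i; i + 1 < n\<rbrakk> \<Longrightarrow>
      (gen (Ge i) * gen (Ge (i + 1)) ^ 2
        - scal (r + s) * gen (Ge (i + 1)) * gen (Ge i) * gen (Ge (i + 1))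
        + scal (r * s) * gen (Ge (i + 1)) ^ 2 * gen (Ge i), 0) \<in> Urs_rels n r s"
  | R7_1: "\<lbrakk>1 \<le> i; i + 1 < n\<rbrakk> \<Longrightarrow>
      (gen (Gf i) ^ 2 * gen (Gf (i + 1))
        - scal (inverse r + inverse s) * gen (Gf i) * gen (Gf (i + 1)) * gen (Gf i)
        + scal (inverse r * inverse s) * gen (Gf (i + 1)) * gen (Gf i) ^ 2, 0) \<in> Urs_rels n r s"
  | R7_2: "\<lbrakk>1 \<le> i; i + 1 < n\<rbrakk> \<Longrightarrow>
      (gen (Gf i) * gen (Gf (i + 1)) ^ 2
        - scal (inverse r + inverse s) * gen (Gf (i + 1)) * gen (Gf i) * gen (Gf (i + 1))
        + scal (inverse r * inverse s) * gen (Gf (i + 1)) ^ 2 * gen (Gf i), 0) \<in> Urs_rels n r s"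

definition Urs :: "nat \<Rightarrow> complex \<Rightarrow> complex \<Rightarrow> (complex, ugen ncpoly set) module"
  where "Urs n r s = presented_alg (Urs_gens n) (Urs_rels n r s)"

definition Urs_el :: "nat \<Rightarrow> complex \<Rightarrow> complex \<Rightarrow> ugen \<Rightarrow> ugen ncpoly set"
  where "Urs_el n r s x = rel_class (Urs_gens n) (Urs_rels n r s) (gen x)"


section \<open>Well-formedness of the presentations and the Gauss decomposition\<close>

lemma free_alg_simps [simp]:
  "mult (free_alg X) = (*)" "one (free_alg X) = 1" "zero (free_alg X) = 0" "add (free_alg X) = (+)"
  by (simp_all add: free_alg_def)

lemma carrier_free_alg:
  "p \<in> carrier (free_alg X) \<longleftrightarrow> (\<forall>w\<in>Poly_Mapping.keys p. set (letters w) \<subseteq> X)"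
  by (simp add: free_alg_def)

lemma free_alg_zero [simp, intro]: "0 \<in> carrier (free_alg X)"
  by (simp add: carrier_free_alg)

lemma free_alg_scal [simp, intro]: "scal c \<in> carrier (free_alg X)"
  by (simp add: carrier_free_alg scal_def zero_fword_def)

lemma free_alg_one [simp, intro]: "1 \<in> carrier (free_alg X)"
  by (simp add: carrier_free_alg zero_fword_def)

lemma free_alg_gen [simp, intro]: "x \<in> X \<Longrightarrow> gen x \<in> carrier (free_alg X)"
  by (simp add: carrier_free_alg gen_def)

lemma free_alg_add [simp, intro]:
  "\<lbrakk>p \<in> carrier (free_alg X); q \<in> carrier (free_alg X)\<rbrakk> \<Longrightarrow> p + q \<in> carrier (free_alg X)"
  using Poly_Mapping.keys_add[of p q] by (auto simp: carrier_free_alg)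

lemma free_alg_uminus [simp, intro]:
  "p \<in> carrier (free_alg X) \<Longrightarrow> - p \<in> carrier (free_alg X)"
  by (auto simp: carrier_free_alg in_keys_iff)

lemma free_alg_diff [simp, intro]:
  "\<lbrakk>p \<in> carrier (free_alg X); q \<in> carrier (free_alg X)\<rbrakk> \<Longrightarrow> p - q \<in> carrier (free_alg X)"
  using free_alg_add[of p X "- q"] by simp

lemma free_alg_mult [simp, intro]:
  assumes "p \<in> carrier (free_alg X)" "q \<in> carrier (free_alg X)"
  shows "p * q \<in> carrier (free_alg X)"
  unfolding carrier_free_alg
proof
  fix w assume "w \<in> Poly_Mapping.keys (p * q)"
  then obtain u v where "u \<in> Poly_Mapping.keys p" "v \<in> Poly_Mapping.keys q" "w = u + v"
    using keys_mult[of p q] by blast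
  then show "set (letters w) \<subseteq> X"
    using assms by (auto simp: carrier_free_alg plus_fword_def)
qed

lemma free_alg_power [simp, intro]:
  "p \<in> carrier (free_alg X) \<Longrightarrow> p ^ k \<in> carrier (free_alg X)"
  by (induction k) auto

lemma free_alg_sum [intro]:
  "(\<And>i. i \<in> I \<Longrightarrow> f i \<in> carrier (free_alg X)) \<Longrightarrow> sum f I \<in> carrier (free_alg X)"
  by (induction I rule: infinite_finite_induct) auto

lemma ring_free_alg: "ring (free_alg X)"
proof (rule ringI)
  show "abelian_group (free_alg X)"
  proof (rule abelian_groupI)
    fix p assume "p \<in> carrier (free_alg X)"
    then show "\<exists>q\<in>carrier (free_alg X). q \<oplus>\<^bsub>free_alg X\<^esub> p = \<zero>\<^bsub>free_alg X\<^esub>"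
      by (intro bexI[of _ "- p"]) auto
  qed (auto simp: algebra_simps)
  show "monoid (free_alg X)"
    by (rule monoidI) (auto simp: algebra_simps)
qed (auto simp: algebra_simps)

locale presentation =
  fixes X :: "'g set" and Rels :: "('g ncpoly \<times> 'g ncpoly) set"
  assumes rels_closed: "(p, q) \<in> Rels \<Longrightarrow> p \<in> carrier (free_alg X) \<and> q \<in> carrier (free_alg X)"
begin

lemma ideal_rel_ideal: "ideal (rel_ideal X Rels) (free_alg X)"
  unfolding rel_ideal_def
  using rels_closed by (intro ring.genideal_ideal[OF ring_free_alg]) auto

lemma ring_presented_alg: "ring (presented_alg X Rels)"
proof -
  interpret Q: ring "free_alg X Quot rel_ideal X Rels"
    by (rule ideal.quotient_is_ring[OF ideal_rel_ideal])
  show ?thesis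
  proof (rule ringI)
    show "abelian_group (presented_alg X Rels)"
      by (rule abelian_groupI)
        (auto simp: presented_alg_def Let_def Q.a_ac intro: Q.l_neg Q.a_inv_closed)
    show "monoid (presented_alg X Rels)"
      by (rule monoidI) (simp_all add: presented_alg_def Let_def Q.m_assoc)
  qed (simp_all add: presented_alg_def Let_def Q.l_distr Q.r_distr)
qed

lemma rel_class_hom: "rel_class X Rels \<in> ring_hom (free_alg X) (presented_alg X Rels)"
  using ideal.rcos_ring_hom[OF ideal_rel_ideal]
  by (auto simp: ring_hom_def rel_class_def presented_alg_def Let_def)

lemma rel_class_closed:
  "p \<in> carrier (free_alg X) \<Longrightarrow> rel_class X Rels p \<in> carrier (presented_alg X Rels)"
  using ring_hom_closed[OF rel_class_hom] .

lemma rel_class_mult: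
  "\<lbrakk>p \<in> carrier (free_alg X); q \<in> carrier (free_alg X)\<rbrakk> \<Longrightarrow>
    rel_class X Rels (p * q) = rel_class X Rels p \<otimes>\<^bsub>presented_alg X Rels\<^esub> rel_class X Rels q"
  using ring_hom_mult[OF rel_class_hom] by simp

lemma rel_class_smult:
  "p \<in> carrier (free_alg X) \<Longrightarrow>
    rel_class X Rels (scal c * p) = c \<odot>\<^bsub>presented_alg X Rels\<^esub> rel_class X Rels p"
  by (simp add: rel_class_mult) (simp add: presented_alg_def Let_def)

lemma rel_class_one: "rel_class X Rels 1 = \<one>\<^bsub>presented_alg X Rels\<^esub>"
  using ring_hom_one[OF rel_class_hom] by simp

lemma rel_class_rel:
  assumes "(p, q) \<in> Rels"
  shows "rel_class X Rels p = rel_class X Rels q"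
proof -
  interpret ideal "rel_ideal X Rels" "free_alg X"
    by (rule ideal_rel_ideal)
  have pq: "p \<in> carrier (free_alg X)" "q \<in> carrier (free_alg X)"
    using rels_closed[OF assms] by auto
  have "p - q \<in> rel_ideal X Rels"
    unfolding rel_ideal_def
    using rels_closed assms by (intro subsetD[OF genideal_self]) auto
  moreover have "p = (p - q) + q" by simp
  ultimately have "p \<in> rel_ideal X Rels +>\<^bsub>free_alg X\<^esub> q"
    unfolding a_r_coset_def' by (auto intro!: bexI[of _ "p - q"])
  then show ?thesis
    unfolding rel_class_def using a_repr_independence'[OF _ pq(2)] by simp
qed

end

lemma Lplus_closed: "\<lbrakk>i \<in> {1..n}; j \<in> {1..n}\<rbrakk> \<Longrightarrow> Lplus i j \<in> carrier (free_alg (UR_gens n))"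
  by (auto simp: Lplus_def UR_gens_def)

lemma Lminus_closed: "\<lbrakk>i \<in> {1..n}; j \<in> {1..n}\<rbrakk> \<Longrightarrow> Lminus i j \<in> carrier (free_alg (UR_gens n))"
  by (auto simp: Lminus_def UR_gens_def)

lemma RLL_closed:
  assumes L: "\<And>i j. \<lbrakk>i \<in> {1..n}; j \<in> {1..n}\<rbrakk> \<Longrightarrow> L i j \<in> carrier (free_alg X)"
    and M: "\<And>i j. \<lbrakk>i \<in> {1..n}; j \<in> {1..n}\<rbrakk> \<Longrightarrow> M i j \<in> carrier (free_alg X)"
    and "(p, q) \<in> RLL_rels n r s L M"
  shows "p \<in> carrier (free_alg X) \<and> q \<in> carrier (free_alg X)"
proof -
  let ?N = "{1..n} \<times> {1..n}"
  have mone: "mone i j \<in> carrier (free_alg X)" for i j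
    by (simp add: mone_def)
  have t: "tens A B x y \<in> carrier (free_alg X)"
    if "\<And>i j. \<lbrakk>i \<in> {1..n}; j \<in> {1..n}\<rbrakk> \<Longrightarrow> A i j \<in> carrier (free_alg X)"
       "\<And>i j. \<lbrakk>i \<in> {1..n}; j \<in> {1..n}\<rbrakk> \<Longrightarrow> B i j \<in> carrier (free_alg X)"
       "x \<in> ?N" "y \<in> ?N" for A B x y
    using that by (auto simp: tens_def)
  have m: "tmult n A B x y \<in> carrier (free_alg X)"
    if "\<And>x y. \<lbrakk>x \<in> ?N; y \<in> ?N\<rbrakk> \<Longrightarrow> A x y \<in> carrier (free_alg X)"
       "\<And>x y. \<lbrakk>x \<in> ?N; y \<in> ?N\<rbrakk> \<Longrightarrow> B x y \<in> carrier (free_alg X)"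
       "x \<in> ?N" "y \<in> ?N" for A B x y
    unfolding tmult_def using that by (intro free_alg_sum free_alg_mult) blast+
  note tL = t[of L mone, OF L mone] and tM = t[of mone M, OF mone M]
  from assms(3) obtain x y where xy: "x \<in> ?N" "y \<in> ?N"
    and p: "p = tmult n (tmult n (\<lambda>x y. scal (Rmat n r s x y)) (tens L mone)) (tens mone M) x y"
    and q: "q = tmult n (tmult n (tens mone M) (tens L mone)) (\<lambda>x y. scal (Rmat n r s x y)) x y"
    unfolding RLL_rels_def Let_def by blast
  show ?thesis
    unfolding p q by (intro conjI m tL tM free_alg_scal xy)
qed

lemma presentation_UR: "presentation (UR_gens n) (UR_rels n r s)"
proof
  fix p q assume "(p, q) \<in> UR_rels n r s"
  then consider "(p, q) \<in> RLL_rels n r s Lplus Lplus" | "(p, q) \<in> RLL_rels n r s Lminus Lminus"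
    | "(p, q) \<in> RLL_rels n r s Lplus Lminus"
    | i where "i \<in> {1..n}" "q = 1"
        "p \<in> {gen (LP i i) * gen (LPinv i), gen (LPinv i) * gen (LP i i),
              gen (LM i i) * gen (LMinv i), gen (LMinv i) * gen (LM i i)}"
    unfolding UR_rels_def by auto
  then show "p \<in> carrier (free_alg (UR_gens n)) \<and> q \<in> carrier (free_alg (UR_gens n))"
  proof cases
    case 4
    then have "{LP i i, LPinv i, LM i i, LMinv i} \<subseteq> UR_gens n"
      by (auto simp: UR_gens_def)
    with 4 show ?thesis by auto
  qed (rule RLL_closed[OF Lplus_closed Lplus_closed] RLL_closed[OF Lminus_closed Lminus_closed]
        RLL_closed[OF Lplus_closed Lminus_closed]; assumption)+
qed

lemma presentation_Urs: "presentation (Urs_gens n) (Urs_rels n r s)"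
proof
  have g: "Ge i \<in> Urs_gens n" "Gf i \<in> Urs_gens n" if "1 \<le> i" "i < n" for i
    using that by (auto simp: Urs_gens_def)
  have h: "Ga i \<in> Urs_gens n" "Gainv i \<in> Urs_gens n" "Gb i \<in> Urs_gens n" "Gbinv i \<in> Urs_gens n"
    if "1 \<le> i" "i \<le> n" for i
    using that by (auto simp: Urs_gens_def Urs_cartan_gens_def)
  have c: "x \<in> Urs_gens n" if "x \<in> Urs_cartan_gens n" for x
    using that by (auto simp: Urs_gens_def)
  fix p q assume "(p, q) \<in> Urs_rels n r s"
  then show "p \<in> carrier (free_alg (Urs_gens n)) \<and> q \<in> carrier (free_alg (Urs_gens n))"
    by (cases rule: Urs_rels.cases) (auto simp: g h c)
qed

lemma ring_UR: "ring (UR n r s)"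
  unfolding UR_def by (rule presentation.ring_presented_alg[OF presentation_UR])

lemma ring_Urs: "ring (Urs n r s)"
  unfolding Urs_def by (rule presentation.ring_presented_alg[OF presentation_Urs])

lemma UR_el_closed: "x \<in> UR_gens n \<Longrightarrow> UR_el n r s x \<in> carrier (UR n r s)"
  unfolding UR_def UR_el_def by (intro presentation.rel_class_closed[OF presentation_UR]) auto

lemma K_Units:
  assumes "i \<in> {1..n}"
  shows "Kplus n r s i \<in> Units (UR n r s)" "Kminus n r s i \<in> Units (UR n r s)"
proof -
  interpret presentation "UR_gens n" "UR_rels n r s" by (rule presentation_UR)
  have X: "LP i i \<in> UR_gens n" "LPinv i \<in> UR_gens n" "LM i i \<in> UR_gens n" "LMinv i \<in> UR_gens n"
    using assms by (auto simp: UR_gens_def)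
  have *: "UR_el n r s x \<in> Units (UR n r s)"
    if "x \<in> UR_gens n" "y \<in> UR_gens n"
      "(gen x * gen y, 1) \<in> UR_rels n r s" "(gen y * gen x, 1) \<in> UR_rels n r s" for x y
    unfolding Units_def UR_def UR_el_def
    using that rel_class_rel[OF that(3)] rel_class_rel[OF that(4)]
    by (auto simp: rel_class_closed rel_class_mult[symmetric] rel_class_one
        intro!: bexI[of _ "rel_class (UR_gens n) (UR_rels n r s) (gen y)"])
  have rels: "(gen (LP i i) * gen (LPinv i), 1) \<in> UR_rels n r s"
    "(gen (LPinv i) * gen (LP i i), 1) \<in> UR_rels n r s"
    "(gen (LM i i) * gen (LMinv i), 1) \<in> UR_rels n r s"
    "(gen (LMinv i) * gen (LM i i), 1) \<in> UR_rels n r s"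
    using assms unfolding UR_rels_def by blast+
  show "Kplus n r s i \<in> Units (UR n r s)" "Kminus n r s i \<in> Units (UR n r s)"
    unfolding Kplus_def Kminus_def using *[OF X(1,2)] *[OF X(3,4)] rels by auto
qed

lemma gauss_plus:
  assumes "1 \<le> i" "i < j" "j \<le> n"
  shows "UR_el n r s (LP i j) = Kplus n r s i \<otimes>\<^bsub>UR n r s\<^esub> Egauss n r s i j"
proof -
  interpret ring "UR n r s" by (rule ring_UR)
  have "Kplus n r s i \<in> Units (UR n r s)" using K_Units assms by simp
  moreover have "UR_el n r s (LP i j) \<in> carrier (UR n r s)"
    using assms by (intro UR_el_closed) (auto simp: UR_gens_def)
  ultimately show ?thesis
    unfolding Egauss_def by (simp add: m_assoc[symmetric] Units_closed)
qed

lemma gauss_minus: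
  assumes "1 \<le> i" "i < j" "j \<le> n"
  shows "UR_el n r s (LM j i) = Fgauss n r s j i \<otimes>\<^bsub>UR n r s\<^esub> Kminus n r s i"
proof -
  interpret ring "UR n r s" by (rule ring_UR)
  have "Kminus n r s i \<in> Units (UR n r s)" using K_Units assms by simp
  moreover have "UR_el n r s (LM j i) \<in> carrier (UR n r s)"
    using assms by (intro UR_el_closed) (auto simp: UR_gens_def)
  ultimately show ?thesis
    unfolding Fgauss_def by (simp add: m_assoc Units_closed)
qed

end

theory Submission
  imports Defs
begin

text \<open>
  The relation \<open>R L\<^sub>1 M\<^sub>2 = M\<^sub>2 L\<^sub>1 R\<close> says entrywise that, with \<open>d\<close> the diagonal of \<open>R\<close>,
  \<open>d(i,k) l\<^sub>i\<^sub>j m\<^sub>k\<^sub>l + [i < k] (s - r) l\<^sub>k\<^sub>j m\<^sub>i\<^sub>l = d(j,l) m\<^sub>k\<^sub>l l\<^sub>i\<^sub>j + [l < j] (s - r) m\<^sub>k\<^sub>j l\<^sub>i\<^sub>l\<close>.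
  For \<open>L = M\<close> these are the relations of a two-parameter quantum matrix (\<open>rll_iff_qmatrix\<close>).
  They contain the commutation of the diagonal with the Gauss factor \<open>E\<close>, the recursion
  \<open>E\<^sub>i\<^sub>l = r/(r - s) (E\<^sub>i\<^sub>j E\<^sub>j\<^sub>l - s E\<^sub>j\<^sub>l E\<^sub>i\<^sub>j)\<close>, which writes all entries by means of the simple ones, and the
  Serre relations; the mixed relations contain the commutators of the simple \<open>E\<close>'s with the simple
  \<open>F\<close>'s (\<open>rll_triangular_to_double_torus\<close>).  So \<open>\<psi>\<close> respects the relations, and it is onto.

  Injectivity is obtained without bases: the recursion defines elements \<open>E\<^sub>i\<^sub>j\<close>, \<open>F\<^sub>j\<^sub>i\<close> of \<open>U\<^sub>r\<^sub>,\<^sub>s(gl\<^sub>n)\<close>, and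
  the resulting triangular matrices satisfy all RLL relations.  For one matrix the relations are the
  quadratic relations between root vectors of type A, which follow from the Serre relations
  (locale \<open>serre\<close>, \<open>serre_torus.qmatrix\<close>); the point where \<open>r + s\<close> has to be
  cancelled is \<open>middle_commutes\<close>.  For the pair \<open>L\<^sup>+, L\<^sup>-\<close> they are the commutators
  \<open>[E\<^sub>i\<^sub>j, F\<^sub>k\<^sub>l]\<close> (\<open>double_torus.commutator\<close>), computed by induction from the simple ones.  This gives a
  homomorphism in the other direction, and both composites fix the generators.

  Two symmetries halve the work.  Transposition turns quantum matrices for \<open>(r, s)\<close> into those for
  \<open>(1/s, 1/r)\<close>, so that \<open>L\<^sup>-\<close> is treated as an upper triangular matrix.  Exchanging the \<open>E\<close>'s with the
  \<open>F\<close>'s and \<open>K\<^sup>+\<close> with \<open>K\<^sup>-\<close> also replaces \<open>(r, s)\<close> by \<open>(1/s, 1/r)\<close> (\<open>double_torus.swap\<close>).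

  All computations take place in a type class \<open>calg\<close> of complex algebras.  They reach the quotient
  algebras, which are records, through the product of all algebras with a given carrier type: by
  \<open>generic_point\<close> it contains a solution of the defining relations whose component at the presented
  algebra consists of the generators.
\<close>

section \<open>Complex algebras\<close>

text \<open>
  Nontriviality \<open>0 \<noteq> 1\<close> is left out, because the product of all algebras with carrier in a one-element
  type, which is to be an instance, is the zero ring.
\<close>

class calg = ring + monoid_mult +
  fixes scaleC :: "complex \<Rightarrow> 'a \<Rightarrow> 'a" (infixr "*:" 75)
  assumes scaleC_add_right: "c *: (x + y) = c *: x + c *: y"
    and scaleC_add_left: "(c + d) *: x = c *: x + d *: x"
    and scaleC_scaleC: "c *: d *: x = (c * d) *: x"
    and scaleC_one: "1 *: x = x"
    and scaleC_mult_left: "(c *: x) * y = c *: (x * y)"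
    and scaleC_mult_right: "x * (c *: y) = c *: (x * y)"
begin

lemma scaleC_zero_right [simp]: "c *: 0 = 0"
  using scaleC_add_right[of c 0 0] by simp

lemma scaleC_zero_left [simp]: "0 *: x = 0"
  using scaleC_add_left[of 0 0 x] by simp

lemma scaleC_minus_right: "c *: (- x) = - (c *: x)"
  using scaleC_add_right[of c x "- x"] by (simp add: eq_neg_iff_add_eq_0 add.commute)

lemma scaleC_minus_left: "(- c) *: x = - (c *: x)"
  using scaleC_add_left[of c "- c" x] by (simp add: eq_neg_iff_add_eq_0 add.commute)

lemma scaleC_diff_right: "c *: (x - y) = c *: x - c *: y"
  using scaleC_add_right[of c x "- y"] by (simp add: scaleC_minus_right)

lemma scaleC_diff_left: "(c - d) *: x = c *: x - d *: x"
  using scaleC_add_left[of c "- d" x] by (simp add: scaleC_minus_left)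

lemma scaleC_cancel: "c \<noteq> 0 \<Longrightarrow> c *: x = c *: y \<longleftrightarrow> x = y"
proof
  assume c: "c \<noteq> 0" and e: "c *: x = c *: y"
  have "inverse c *: c *: x = inverse c *: c *: y" by (simp only: e)
  then show "x = y" using c by (simp add: scaleC_scaleC scaleC_one)
qed simp

lemma scaleC_eq_move: "c \<noteq> 0 \<Longrightarrow> c *: x = y \<longleftrightarrow> x = inverse c *: y"
  using scaleC_cancel[of c x "inverse c *: y"] by (simp add: scaleC_scaleC scaleC_one)

lemmas scaleC_push = scaleC_mult_left scaleC_mult_right scaleC_scaleC scaleC_one
lemmas scaleC_linear = scaleC_add_right scaleC_add_left scaleC_diff_right scaleC_diff_left
  scaleC_minus_right scaleC_minus_left scaleC_push

end

section \<open>Quasi-commutation\<close>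

definition qcomm :: "complex \<Rightarrow> 'a::calg \<Rightarrow> 'a \<Rightarrow> bool"
  where "qcomm c t x \<longleftrightarrow> t * x = c *: (x * t)"

lemma qcommD: "qcomm c t x \<Longrightarrow> t * x = c *: (x * t)"
  by (simp add: qcomm_def)

lemma qcommD2: "qcomm c t x \<Longrightarrow> t * (x * z) = c *: (x * (t * z))"
  by (simp add: qcomm_def mult.assoc[symmetric] scaleC_mult_left[symmetric])

lemma qcomm_mult_right: "qcomm c t x \<Longrightarrow> qcomm d t y \<Longrightarrow> qcomm (c * d) t (x * y)"
  by (simp add: qcomm_def mult.assoc[symmetric] scaleC_push) (simp add: mult.assoc scaleC_push)

lemma qcomm_mult_left: "qcomm c t x \<Longrightarrow> qcomm d u x \<Longrightarrow> qcomm (c * d) (t * u) x"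
  by (simp add: qcomm_def mult.assoc scaleC_push) (simp add: mult.assoc[symmetric] scaleC_push mult.commute)

lemma qcomm_diff: "qcomm c t x \<Longrightarrow> qcomm c t y \<Longrightarrow> qcomm c t (x - y)"
  by (simp add: qcomm_def algebra_simps scaleC_linear)

lemma qcomm_scale: "qcomm c t x \<Longrightarrow> qcomm c t (b *: x)"
  by (simp add: qcomm_def scaleC_linear mult.commute)

lemma qcomm_scale_left: "qcomm c t x \<Longrightarrow> qcomm c (b *: t) x"
  by (simp add: qcomm_def scaleC_linear mult.commute)

lemma qcomm_diff_left: "qcomm c t x \<Longrightarrow> qcomm c u x \<Longrightarrow> qcomm c (t - u) x"
  by (simp add: qcomm_def algebra_simps scaleC_linear)

lemma qcomm_one [simp]: "qcomm 1 1 x" "qcomm 1 t 1"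
  by (simp_all add: qcomm_def scaleC_one)

lemma qcomm_zero [simp]: "qcomm c t 0"
  by (simp add: qcomm_def)

lemma qcomm_sym: "qcomm c t x \<Longrightarrow> c \<noteq> 0 \<Longrightarrow> qcomm (inverse c) x t"
  by (simp add: qcomm_def scaleC_push)

lemma qcomm_1_iff: "qcomm 1 t x \<longleftrightarrow> t * x = x * t"
  by (simp add: qcomm_def scaleC_one)

lemma qcomm_1_sym: "qcomm 1 t x \<Longrightarrow> qcomm 1 x t"
  by (simp add: qcomm_1_iff)

lemma qcomm_inverse:
  assumes "qcomm c t x" "c \<noteq> 0" "t * t' = 1" "t' * t = 1"
  shows "qcomm (inverse c) t' x"
proof -
  have "x * t' = t' * (t * x) * t'" using assms(4) by (simp add: mult.assoc[symmetric])
  also have "\<dots> = c *: (t' * x)"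
    using assms(3) qcommD[OF assms(1)] by (simp add: scaleC_push mult.assoc)
  finally show ?thesis using assms(2) by (simp add: qcomm_def scaleC_push)
qed

section \<open>Root vectors of type A\<close>

text \<open>
  The values at \<open>j \<le> i\<close> make the matrix upper unitriangular, so that it can be used as a Gauss factor
  without case distinctions.  The scaling \<open>k\<close> is a parameter because the Gauss factors of \<open>L\<^sup>+\<close> and \<open>L\<^sup>-\<close>
  need different ones.
\<close>

primrec rootv :: "complex \<Rightarrow> complex \<Rightarrow> (nat \<Rightarrow> 'a::calg) \<Rightarrow> nat \<Rightarrow> nat \<Rightarrow> 'a" where
  "rootv k s x i 0 = (if i = 0 then 1 else 0)"
| "rootv k s x i (Suc j) =
    (if j < i then (if Suc j = i then 1 else 0)
     else if j = i then x i
     else k *: (rootv k s x i j * x j - s *: (x j * rootv k s x i j)))"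

lemma rootv_refl [simp]: "rootv k s x i i = 1"
  by (cases i) auto

lemma rootv_below: "j < i \<Longrightarrow> rootv k s x i j = 0"
  by (cases j) auto

lemma rootv_step: "i < j \<Longrightarrow>
    rootv k s x i (Suc j) = k *: (rootv k s x i j * x j - s *: (x j * rootv k s x i j))"
  by simp

declare rootv.simps(2) [simp del]

lemma rootv_simple [simp]: "rootv k s x i (Suc i) = x i"
  by (simp add: rootv.simps)

lemma rootv_induct [consumes 1, case_names simple step]:
  assumes "i < j" "P (Suc i)" "\<And>j. i < j \<Longrightarrow> P j \<Longrightarrow> P (Suc j)"
  shows "P j"
  using assms(1) by (induction j) (auto intro: assms(2,3) simp: less_Suc_eq)

text \<open>
  An element that commutes with \<open>x\<^sub>m\<close> up to \<open>w\<^sub>m\<^sub>+\<^sub>1 / w\<^sub>m\<close> commutes with a root vector up to the telescoping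
  product of these factors.
\<close>

lemma rootv_qcomm:
  assumes "i < j" and "\<And>m. i \<le> m \<Longrightarrow> m < j \<Longrightarrow> qcomm (w (Suc m) / w m) t (x m)"
    and "\<And>m. w m \<noteq> 0"
  shows "qcomm (w j / w i) t (rootv k s x i j)"
  using assms(1,2)
proof (induction rule: rootv_induct)
  case simple
  then show ?case by simp
next
  case (step j)
  have a: "qcomm (w j / w i) t (rootv k s x i j)" using step by auto
  have b: "qcomm (w (Suc j) / w j) t (x j)" using step by auto
  have c: "w j / w i * (w (Suc j) / w j) = w (Suc j) / w i" using assms(3) by simp
  show ?case
    using step(1) qcomm_mult_right[OF a b] qcomm_mult_right[OF b a]
    unfolding rootv_step[OF step(1)]
    by (intro qcomm_scale qcomm_diff) (simp_all add: c mult.commute assms(3))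
qed

lemma rootv_comm:
  assumes "\<And>m. i \<le> m \<Longrightarrow> m < j \<Longrightarrow> qcomm 1 t (x m)"
  shows "qcomm 1 t (rootv k s x i j)"
proof (cases "i < j")
  case True
  then show ?thesis using rootv_qcomm[of i j "\<lambda>_. 1" t x] assms by simp
next
  case False
  then show ?thesis by (cases "i = j") (auto simp: rootv_below)
qed

text \<open>
  The associated root vectors satisfy the relations
  \<open>E\<^sub>i\<^sub>j E\<^sub>i\<^sub>l = r E\<^sub>i\<^sub>l E\<^sub>i\<^sub>j\<close> (\<open>row\<close>), \<open>E\<^sub>i\<^sub>j E\<^sub>p\<^sub>j = r E\<^sub>p\<^sub>j E\<^sub>i\<^sub>j\<close> (\<open>column\<close>), they commute for disjoint or strictly nested
  intervals, and adjacent or crossing intervals are related by \<open>split\<close> and \<open>crossing\<close>.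
\<close>

locale serre =
  fixes n :: nat and r s k :: complex and x :: "nat \<Rightarrow> 'a::calg"
  assumes s0: "s \<noteq> 0" and r0: "r \<noteq> 0" and rs0: "r + s \<noteq> 0"
    and far: "\<lbrakk>1 \<le> i; i + 1 < j; j < n\<rbrakk> \<Longrightarrow> x i * x j = x j * x i"
    and serre1: "\<lbrakk>1 \<le> i; i + 1 < n\<rbrakk> \<Longrightarrow> x i * (x i * x (i + 1)) - (r + s) *: (x i * (x (i + 1) * x i))
        + (r * s) *: (x (i + 1) * (x i * x i)) = 0"
    and serre2: "\<lbrakk>1 \<le> i; i + 1 < n\<rbrakk> \<Longrightarrow> x i * (x (i + 1) * x (i + 1))
        - (r + s) *: (x (i + 1) * (x i * x (i + 1))) + (r * s) *: (x (i + 1) * (x (i + 1) * x i)) = 0"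
begin

abbreviation E where "E \<equiv> rootv k s x"

lemma disjoint:
  assumes "1 \<le> i" "j < p" "q \<le> n"
  shows "qcomm 1 (E i j) (E p q)"
proof (rule rootv_comm)
  fix m assume m: "p \<le> m" "m < q"
  show "qcomm 1 (E i j) (x m)"
  proof (rule qcomm_1_sym, rule rootv_comm)
    fix l assume l: "i \<le> l" "l < j"
    show "qcomm 1 (x m) (x l)"
      using far[of l m] assms l m by (simp add: qcomm_1_iff)
  qed
qed

text \<open>
  The recursion peels off the last simple factor; the interval can be cut at every inner point because
  \<open>x\<^sub>l\<close> commutes with all root vectors of intervals that end before \<open>l\<close>.
\<close>

lemma split:
  assumes "1 \<le> i" "i < j" "j < l" "l \<le> n"
  shows "E i l = k *: (E i j * E j l - s *: (E j l * E i j))"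
  using assms(3,4)
proof (induction rule: rootv_induct)
  case simple
  then show ?case using rootv_step[OF assms(2)] by simp
next
  case (step l)
  have c: "E i j * x l = x l * E i j"
    using disjoint[of i j l "Suc l"] assms step by (simp add: qcomm_1_iff)
  have c2: "E i j * (x l * z) = x l * (E i j * z)" for z
    by (simp add: mult.assoc[symmetric] c)
  have IH: "E i l = k *: (E i j * E j l - s *: (E j l * E i j))" using step by simp
  have "E i (Suc l) = k *: (E i l * x l - s *: (x l * E i l))"
    using step assms by (intro rootv_step) simp
  then show ?case
    unfolding IH rootv_step[OF step(1)]
    by (simp add: algebra_simps scaleC_linear c c2)
qed

lemma split_simple_left:
  assumes "1 \<le> i" "Suc i < l" "l \<le> n"
  shows "E i l = k *: (x i * E (Suc i) l - s *: (E (Suc i) l * x i))"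
  using split[of i "Suc i" l] assms by simp

text \<open>
  For an interval of length two this is the first Serre relation; a longer interval is split after its
  first two letters, and the rest commutes with \<open>x\<^sub>i\<close>.
\<close>

lemma row_simple:
  assumes "1 \<le> i" "Suc i < l" "l \<le> n"
  shows "qcomm r (x i) (E i l)"
proof -
  have base: "qcomm r (x i) (E i (Suc (Suc i)))"
  proof -
    have "x i * E i (Suc (Suc i)) - r *: (E i (Suc (Suc i)) * x i)
      = k *: (x i * (x i * x (i + 1)) - (r + s) *: (x i * (x (i + 1) * x i))
        + (r * s) *: (x (i + 1) * (x i * x i)))"
      by (simp add: rootv_step algebra_simps scaleC_linear)
    also have "\<dots> = 0" using serre1[of i] assms by simp
    finally show ?thesis by (simp add: qcomm_def)
  qed
  show ?thesis
  proof (cases "l = Suc (Suc i)")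
    case False
    then have l: "Suc (Suc i) < l" using assms by simp
    have c: "qcomm 1 (x i) (E (Suc (Suc i)) l)"
      using disjoint[of i "Suc i" "Suc (Suc i)" l] assms by simp
    show ?thesis
      unfolding split[OF assms(1) _ l assms(3), of , simplified]
      using qcomm_mult_right[OF base c] qcomm_mult_right[OF c base]
      by (intro qcomm_scale qcomm_diff) simp_all
  qed (use base in simp)
qed

text \<open>
  The mirror image of \<open>row_simple\<close>, based on the second Serre relation.
\<close>

lemma column_simple:
  assumes "1 \<le> i" "i < j" "Suc j \<le> n"
  shows "qcomm r (E i (Suc j)) (x j)"
proof -
  obtain p where p: "j = Suc p" using assms by (cases j) auto
  have base: "E p (Suc j) * x j = r *: (x j * E p (Suc j))" if "1 \<le> p"
  proof -
    have "E p (Suc j) * x j - r *: (x j * E p (Suc j))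
      = k *: (x p * (x (p + 1) * x (p + 1))
        - (r + s) *: (x (p + 1) * (x p * x (p + 1))) + (r * s) *: (x (p + 1) * (x (p + 1) * x p)))"
      by (simp add: rootv_step p algebra_simps scaleC_linear)
    also have "\<dots> = 0" using serre2[of p] assms p that by simp
    finally show ?thesis by simp
  qed
  show ?thesis
  proof (cases "i = p")
    case True
    then show ?thesis using base assms by (simp add: qcomm_def)
  next
    case False
    then have i: "i < p" "1 \<le> p" using assms p by auto
    have c: "E i p * x j = x j * E i p"
      using disjoint[of i p j "Suc j"] assms p by (simp add: qcomm_1_iff)
    have c2: "E i p * (x j * z) = x j * (E i p * z)" for z
      by (simp add: mult.assoc[symmetric] c)
    have b2: "E p (Suc j) * (x j * z) = r *: (x j * (E p (Suc j) * z))" for z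
      using base[OF i(2)] by (intro qcommD2) (simp add: qcomm_def)
    have e: "E i (Suc j) = k *: (E i p * E p (Suc j) - s *: (E p (Suc j) * E i p))"
      using split[of i p "Suc j"] i assms p by simp
    show ?thesis
      unfolding e qcomm_def
      by (simp add: algebra_simps scaleC_linear c c2 base[OF i(2)] b2)
  qed
qed

text \<open>
  Here the Serre relations of two neighbouring pairs interact: \<open>r + s\<close> times the commutator is a multiple
  of a combination of the Serre relations for \<open>(x\<^sub>i, x\<^sub>i\<^sub>+\<^sub>1)\<close> and \<open>(x\<^sub>i\<^sub>+\<^sub>1, x\<^sub>i\<^sub>+\<^sub>2)\<close>.
\<close>

lemma middle_commutes:
  assumes "1 \<le> i" "i + 2 < n"
  shows "qcomm 1 (x (i + 1)) (E i (i + 3))"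
proof -
  define X Y Z A where d: "X = x i" "Y = x (i + 1)" "Z = x (i + 2)"
    "A = X * Y - s *: (Y * X)"
  have A: "E i (i + 2) = k *: A" by (simp add: d rootv_step)
  have eq: "E i (i + 3) = k *: (k *: (A * Z - s *: (Z * A)))"
    using rootv_step[of i "i + 2" k s x] unfolding A
    by (simp add: d(3) numeral_3_eq_3 scaleC_push) (simp add: scaleC_linear mult_ac)
  define S S' where e: "S = X * (Y * Y) - (r + s) *: (Y * (X * Y)) + (r * s) *: (Y * (Y * X))"
    "S' = Y * (Y * Z) - (r + s) *: (Y * (Z * Y)) + (r * s) *: (Z * (Y * Y))"
  have 0: "S = 0" "S' = 0"
    using serre2[of i] serre1[of "i + 1"] assms by (simp_all add: d(1-3) e)
  have XZ: "X * Z = Z * X" using far[of i "i + 2"] assms by (simp add: d)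
  have XZ2: "X * (Z * z) = Z * (X * z)" for z by (simp add: mult.assoc[symmetric] XZ)
  \<comment> \<open>The words that contain \<open>Y X Y\<close> or \<open>Y Z Y\<close> are eliminated by the Serre relations, which needs the
      coefficient \<open>r + s\<close>; the rest cancels.\<close>
  have "(r + s) *: (Y * (A * Z - s *: (Z * A)) - (A * Z - s *: (Z * A)) * Y)
     = (s * s) *: (Z * S) - S * Z + X * S' - (s * s) *: (S' * X)"
    unfolding d(4) e by (simp add: algebra_simps scaleC_linear XZ XZ2)
  then have "(r + s) *: (Y * (A * Z - s *: (Z * A))) = (r + s) *: ((A * Z - s *: (Z * A)) * Y)"
    unfolding 0 by (simp add: scaleC_diff_right)
  then show ?thesis
    unfolding eq qcomm_def scaleC_cancel[OF rs0] d(2)[symmetric] by (simp add: scaleC_push)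
qed

text \<open>
  Cut out the three letters around \<open>m\<close>, to which \<open>middle_commutes\<close> applies; the two outer pieces commute
  with \<open>x\<^sub>m\<close> for reasons of distance.
\<close>

lemma nested_simple:
  assumes "1 \<le> i" "i < m" "m + 1 < l" "l \<le> n"
  shows "qcomm 1 (x m) (E i l)"
proof -
  obtain p where p: "m = p + 1" "i \<le> p" using assms by (cases m) auto
  have a: "qcomm 1 (x m) (E p (p + 3))" using middle_commutes[of p] assms p by simp
  have b: "qcomm 1 (x m) (E p l)"
  proof (cases "l = p + 3")
    case False
    then have l: "p + 3 < l" using assms p by simp
    have c: "qcomm 1 (x m) (E (p + 3) l)"
      using disjoint[of m "Suc m" "p + 3" l] assms p by simp
    have e: "E p l = k *: (E p (p + 3) * E (p + 3) l - s *: (E (p + 3) l * E p (p + 3)))"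
      using split[of p "p + 3" l] l assms p by simp
    show ?thesis
      unfolding e using qcomm_mult_right[OF a c] qcomm_mult_right[OF c a]
      by (intro qcomm_scale qcomm_diff) simp_all
  qed (use a in simp)
  show ?thesis
  proof (cases "i = p")
    case False
    then have i: "i < p" using p by simp
    have c: "qcomm 1 (x m) (E i p)"
      using disjoint[of i p m "Suc m"] assms p by (simp add: qcomm_1_sym)
    have e: "E i l = k *: (E i p * E p l - s *: (E p l * E i p))"
      using split[of i p l] i assms p by simp
    show ?thesis
      unfolding e using qcomm_mult_right[OF b c] qcomm_mult_right[OF c b]
      by (intro qcomm_scale qcomm_diff) simp_all
  qed (use b in simp)
qed

lemma nested:
  assumes "1 \<le> i" "i < p" "q < l" "l \<le> n"
  shows "qcomm 1 (E i l) (E p q)"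
  by (rule rootv_comm) (rule qcomm_1_sym, rule nested_simple, use assms in auto)

text \<open>
  \<open>E\<^sub>i\<^sub>j\<close> is made of \<open>x\<^sub>i\<close>, which contributes the factor \<open>r\<close>, and of \<open>E\<^sub>i\<^sub>+\<^sub>1\<^sub>,\<^sub>j\<close>, which commutes with
  \<open>E\<^sub>i\<^sub>l\<close> because it is nested.
\<close>

lemma row:
  assumes "1 \<le> i" "i < j" "j < l" "l \<le> n"
  shows "qcomm r (E i j) (E i l)"
proof (cases "j = Suc i")
  case False
  then have j: "Suc i < j" using assms by simp
  have c: "qcomm 1 (E (Suc i) j) (E i l)" using nested[of i "Suc i" j l] assms by (simp add: qcomm_1_sym)
  have b: "qcomm r (x i) (E i l)" using row_simple[of i l] assms by simp
  have "qcomm r (x i * E (Suc i) j) (E i l)" "qcomm r (E (Suc i) j * x i) (E i l)"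
    using qcomm_mult_left[OF b c] qcomm_mult_left[OF c b] by simp_all
  moreover have e: "E i j = k *: (x i * E (Suc i) j - s *: (E (Suc i) j * x i))"
    using split_simple_left[of i j] assms j by simp
  ultimately show ?thesis
    unfolding e by (intro qcomm_scale_left qcomm_diff_left)
qed (use row_simple[of i l] assms in simp)

lemma column:
  assumes "1 \<le> i" "i < p" "p < j" "j \<le> n"
  shows "qcomm r (E i j) (E p j)"
proof -
  obtain q where q: "j = Suc q" using assms by (cases j) auto
  have b: "qcomm r (E i j) (x q)" using column_simple[of i q] assms q by simp
  show ?thesis
  proof (cases "p = q")
    case False
    then have pq: "p < q" using assms q by simp
    have c: "qcomm 1 (E i j) (E p q)" using nested[of i p q j] assms q by simp
    show ?thesis
      unfolding q rootv_step[OF pq]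
      using qcomm_mult_right[OF b c] qcomm_mult_right[OF c b] q
      by (intro qcomm_scale qcomm_diff) simp_all
  qed (use b q in simp)
qed

text \<open>
  Split \<open>E\<^sub>i\<^sub>j\<close> and \<open>E\<^sub>i\<^sub>l\<close> at \<open>p\<close>.  That \<open>E\<^sub>i\<^sub>l\<close> commutes with the nested \<open>E\<^sub>p\<^sub>j\<close> turns into a rule for the word
  \<open>E\<^sub>p\<^sub>j E\<^sub>i\<^sub>p E\<^sub>p\<^sub>l\<close>, with which both sides reduce to the same combination of words.
\<close>

lemma crossing:
  assumes "1 \<le> i" "i < p" "p < j" "j < l" "l \<le> n" and k: "k \<noteq> 0"
  shows "E i j * E p l - (r * s) *: (E p l * E i j) = (r - s) *: (E i l * E p j)"
proof -
  let ?A = "E i p" and ?B = "E p j" and ?C = "E p l"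
  have e: "E i j = k *: (?A * ?B - s *: (?B * ?A))" and f: "E i l = k *: (?A * ?C - s *: (?C * ?A))"
    using split[of i p j] split[of i p l] assms by auto
  have BC: "?B * ?C = r *: (?C * ?B)" using row[of p j l] assms by (simp add: qcomm_def)
  have BC2: "?B * (?C * z) = r *: (?C * (?B * z))" for z
    using row[of p j l] assms by (intro qcommD2) simp
  have "qcomm 1 ?B (E i l)" using nested[of i p j l] assms by (simp add: qcomm_1_sym)
  then have "k *: (?B * (?A * ?C - s *: (?C * ?A))) = k *: ((?A * ?C - s *: (?C * ?A)) * ?B)"
    unfolding qcomm_1_iff f by (simp add: scaleC_push)
  then have "?B * (?A * ?C - s *: (?C * ?A)) = (?A * ?C - s *: (?C * ?A)) * ?B"
    unfolding scaleC_cancel[OF k] .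
  then have BAC: "?B * (?A * ?C) = ?A * (?C * ?B) - s *: (?C * (?A * ?B)) + (s * r) *: (?C * (?B * ?A))"
    by (simp add: algebra_simps scaleC_linear BC2 BC)
  show ?thesis
    unfolding e f by (simp add: algebra_simps scaleC_linear BC BC2 BAC)
qed

end

section \<open>Two-parameter quantum matrices\<close>

text \<open>
  The diagonal entry of \<open>R\<close> at the basis vector \<open>v\<^sub>i \<otimes> v\<^sub>j\<close>.  The weights of the Cartan generators are its
  quotients: \<open>K\<^sup>+\<^sub>a E\<^sub>b\<^sub>c = (wt a c / wt a b) E\<^sub>b\<^sub>c K\<^sup>+\<^sub>a\<close> and \<open>K\<^sup>-\<^sub>a E\<^sub>b\<^sub>c = (wt b a / wt c a) E\<^sub>b\<^sub>c K\<^sup>-\<^sub>a\<close>.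
\<close>

definition wt :: "complex \<Rightarrow> complex \<Rightarrow> nat \<Rightarrow> nat \<Rightarrow> complex"
  where "wt r s i j = (if i = j then s else if i < j then r * s else 1)"

lemma wt_simps [simp]: "wt r s i i = s" "i < j \<Longrightarrow> wt r s i j = r * s" "j < i \<Longrightarrow> wt r s i j = 1"
  by (simp_all add: wt_def)

lemma wt_nonzero: "r \<noteq> 0 \<Longrightarrow> s \<noteq> 0 \<Longrightarrow> wt r s i j \<noteq> 0"
  by (simp add: wt_def)

text \<open>
  The relations of the two-parameter quantum matrix algebra: they involve the entries of one
  \<open>2 \<times> 2\<close> submatrix, and are in turn for two entries in one row, in one column, on the antidiagonal and
  on the diagonal.
\<close>

definition qmatrix :: "nat \<Rightarrow> complex \<Rightarrow> complex \<Rightarrow> (nat \<Rightarrow> nat \<Rightarrow> 'a::calg) \<Rightarrow> bool"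
  where "qmatrix n r s L \<longleftrightarrow> (\<forall>i\<in>{1..n}. \<forall>j\<in>{1..n}. \<forall>p\<in>{1..n}. \<forall>q\<in>{1..n}.
      (j < q \<longrightarrow> L i j * L i q = r *: (L i q * L i j))
    \<and> (i < p \<longrightarrow> s *: (L i j * L p j) = L p j * L i j)
    \<and> (i < p \<longrightarrow> j < q \<longrightarrow> L p j * L i q = (r * s) *: (L i q * L p j))
    \<and> (i < p \<longrightarrow> j < q \<longrightarrow> L p q * L i j - L i j * L p q = (s - r) *: (L i q * L p j)))"

locale serre_torus = serre n r s k x
  for n :: nat and r s k :: complex and x :: "nat \<Rightarrow> 'a::calg" +
  fixes K :: "nat \<Rightarrow> 'a"
  assumes rs: "r \<noteq> s" and k: "k = r / (r - s)"
    and KK: "\<lbrakk>a \<in> {1..n}; b \<in> {1..n}\<rbrakk> \<Longrightarrow> K a * K b = K b * K a"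
    and Kx: "\<lbrakk>a \<in> {1..n}; m \<in> {1..<n}\<rbrakk> \<Longrightarrow> qcomm (wt r s a (Suc m) / wt r s a m) (K a) (x m)"
begin

lemma k0: "k \<noteq> 0" using rs r0 k by simp

lemma K_qcomm_E:
  assumes "a \<in> {1..n}" "b \<in> {1..n}" "c \<in> {1..n}" "b \<le> c"
  shows "qcomm (wt r s a c / wt r s a b) (K a) (E b c)"
proof (cases "b = c")
  case False
  then show ?thesis
    using assms by (intro rootv_qcomm Kx) (auto simp: wt_nonzero r0 s0)
qed (simp add: wt_nonzero r0 s0)

lemma KE_mult:
  assumes "i \<in> {1..n}" "j \<in> {1..n}" "p \<in> {1..n}" "i \<le> j"
  shows "K i * E i j * (K p * z) = (wt r s p i / wt r s p j) *: (K i * (K p * (E i j * z)))"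
proof -
  have "qcomm (inverse (wt r s p j / wt r s p i)) (E i j) (K p)"
    using K_qcomm_E[of p i j] assms by (intro qcomm_sym) (auto simp: wt_nonzero r0 s0)
  from qcommD2[OF this, of z] show ?thesis
    by (simp add: mult.assoc scaleC_push)
qed

lemma KE_mult_last:
  assumes "i \<in> {1..n}" "j \<in> {1..n}" "p \<in> {1..n}" "i \<le> j"
  shows "K i * E i j * K p = (wt r s p i / wt r s p j) *: (K i * (K p * E i j))"
  using KE_mult[OF assms, of 1] by simp

text \<open>
  Moving all diagonal elements to the left leaves a relation between two root vectors.  For every position
  of the two intervals it is one of those of locale \<open>serre\<close> or trivial.
\<close>

lemma qmatrix: "qmatrix n r s (\<lambda>i j. K i * E i j)"
  unfolding qmatrix_def
proof (intro ballI conjI impI)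
  fix i j p q assume I: "i \<in> {1..n}" "j \<in> {1..n}" "p \<in> {1..n}" "q \<in> {1..n}"
  have KKz: "K a * (K b * z) = K b * (K a * z)" if "a \<in> {1..n}" "b \<in> {1..n}" for a b z
    using KK[of a b] that by (simp add: mult.assoc[symmetric])
  note M = KE_mult KE_mult_last rootv_below KKz KK
  show "K i * E i j * (K i * E i q) = r *: (K i * E i q * (K i * E i j))" if "j < q"
  proof -
    consider "i < j" | "i = j" | "j < i" by linarith
    then show ?thesis
    proof cases
      case 1
      then have "E i j * E i q = r *: (E i q * E i j)"
        using row[of i j q] that I by (simp add: qcomm_def)
      then show ?thesis using 1 that I by (simp add: M scaleC_push)
    qed (use that I r0 s0 in \<open>simp_all add: M scaleC_push\<close>)
  qed
  show "s *: (K i * E i j * (K p * E p j)) = K p * E p j * (K i * E i j)" if "i < p"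
  proof -
    consider "p < j" | "p = j" | "j < p" by linarith
    then show ?thesis
    proof cases
      case 1
      then have "E i j * E p j = r *: (E p j * E i j)"
        using column[of i p j] that I by (simp add: qcomm_def)
      then show ?thesis using 1 that I r0 s0 by (simp add: M scaleC_push)
    qed (use that I r0 s0 in \<open>simp_all add: M scaleC_push\<close>)
  qed
  show "K p * E p j * (K i * E i q) = (r * s) *: (K i * E i q * (K p * E p j))" if "i < p" "j < q"
  proof -
    consider "p < j" | "p = j" | "j < p" by linarith
    then show ?thesis
    proof cases
      case 1
      then have "E p j * E i q = E i q * E p j"
        using nested[of i p j q] that I by (simp add: qcomm_1_iff)
      then show ?thesis using 1 that I r0 s0 by (simp add: M scaleC_push)
    qed (use that I r0 s0 in \<open>simp_all add: M scaleC_push\<close>)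
  qed
  show "K p * E p q * (K i * E i j) - K i * E i j * (K p * E p q) = (s - r) *: (K i * E i q * (K p * E p j))"
    if "i < p" "j < q"
  proof -
    consider "j < p" | "j = p" | "p < j" by linarith
    then show ?thesis
    proof cases
      case 1
      consider "j < i" | "q < p" | "i = j" "p \<le> q" | "i < j" "p \<le> q" by linarith
      then show ?thesis
      proof cases
        case 4
        then have "E i j * E p q = E p q * E i j"
          using disjoint[of i j p q] 1 that I by (cases "p = q") (auto simp: qcomm_1_iff)
        then show ?thesis using 4 1 that I r0 s0 by (simp add: M scaleC_push)
      qed (use 1 that I r0 s0 in \<open>simp_all add: M scaleC_push\<close>)
    next
      case 2
      have e: "E i q = k *: (E i p * E p q - s *: (E p q * E i p))"
        using split[of i p q] 2 that I by simp
      have H: "E p q * E i p - (1 / s) *: (E i p * E p q) = ((s - r) / (r * s)) *: E i q"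
      proof -
        have "E p q * E i p - (1 / s) *: (E i p * E p q)
          = (- (1 / s)) *: (E i p * E p q - s *: (E p q * E i p))"
          using r0 s0 by (simp add: scaleC_diff_right scaleC_push scaleC_minus_left)
        also have "E i p * E p q - s *: (E p q * E i p) = inverse k *: E i q"
          unfolding e using k0 by (simp add: scaleC_push)
        also have "(- (1 / s)) *: inverse k *: E i q = ((s - r) / (r * s)) *: E i q"
        proof -
          have "- (1 / s) * inverse k = (s - r) / (r * s)"
            using rs r0 s0 by (simp add: k divide_simps)
          then show ?thesis by (simp only: scaleC_scaleC)
        qed
        finally show ?thesis .
      qed
      have "K p * E p q * (K i * E i j) - K i * E i j * (K p * E p q)
        = K i * (K p * (E p q * E i p - (1 / s) *: (E i p * E p q)))"
        using 2 that I r0 s0 by (simp add: M scaleC_push right_diff_distrib)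
      also have "\<dots> = (s - r) *: (K i * E i q * (K p * E p j))"
        unfolding H using 2 that I r0 s0 by (simp add: M scaleC_push)
      finally show ?thesis .
    next
      case 3
      have H: "E p q * E i j - (1 / (r * s)) *: (E i j * E p q) = ((s - r) / (r * s)) *: (E i q * E p j)"
      proof -
        have "E p q * E i j - (1 / (r * s)) *: (E i j * E p q)
          = (- (1 / (r * s))) *: (E i j * E p q - (r * s) *: (E p q * E i j))"
          using r0 s0 by (simp add: scaleC_diff_right scaleC_push scaleC_minus_left)
        also have "\<dots> = (- (1 / (r * s))) *: (r - s) *: (E i q * E p j)"
          using crossing[of i p j q] 3 that I k0 by simp
        also have "\<dots> = ((s - r) / (r * s)) *: (E i q * E p j)"
        proof -
          have "- (1 / (r * s)) * (r - s) = (s - r) / (r * s)"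
            using r0 s0 by (simp add: divide_simps)
          then show ?thesis by (simp only: scaleC_scaleC)
        qed
        finally show ?thesis .
      qed
      have "K p * E p q * (K i * E i j) - K i * E i j * (K p * E p q)
        = K i * (K p * (E p q * E i j - (1 / (r * s)) *: (E i j * E p q)))"
        using 3 that I r0 s0 by (simp add: M scaleC_push right_diff_distrib)
      also have "\<dots> = (s - r) *: (K i * E i q * (K p * E p j))"
        unfolding H using 3 that I r0 s0 by (simp add: M scaleC_push)
      finally show ?thesis .
    qed
  qed
qed

end

text \<open>
  Transposition exchanges the row and column relations, which is why \<open>r\<close> and \<open>s\<close> are exchanged
  and inverted.
\<close>

lemma qmatrix_transpose:
  assumes "r \<noteq> 0" "s \<noteq> 0"
  shows "qmatrix n (inverse s) (inverse r) (\<lambda>i j. L j i) \<longleftrightarrow> qmatrix n r s (L :: nat \<Rightarrow> nat \<Rightarrow> 'a::calg)"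
proof -
  have 1: "qmatrix n (inverse s) (inverse r) (\<lambda>i j. L j i)"
    if "qmatrix n r s L" "r \<noteq> 0" "s \<noteq> 0" for r s and L :: "nat \<Rightarrow> nat \<Rightarrow> 'a"
    unfolding qmatrix_def
  proof (intro ballI conjI impI)
    fix i j p q assume I: "i \<in> {1..n}" "j \<in> {1..n}" "p \<in> {1..n}" "q \<in> {1..n}"
    note D = that(1)[unfolded qmatrix_def, rule_format]
    show "L j i * L q i = inverse s *: (L q i * L j i)" if "j < q"
      using D[of j i q q] that I \<open>s \<noteq> 0\<close> by (auto simp: scaleC_eq_move)
    show "inverse r *: (L j i * L j p) = L j p * L j i" if "i < p"
      using D[of j i j p] that I \<open>r \<noteq> 0\<close> by (auto simp: scaleC_push)
    show a: "L j p * L q i = (inverse s * inverse r) *: (L q i * L j p)" if "i < p" "j < q"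
      using D[of j i q p] that I \<open>r \<noteq> 0\<close> \<open>s \<noteq> 0\<close> by (auto simp: scaleC_push field_simps)
    show "L q p * L j i - L j i * L q p = (inverse r - inverse s) *: (L q i * L j p)" if "i < p" "j < q"
    proof -
      have "L q p * L j i - L j i * L q p = (s - r) *: (L j p * L q i)"
        using D[of j i q p] that I by auto
      also have "\<dots> = (inverse r - inverse s) *: (L q i * L j p)"
        unfolding a[OF that] using \<open>r \<noteq> 0\<close> \<open>s \<noteq> 0\<close> by (simp add: scaleC_push divide_simps algebra_simps)
      finally show ?thesis .
    qed
  qed
  show ?thesis using 1[of r s L] 1[of "inverse s" "inverse r" "\<lambda>i j. L j i"] assms by auto
qed

section \<open>Commutators of positive and negative root vectors\<close>

lemma wt_swap:
  assumes "r \<noteq> 0" "s \<noteq> 0"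
  shows "wt (inverse s) (inverse r) i j = wt r s j i / (r * s)"
  using assms by (auto simp: wt_def field_simps)

lemma commute_inverse:
  fixes u v v' :: "'a::calg"
  assumes "v * v' = 1" "v' * v = 1" "u * v = v * u"
  shows "u * v' = v' * u"
  using qcomm_inverse[of 1 v u v'] assms by (simp add: qcomm_1_iff)

text \<open>
  The shape in which commutators with root vectors are computed: a \<open>q\<close>-commutator \<open>e\<close> of \<open>A\<close> and \<open>X\<close> is
  commuted with \<open>Y\<close>, when only \<open>X\<close> contributes.
\<close>

lemma commutator_step:
  fixes A X Y :: "'a::calg"
  assumes "A * Y = Y * A" "X * Y - Y * X = H" "e = k *: (A * X - s *: (X * A))"
  shows "e * Y - Y * e = k *: (A * H - s *: (H * A))"
proof -
  have "A * (Y * z) = Y * (A * z)" for z using assms(1) by (simp add: mult.assoc[symmetric])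
  then show ?thesis
    unfolding assms(2)[symmetric] assms(3) using assms(1) by (simp add: algebra_simps scaleC_linear)
qed

text \<open>
  The common structure behind both algebras: \<open>x\<close>, \<open>y\<close> are multiples of the simple \<open>e\<close>'s and \<open>f\<close>'s, and \<open>K\<close>, \<open>M\<close>
  are the diagonals of \<open>L\<^sup>+\<close> and \<open>L\<^sup>-\<close> with inverses \<open>K'\<close>, \<open>M'\<close>.  Of the scalings
  only the product in \<open>kk\<close> is prescribed; it is the value for which the commutator of \<open>E\<^sub>i\<^sub>j\<close> and \<open>F\<^sub>j\<^sub>i\<close> is \<open>\<eta>\<close> times a difference
  of torus elements for non-simple roots, too (\<open>same\<close>), and it is invariant under the exchange of \<open>x\<close> and \<open>y\<close>.
\<close>

locale double_torus =
  X: serre n r s kE x + Y: serre n "inverse s" "inverse r" kF y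
  for n :: nat and r s kE kF \<eta> :: complex and x y :: "nat \<Rightarrow> 'a::calg" and K K' M M' :: "nat \<Rightarrow> 'a" +
  assumes rs: "r \<noteq> s" and kk: "kE * kF * \<eta> * (r - s) = - r"
    and inv: "a \<in> {1..n} \<Longrightarrow> K a * K' a = 1" "a \<in> {1..n} \<Longrightarrow> K' a * K a = 1"
      "a \<in> {1..n} \<Longrightarrow> M a * M' a = 1" "a \<in> {1..n} \<Longrightarrow> M' a * M a = 1"
    and KK: "\<lbrakk>a \<in> {1..n}; b \<in> {1..n}\<rbrakk> \<Longrightarrow> K a * K b = K b * K a"
    and KM: "\<lbrakk>a \<in> {1..n}; b \<in> {1..n}\<rbrakk> \<Longrightarrow> K a * M b = M b * K a"
    and MM: "\<lbrakk>a \<in> {1..n}; b \<in> {1..n}\<rbrakk> \<Longrightarrow> M a * M b = M b * M a"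
    and Kx: "\<lbrakk>a \<in> {1..n}; m \<in> {1..<n}\<rbrakk> \<Longrightarrow> qcomm (wt r s a (Suc m) / wt r s a m) (K a) (x m)"
    and Ky: "\<lbrakk>a \<in> {1..n}; m \<in> {1..<n}\<rbrakk> \<Longrightarrow> qcomm (wt r s a m / wt r s a (Suc m)) (K a) (y m)"
    and Mx: "\<lbrakk>a \<in> {1..n}; m \<in> {1..<n}\<rbrakk> \<Longrightarrow> qcomm (wt r s m a / wt r s (Suc m) a) (M a) (x m)"
    and My: "\<lbrakk>a \<in> {1..n}; m \<in> {1..<n}\<rbrakk> \<Longrightarrow> qcomm (wt r s (Suc m) a / wt r s m a) (M a) (y m)"
    and xy: "\<lbrakk>i \<in> {1..<n}; j \<in> {1..<n}; i \<noteq> j\<rbrakk> \<Longrightarrow> x i * y j = y j * x i"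
    and xy_same: "i \<in> {1..<n} \<Longrightarrow>
        x i * y i - y i * x i = \<eta> *: (M (Suc i) * M' i - K (Suc i) * K' i)"
begin

abbreviation E where "E \<equiv> rootv kE s x"
abbreviation F where "F \<equiv> rootv kF (inverse r) y"

lemma r0: "r \<noteq> 0" and s0: "s \<noteq> 0"
  using X.r0 X.s0 by auto

lemmas nz = r0 s0 wt_nonzero[OF r0 s0]

text \<open>
  The exchange of the two triangular halves, through which every statement below has a mirror image.
\<close>

lemma swap: "double_torus n (inverse s) (inverse r) kF kE \<eta> y x M M' K K'"
proof -
  \<comment> \<open>Invariance of the constant: \<open>r' - s' = (r - s) / (r s)\<close> for \<open>r' = 1/s\<close>, \<open>s' = 1/r\<close>.\<close>
  have *: "inverse s - inverse r = (r - s) / (r * s)" using nz by (simp add: field_simps)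
  have "kE * kF * \<eta> * (r - s) / (r * s) = - r / (r * s)"
    unfolding kk ..
  then have k: "kF * kE * \<eta> * (inverse s - inverse r) = - inverse s"
    unfolding * using nz by (simp add: field_simps)
  have e: "y i * x i - x i * y i = \<eta> *: (K (Suc i) * K' i - M (Suc i) * M' i)" if "i \<in> {1..<n}" for i
  proof -
    have "y i * x i - x i * y i = - (x i * y i - y i * x i)" by simp
    also have "\<dots> = \<eta> *: (K (Suc i) * K' i - M (Suc i) * M' i)"
      unfolding xy_same[OF that] by (simp add: scaleC_diff_right)
    finally show ?thesis .
  qed
  have "serre n (inverse (inverse r)) (inverse (inverse s)) x"
    using X.serre_axioms by simp
  then show ?thesis
    using rs k inv KK KM MM Kx Ky Mx My xy e nz Y.serre_axioms
    by (intro double_torus.intro double_torus_axioms.intro) (auto simp: wt_swap)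
qed

lemma K_qcomm_E:
  assumes "a \<in> {1..n}" "b \<in> {1..n}" "c \<in> {1..n}" "b \<le> c"
  shows "qcomm (wt r s a c / wt r s a b) (K a) (E b c)"
proof (cases "b = c")
  case False
  then show ?thesis
    using assms by (intro rootv_qcomm Kx) (auto simp: nz)
qed (simp add: nz)

lemma M_qcomm_E:
  assumes "a \<in> {1..n}" "b \<in> {1..n}" "c \<in> {1..n}" "b \<le> c"
  shows "qcomm (wt r s b a / wt r s c a) (M a) (E b c)"
proof (cases "b = c")
  case False
  then have "qcomm (inverse (wt r s c a) / inverse (wt r s b a)) (M a) (E b c)"
    using assms by (intro rootv_qcomm) (auto simp: nz divide_simps intro!: Mx)
  then show ?thesis by (simp add: divide_simps)
qed (simp add: nz)

lemma K_qcomm_F: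
  assumes "a \<in> {1..n}" "b \<in> {1..n}" "c \<in> {1..n}" "b \<le> c"
  shows "qcomm (wt r s a b / wt r s a c) (K a) (F b c)"
  using double_torus.M_qcomm_E[OF swap assms] nz by (simp add: wt_swap)

lemma M_qcomm_F:
  assumes "a \<in> {1..n}" "b \<in> {1..n}" "c \<in> {1..n}" "b \<le> c"
  shows "qcomm (wt r s c a / wt r s b a) (M a) (F b c)"
  using double_torus.K_qcomm_E[OF swap assms] nz by (simp add: wt_swap)

lemma K_ratio_E:
  assumes "a \<in> {1..n}" "a' \<in> {1..n}" "b \<in> {1..n}" "c \<in> {1..n}" "b \<le> c"
  shows "qcomm ((wt r s a c / wt r s a b) * (wt r s a' b / wt r s a' c)) (K a * K' a') (E b c)"
  using qcomm_mult_left[OF K_qcomm_E[of a b c] qcomm_inverse[OF K_qcomm_E[of a' b c], of "K' a'"]] assms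
  by (simp add: inv nz)

lemma M_ratio_E:
  assumes "a \<in> {1..n}" "a' \<in> {1..n}" "b \<in> {1..n}" "c \<in> {1..n}" "b \<le> c"
  shows "qcomm ((wt r s b a / wt r s c a) * (wt r s c a' / wt r s b a')) (M a * M' a') (E b c)"
  using qcomm_mult_left[OF M_qcomm_E[of a b c] qcomm_inverse[OF M_qcomm_E[of a' b c], of "M' a'"]] assms
  by (simp add: inv nz)

lemma K_ratio_F:
  assumes "a \<in> {1..n}" "a' \<in> {1..n}" "b \<in> {1..n}" "c \<in> {1..n}" "b \<le> c"
  shows "qcomm ((wt r s a b / wt r s a c) * (wt r s a' c / wt r s a' b)) (K a * K' a') (F b c)"
  using qcomm_mult_left[OF K_qcomm_F[of a b c] qcomm_inverse[OF K_qcomm_F[of a' b c], of "K' a'"]] assms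
  by (simp add: inv nz)

lemma M_ratio_F:
  assumes "a \<in> {1..n}" "a' \<in> {1..n}" "b \<in> {1..n}" "c \<in> {1..n}" "b \<le> c"
  shows "qcomm ((wt r s c a / wt r s b a) * (wt r s b a' / wt r s c a')) (M a * M' a') (F b c)"
  using qcomm_mult_left[OF M_qcomm_F[of a b c] qcomm_inverse[OF M_qcomm_F[of a' b c], of "M' a'"]] assms
  by (simp add: inv nz)

lemma commute_inverses:
  assumes "a \<in> {1..n}" "b \<in> {1..n}"
  shows "K a * K' b = K' b * K a" "K a * M' b = M' b * K a" "M a * K' b = K' b * M a"
    "M a * M' b = M' b * M a" "K' a * K' b = K' b * K' a" "K' a * M' b = M' b * K' a"
    "M' a * M' b = M' b * M' a"
proof -
  note a = assms(1) and b = assms(2)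
  note invK = commute_inverse[OF inv(1,2)] and invM = commute_inverse[OF inv(3,4)]
  show 1: "K a * K' b = K' b * K a" "K a * M' b = M' b * K a" "M a * K' b = K' b * M a"
      "M a * M' b = M' b * M a"
    using invK[OF b b KK[OF a b]] invM[OF b b KM[OF a b]] invK[OF b b KM[OF b a, symmetric]]
      invM[OF b b MM[OF a b]] .
  have 2: "K b * K' a = K' a * K b" "M b * K' a = K' a * M b" "M b * M' a = M' a * M b"
    using invK[OF a a KK[OF b a]] invK[OF a a KM[OF a b, symmetric]] invM[OF a a MM[OF b a]] .
  show "K' a * K' b = K' b * K' a" "K' a * M' b = M' b * K' a" "M' a * M' b = M' b * M' a"
    using invK[OF b b 2(1)[symmetric]] invM[OF b b 2(2)[symmetric]] invM[OF b b 2(3)[symmetric]] .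
qed

lemma torus_compose:
  assumes "a \<in> {1..n}" "b \<in> {1..n}" "c \<in> {1..n}"
  shows "(K b * K' a) * (K c * K' b) = K c * K' a" "(M b * M' a) * (M c * M' b) = M c * M' a"
proof -
  have *: "(u * v) * (w * u') = w * v" if "u * u' = 1" "u * w = w * u" "v * u' = u' * v" "v * w = w * v"
    for u v w u' :: 'a
  proof -
    have "(u * v) * (w * u') = u * (v * w) * u'" by (simp only: mult.assoc)
    also have "\<dots> = (u * w) * (v * u')" unfolding that(4) by (simp only: mult.assoc)
    also have "\<dots> = w * (u * u') * v" unfolding that(2,3) by (simp only: mult.assoc)
    finally show ?thesis using that(1) by simp
  qed
  show "(K b * K' a) * (K c * K' b) = K c * K' a" "(M b * M' a) * (M c * M' b) = M c * M' a"
    using *[OF inv(1)[OF assms(2)] KK[OF assms(2,3)] commute_inverses(5)[OF assms(1,2)]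
        commute_inverses(1)[OF assms(3,1), symmetric]]
      *[OF inv(3)[OF assms(2)] MM[OF assms(2,3)] commute_inverses(7)[OF assms(1,2)]
        commute_inverses(4)[OF assms(3,1), symmetric]] .
qed

lemma ratios_commute:
  assumes "a \<in> {1..n}" "b \<in> {1..n}" "c \<in> {1..n}" "d \<in> {1..n}"
  shows "(K a * K' b) * (K c * K' d) = (K c * K' d) * (K a * K' b)"
    "(K a * K' b) * (M c * M' d) = (M c * M' d) * (K a * K' b)"
    "(M a * M' b) * (M c * M' d) = (M c * M' d) * (M a * M' b)"
proof -
  have *: "(u * v) * (w * z) = (w * z) * (u * v)"
    if "u * w = w * u" "u * z = z * u" "v * w = w * v" "v * z = z * v" for u v w z :: 'a
  proof -
    have "(u * v) * (w * z) = u * (v * w) * z" by (simp only: mult.assoc)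
    also have "\<dots> = (u * w) * (v * z)" unfolding that(3) by (simp only: mult.assoc)
    also have "\<dots> = w * (u * z) * v" unfolding that(1,4) by (simp only: mult.assoc)
    finally show ?thesis unfolding that(2) by (simp only: mult.assoc)
  qed
  note c = commute_inverses
  show "(K a * K' b) * (K c * K' d) = (K c * K' d) * (K a * K' b)"
    by (rule *[OF KK c(1) c(1)[symmetric] c(5)]) (fact assms)+
  show "(K a * K' b) * (M c * M' d) = (M c * M' d) * (K a * K' b)"
    by (rule *[OF KM c(2) c(3)[symmetric] c(6)]) (fact assms)+
  show "(M a * M' b) * (M c * M' d) = (M c * M' d) * (M a * M' b)"
    by (rule *[OF MM c(4) c(4)[symmetric] c(7)]) (fact assms)+
qed

lemma disjoint_simple:
  assumes "1 \<le> i" "j \<le> n" "m \<in> {1..<n}" "m < i \<or> j \<le> m"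
  shows "qcomm 1 (E i j) (y m)"
proof (rule qcomm_1_sym, rule rootv_comm)
  fix l assume "i \<le> l" "l < j"
  then show "qcomm 1 (y m) (x l)" using assms xy[of l m] by (auto simp: qcomm_1_iff)
qed

lemma disjoint:
  assumes "1 \<le> i" "j \<le> n" "1 \<le> l" "p \<le> n" "p \<le> i \<or> j \<le> l"
  shows "qcomm 1 (E i j) (F l p)"
  by (rule rootv_comm, rule disjoint_simple) (use assms in auto)

text \<open>
  Only the last letter of the interval fails to commute with \<open>y\<^sub>m\<close>.  Of the two torus terms that it produces,
  the one with \<open>K\<close> drops out, since its weight on \<open>E\<^sub>i\<^sub>m\<close> is exactly the \<open>1/s\<close> that the \<open>s\<close>-commutator cancels.
\<close>

lemma right_end:
  assumes "1 \<le> i" "i < m" "m < n"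
  shows "E i (Suc m) * y m - y m * E i (Suc m)
    = (kE * \<eta> * (1 - s / r)) *: (E i m * (M (Suc m) * M' m))"
proof -
  have c: "E i m * y m = y m * E i m" using disjoint_simple[of i m m] assms by (simp add: qcomm_1_iff)
  define W V where WV: "W = M (Suc m) * M' m" "V = K (Suc m) * K' m"
  have W: "W * E i m = (1 / r) *: (E i m * W)"
    using M_ratio_E[of "Suc m" m i m] assms by (simp add: qcomm_def nz WV)
  have V: "V * E i m = (1 / s) *: (E i m * V)"
    using K_ratio_E[of "Suc m" m i m] assms by (simp add: qcomm_def nz WV)
  have "E i (Suc m) * y m - y m * E i (Suc m) = kE *: (E i m * (\<eta> *: (W - V))
      - s *: (\<eta> *: (W - V) * E i m))"
    using commutator_step[OF c xy_same[of m] rootv_step[of i m kE s x]] assms by (simp add: WV)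
  also have "\<dots> = (kE * \<eta> * (1 - s / r)) *: (E i m * W)"
    by (simp add: scaleC_linear W V nz algebra_simps)
  finally show ?thesis unfolding WV .
qed

text \<open>
  Here the \<open>M\<close>-term drops out: its weight on the rest of the interval is \<open>s\<close>.
\<close>

lemma left_end:
  assumes "1 \<le> i" "Suc i < j" "j \<le> n"
  shows "E i j * y i - y i * E i j
    = (- (kE * (r - s) * \<eta>)) *: (E (Suc i) j * (K (Suc i) * K' i))"
proof -
  let ?W = "M (Suc i) * M' i" and ?V = "K (Suc i) * K' i" and ?B = "E (Suc i) j"
  have c: "?B * y i = y i * ?B" using disjoint_simple[of "Suc i" j i] assms by (simp add: qcomm_1_iff)
  have c2: "?B * (y i * z) = y i * (?B * z)" for z by (simp add: mult.assoc[symmetric] c)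
  have W: "?W * ?B = s *: (?B * ?W)"
    using M_ratio_E[of "Suc i" i "Suc i" j] assms by (simp add: qcomm_def nz)
  have V: "?V * ?B = r *: (?B * ?V)"
    using K_ratio_E[of "Suc i" i "Suc i" j] assms by (simp add: qcomm_def nz)
  have "E i j * y i - y i * E i j = kE *: ((x i * y i - y i * x i) * ?B - s *: (?B * (x i * y i - y i * x i)))"
    unfolding X.split_simple_left[OF assms] by (simp add: algebra_simps scaleC_linear c c2)
  also have "x i * y i - y i * x i = \<eta> *: (?W - ?V)" using xy_same[of i] assms by simp
  also have "kE *: (\<eta> *: (?W - ?V) * ?B - s *: (?B * \<eta> *: (?W - ?V))) = (- (kE * (r - s) * \<eta>)) *: (?B * ?V)"
    by (simp only: scaleC_push left_diff_distrib W V) (simp add: algebra_simps scaleC_linear)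
  finally show ?thesis .
qed

text \<open>
  Split after \<open>m\<close>.  By \<open>right_end\<close> the left part produces \<open>E\<^sub>i\<^sub>m\<close> times a torus element of weight \<open>s\<close> on the right
  part, so that the two terms of the \<open>s\<close>-commutator cancel.
\<close>

lemma nested_simple:
  assumes "1 \<le> i" "i < m" "Suc m < j" "j \<le> n"
  shows "qcomm 1 (E i j) (y m)"
proof -
  let ?A = "E i (Suc m)" and ?B = "E (Suc m) j" and ?C = "E i m" and ?W = "M (Suc m) * M' m"
  have 1: "?A * y m = y m * ?A + (kE * \<eta> * (1 - s / r)) *: (?C * ?W)"
    using right_end[of i m] assms by (simp add: algebra_simps)
  have c: "?B * y m = y m * ?B"
    using disjoint_simple[of "Suc m" j m] assms by (simp add: qcomm_1_iff)
  have CB: "?B * ?C = ?C * ?B"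
    using X.disjoint[of i m "Suc m" j] assms by (simp add: qcomm_1_iff)
  have W: "?W * ?B = s *: (?B * ?W)"
    using M_ratio_E[of "Suc m" m "Suc m" j] assms by (simp add: qcomm_def nz)
  have e: "E i j = kE *: (?A * ?B - s *: (?B * ?A))" using X.split[of i "Suc m" j] assms by simp
  have "(?A * ?B) * y m = y m * (?A * ?B) + (kE * \<eta> * (1 - s / r)) *: (?C * (?W * ?B))"
    unfolding mult.assoc c unfolding mult.assoc[symmetric] 1 by (simp add: algebra_simps scaleC_linear)
  moreover have "(?B * ?A) * y m = y m * (?B * ?A) + (kE * \<eta> * (1 - s / r)) *: (?C * (?B * ?W))"
  proof -
    have "(?B * ?A) * y m = ?B * (y m * ?A + (kE * \<eta> * (1 - s / r)) *: (?C * ?W))"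
      unfolding mult.assoc 1 ..
    also have "\<dots> = (?B * y m) * ?A + (kE * \<eta> * (1 - s / r)) *: ((?B * ?C) * ?W)"
      by (simp only: distrib_left scaleC_mult_right mult.assoc)
    finally show ?thesis unfolding c CB by (simp only: mult.assoc)
  qed
  ultimately show ?thesis
    unfolding qcomm_1_iff e W by (simp add: left_diff_distrib right_diff_distrib scaleC_push scaleC_add_right mult_ac)
qed

lemma nested:
  assumes "1 \<le> i" "i < l" "p < j" "j \<le> n"
  shows "qcomm 1 (E i j) (F l p)"
  by (rule rootv_comm) (use nested_simple assms in auto)

text \<open>
  Induction on the length of \<open>F\<close>.  Each further letter shortens \<open>E\<close> from the left, by \<open>left_end\<close>, and multiplies
  by a constant that \<open>kk\<close> makes \<open>1\<close>; the ratios of neighbouring \<open>K\<close>'s telescope.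
\<close>

lemma same_left:
  assumes "1 \<le> i" "i < p" "p < j" "j \<le> n"
  shows "E i j * F i p - F i p * E i j = (- (kE * (r - s) * \<eta>)) *: (E p j * (K p * K' i))"
  using assms(2,3)
proof (induction rule: rootv_induct)
  case simple
  then show ?case using left_end[of i j] assms by simp
next
  case (step p)
  define c where "c = - (kE * (r - s) * \<eta>)"
  define S where S_def: "S = K p * K' i"
  let ?D = "E p j"
  have IH: "E i j * F i p - F i p * E i j = c *: (?D * S)" using step by (simp add: c_def S_def)
  have com: "E i j * y p = y p * E i j" using nested_simple[of i p j] step assms by (simp add: qcomm_1_iff)
  have com2: "E i j * (y p * z) = y p * (E i j * z)" for z by (simp add: mult.assoc[symmetric] com)
  have S: "S * y p = inverse r *: (y p * S)"
    using K_ratio_F[of p i p "Suc p"] step assms by (simp add: qcomm_def nz S_def inverse_eq_divide)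
  have D: "?D * y p - y p * ?D = c *: (E (Suc p) j * (K (Suc p) * K' p))"
    using left_end[of p j] step assms by (simp add: c_def)
  have "E i j * F i (Suc p) - F i (Suc p) * E i j
      = kF *: ((E i j * F i p - F i p * E i j) * y p - inverse r *: (y p * (E i j * F i p - F i p * E i j)))"
    unfolding rootv_step[OF step(1)] by (simp add: algebra_simps scaleC_linear com com2)
  also have "\<dots> = (kF * c * inverse r) *: ((?D * y p - y p * ?D) * S)"
    unfolding IH scaleC_push mult.assoc S by (simp add: left_diff_distrib scaleC_push scaleC_diff_right mult.assoc mult_ac)
  also have "\<dots> = (kF * c * inverse r * c) *: (E (Suc p) j * (K (Suc p) * K' i))"
  proof -
    have "(K (Suc p) * K' p) * S = K (Suc p) * K' i"
      using torus_compose(1)[of i p "Suc p"] ratios_commute(1)[of "Suc p" p p i] step assms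
      by (simp add: S_def)
    then show ?thesis unfolding D by (simp add: scaleC_push mult.assoc)
  qed
  also have "kF * c * inverse r * c = c"
  proof -
    have "kF * c * inverse r = - (kE * kF * \<eta> * (r - s)) * inverse r" by (simp add: c_def algebra_simps)
    also have "\<dots> = 1" unfolding kk using nz by simp
    finally show ?thesis by simp
  qed
  finally show ?case unfolding c_def S_def .
qed

text \<open>
  Induction on the length, adding the last letter to both root vectors.  Apart from the expected difference
  the calculation produces products of one \<open>M\<close>-ratio and one \<open>K\<close>-ratio, and these cancel.
\<close>

lemma same:
  assumes "1 \<le> i" "i < j" "j \<le> n"
  shows "E i j * F i j - F i j * E i j = \<eta> *: (M j * M' i - K j * K' i)"
  using assms(2,3)
proof (induction rule: rootv_induct)
  case simple
  then show ?case using xy_same[of i] assms by simp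
next
  case (step j)
  define A B X Y P Q W V where d: "A = E i j" "B = F i j" "X = x j" "Y = y j"
    "P = M j * M' i" "Q = K j * K' i" "W = M (Suc j) * M' j" "V = K (Suc j) * K' j"
  have I: "i \<in> {1..n}" "j \<in> {1..n}" "Suc j \<in> {1..n}" using step assms by auto
  have IH: "A * B = B * A + \<eta> *: (P - Q)" using step by (simp add: d algebra_simps)
  have XY: "X * Y = Y * X + \<eta> *: (W - V)" using xy_same[of j] I by (simp add: d algebra_simps)
  have AY: "A * Y = Y * A" using disjoint_simple[of i j j] I by (simp add: d qcomm_1_iff)
  have XB: "X * B = B * X"
    using double_torus.disjoint_simple[OF swap, of i j j] I by (simp add: d qcomm_1_iff)
  have WA: "W * A = (1 / r) *: (A * W)" using M_ratio_E[of "Suc j" j i j] step I by (simp add: qcomm_def d nz)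
  have VA: "V * A = (1 / s) *: (A * V)" using K_ratio_E[of "Suc j" j i j] step I by (simp add: qcomm_def d nz)
  have WB: "W * B = r *: (B * W)" using M_ratio_F[of "Suc j" j i j] step I by (simp add: qcomm_def d nz)
  have VB: "V * B = s *: (B * V)" using K_ratio_F[of "Suc j" j i j] step I by (simp add: qcomm_def d nz)
  have PX: "P * X = s *: (X * P)" using M_ratio_E[of j i j "Suc j"] step I by (simp add: qcomm_def d nz)
  have QX: "Q * X = r *: (X * Q)" using K_ratio_E[of j i j "Suc j"] step I by (simp add: qcomm_def d nz)
  have PY: "P * Y = (1 / s) *: (Y * P)" using M_ratio_F[of j i j "Suc j"] step I by (simp add: qcomm_def d nz)
  have QY: "Q * Y = (1 / r) *: (Y * Q)" using K_ratio_F[of j i j "Suc j"] step I by (simp add: qcomm_def d nz)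
  have tor: "W * P = P * W" "V * P = P * V" "W * Q = Q * W" "V * Q = Q * V"
    using ratios_commute I by (simp_all add: d)
  have PW: "P * W = M (Suc j) * M' i" "Q * V = K (Suc j) * K' i"
    using torus_compose[of i j "Suc j"] ratios_commute(1)[of j i "Suc j" j] ratios_commute(3)[of j i "Suc j" j] I
    by (simp_all add: d)
  have assoc: "a * (b * z) = c *: (b * (a * z))" if "a * b = c *: (b * a)" for a b z :: 'a and c
    using that by (simp add: mult.assoc[symmetric] scaleC_mult_left)
  have assoc1: "a * (b * z) = b * (a * z)" if "a * b = b * a" for a b z :: 'a
    using that by (simp add: mult.assoc[symmetric])
  have assoc2: "a * (b * z) = b * (a * z) + \<eta> *: (p * z - q * z)"
    if "a * b = b * a + \<eta> *: (p - q)" for a b p q z :: 'a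
    using that by (simp add: mult.assoc[symmetric]) (simp add: algebra_simps scaleC_linear)
  \<comment> \<open>Rewriting with these rules puts words into normal form: negative letters to the left of positive ones,
      torus elements to the right of both.\<close>
  note rules = AY XB WA VA WB VB PX QX PY QY assoc1[OF AY] assoc1[OF XB]
    assoc[OF WA] assoc[OF VA] assoc[OF WB] assoc[OF VB] assoc[OF PX] assoc[OF QX] assoc[OF PY] assoc[OF QY]
    IH XY assoc2[OF IH] assoc2[OF XY] tor
  have e: "E i (Suc j) = kE *: (A * X - s *: (X * A))"
    and f: "F i (Suc j) = kF *: (B * Y - (1 / r) *: (Y * B))"
    using step by (simp_all add: rootv_step d inverse_eq_divide)
  have main: "(A * X - s *: (X * A)) * (B * Y - (1 / r) *: (Y * B))
      - (B * Y - (1 / r) *: (Y * B)) * (A * X - s *: (X * A))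
      = (\<eta> * \<eta> * (s / r - 1)) *: (P * W - Q * V)"
    using r0 s0 by (simp add: rules algebra_simps scaleC_linear)
  have "E i (Suc j) * F i (Suc j) - F i (Suc j) * E i (Suc j)
     = (kE * kF) *: ((A * X - s *: (X * A)) * (B * Y - (1 / r) *: (Y * B))
      - (B * Y - (1 / r) *: (Y * B)) * (A * X - s *: (X * A)))"
  proof -
    have "(kE *: a) * (kF *: b) - (kF *: b) * (kE *: a) = (kE * kF) *: (a * b - b * a)" for a b :: 'a
      by (simp add: scaleC_linear mult.commute)
    then show ?thesis unfolding e f .
  qed
  also have "\<dots> = (kE * kF * (\<eta> * \<eta> * (s / r - 1))) *: (P * W - Q * V)"
    unfolding main by (simp only: scaleC_scaleC)
  also have "kE * kF * (\<eta> * \<eta> * (s / r - 1)) = \<eta>"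
  proof -
    have "kE * kF * (\<eta> * \<eta> * (s / r - 1)) = - (kE * kF * \<eta> * (r - s)) * \<eta> / r"
      using nz by (simp add: field_simps)
    then show ?thesis unfolding kk using nz by simp
  qed
  finally show ?case unfolding PW .
qed

text \<open>
  The surplus part \<open>F\<^sub>l\<^sub>i\<close> commutes with \<open>E\<^sub>i\<^sub>j\<close>, so that the commutator arises from \<open>same\<close>; the weight
  of the \<open>M\<close>-term on \<open>F\<^sub>l\<^sub>i\<close> makes it drop out.
\<close>

lemma same_right:
  assumes "1 \<le> l" "l < i" "i < j" "j \<le> n"
  shows "E i j * F l j - F l j * E i j = (- (kF * (r - s) / r * \<eta>)) *: (F l i * (K j * K' i))"
proof -
  let ?F = "F l i"
  define P Q where d: "P = M j * M' i" "Q = K j * K' i"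
  have c: "E i j * ?F = ?F * E i j" using disjoint[of i j l i] assms by (simp add: qcomm_1_iff)
  have c2: "E i j * (?F * z) = ?F * (E i j * z)" for z by (simp add: mult.assoc[symmetric] c)
  have f: "F l j = kF *: (?F * F i j - inverse r *: (F i j * ?F))"
    using Y.split[of l i j] assms by simp
  have P: "P * ?F = r *: (?F * P)"
    using M_ratio_F[of j i l i] assms by (simp add: qcomm_def d nz)
  have Q: "Q * ?F = s *: (?F * Q)"
    using K_ratio_F[of j i l i] assms by (simp add: qcomm_def d nz)
  have "E i j * F l j - F l j * E i j = kF *: (?F * (E i j * F i j - F i j * E i j)
      - inverse r *: ((E i j * F i j - F i j * E i j) * ?F))"
    unfolding f by (simp add: algebra_simps scaleC_linear c c2)
  also have "E i j * F i j - F i j * E i j = \<eta> *: (P - Q)"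
    using same[of i j] assms by (simp add: d)
  also have "kF *: (?F * \<eta> *: (P - Q) - inverse r *: (\<eta> *: (P - Q) * ?F)) =
      (- (kF * (r - s) / r * \<eta>)) *: (?F * Q)"
  proof -
    have "kF *: (?F * \<eta> *: (P - Q) - inverse r *: (\<eta> *: (P - Q) * ?F))
       = (kF * \<eta> * (inverse r * s - 1)) *: (?F * Q)"
      by (simp add: scaleC_linear P Q nz algebra_simps)
    also have "kF * \<eta> * (inverse r * s - 1) = - (kF * (r - s) / r * \<eta>)"
      using nz by (simp add: field_simps)
    finally show ?thesis .
  qed
  finally show ?thesis unfolding d .
qed

text \<open>
  As for \<open>same_right\<close>, with \<open>same_left\<close> in the place of \<open>same\<close>.
\<close>

lemma crossing:
  assumes "1 \<le> l" "l < i" "i < p" "p < j" "j \<le> n"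
  shows "E i j * F l p - F l p * E i j = (r - s) *: (E p j * F l i * (K p * K' i))"
proof -
  let ?F = "F l i" and ?E = "E p j"
  define Q where d: "Q = K p * K' i"
  define c where c: "c = - (kE * (r - s) * \<eta>)"
  have com: "E i j * ?F = ?F * E i j" using disjoint[of i j l i] assms by (simp add: qcomm_1_iff)
  have com2: "E i j * (?F * z) = ?F * (E i j * z)" for z by (simp add: mult.assoc[symmetric] com)
  have EF: "?F * ?E = ?E * ?F" using disjoint[of p j l i] assms by (simp add: qcomm_1_iff)
  have f: "F l p = kF *: (?F * F i p - inverse r *: (F i p * ?F))"
    using Y.split[of l i p] assms by simp
  have Q: "Q * ?F = s *: (?F * Q)"
    using K_ratio_F[of p i l i] assms by (simp add: qcomm_def d nz)
  have "E i j * F l p - F l p * E i j = kF *: (?F * (E i j * F i p - F i p * E i j)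
      - inverse r *: ((E i j * F i p - F i p * E i j) * ?F))"
    unfolding f by (simp add: algebra_simps scaleC_linear com com2)
  also have "E i j * F i p - F i p * E i j = c *: (?E * Q)"
    using same_left[of i p j] assms by (simp add: d c)
  also have "kF *: (?F * c *: (?E * Q) - inverse r *: (c *: (?E * Q) * ?F))
    = (kF * c * (1 - inverse r * s)) *: (?E * ?F * Q)"
  proof -
    have "?F * (?E * Q) = ?E * ?F * Q" by (simp only: mult.assoc[symmetric] EF)
    moreover have "?E * Q * ?F = s *: (?E * ?F * Q)" by (simp add: mult.assoc Q scaleC_push)
    ultimately show ?thesis by (simp add: scaleC_push scaleC_diff_right scaleC_diff_left algebra_simps)
  qed
  also have "kF * c * (1 - inverse r * s) = r - s"
  proof -
    have "kF * c * (1 - inverse r * s) = - (kE * kF * \<eta> * (r - s)) * (1 - s / r)"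
      by (simp add: c inverse_eq_divide algebra_simps)
    then show ?thesis unfolding kk using nz by (simp add: field_simps)
  qed
  finally show ?thesis unfolding d .
qed

end

section \<open>The RLL relations entry by entry\<close>

definition rll :: "nat \<Rightarrow> complex \<Rightarrow> complex \<Rightarrow> (nat \<Rightarrow> nat \<Rightarrow> 'a::calg) \<Rightarrow> (nat \<Rightarrow> nat \<Rightarrow> 'a) \<Rightarrow> bool"
  where "rll n r s L N \<longleftrightarrow> (\<forall>i\<in>{1..n}. \<forall>j\<in>{1..n}. \<forall>p\<in>{1..n}. \<forall>q\<in>{1..n}.
      wt r s i p *: (L i j * N p q) + (if i < p then (s - r) *: (L p j * N i q) else 0)
    = wt r s j q *: (N p q * L i j) + (if q < j then (s - r) *: (N p j * L i q) else 0))"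

lemma rllD:
  assumes "rll n r s L N" "i \<in> {1..n}" "j \<in> {1..n}" "p \<in> {1..n}" "q \<in> {1..n}"
  shows "wt r s i p *: (L i j * N p q) + (if i < p then (s - r) *: (L p j * N i q) else 0)
    = wt r s j q *: (N p q * L i j) + (if q < j then (s - r) *: (N p j * L i q) else 0)"
  using assms(1)[unfolded rll_def, rule_format, OF assms(2-5)] .

lemma qmatrixD:
  assumes "qmatrix n r s L" "i \<in> {1..n}" "j \<in> {1..n}" "p \<in> {1..n}" "q \<in> {1..n}"
  shows "j < q \<Longrightarrow> L i j * L i q = r *: (L i q * L i j)"
    "i < p \<Longrightarrow> s *: (L i j * L p j) = L p j * L i j"
    "i < p \<Longrightarrow> j < q \<Longrightarrow> L p j * L i q = (r * s) *: (L i q * L p j)"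
    "i < p \<Longrightarrow> j < q \<Longrightarrow> L p q * L i j - L i j * L p q = (s - r) *: (L i q * L p j)"
  using assms(1)[unfolded qmatrix_def, rule_format, OF assms(2-5)] by auto

text \<open>
  The relations of a quantum matrix are entries of the RLL relation; its other entries, with two terms on
  one side or on both, are combinations of them.
\<close>

lemma rll_iff_qmatrix:
  assumes "r \<noteq> 0" "s \<noteq> 0"
  shows "rll n r s L L \<longleftrightarrow> qmatrix n r s (L :: nat \<Rightarrow> nat \<Rightarrow> 'a::calg)"
proof
  assume R: "rll n r s L L"
  show "qmatrix n r s L"
    unfolding qmatrix_def
  proof (intro ballI conjI impI)
    fix i j p q assume I: "i \<in> {1..n}" "j \<in> {1..n}" "p \<in> {1..n}" "q \<in> {1..n}"
    show "L i j * L i q = r *: (L i q * L i j)" if "j < q"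
    proof -
      have "s *: (L i j * L i q) = s *: r *: (L i q * L i j)"
        using rllD[OF R I(1,2,1,4)] that by (simp add: scaleC_scaleC mult.commute)
      then show ?thesis unfolding scaleC_cancel[OF assms(2)] .
    qed
    show "s *: (L i j * L p j) = L p j * L i j" if "i < p"
    proof -
      have "(r * s) *: (L i j * L p j) = r *: (L p j * L i j)"
        using rllD[OF R I(1,2,3,2)] that by (simp add: scaleC_diff_left algebra_simps)
      then have "r *: (s *: (L i j * L p j)) = r *: (L p j * L i j)" by (simp add: scaleC_push)
      then show ?thesis unfolding scaleC_cancel[OF assms(1)] .
    qed
    show "L p j * L i q = (r * s) *: (L i q * L p j)" if "i < p" "j < q"
      using rllD[OF R I(3,2,1,4)] that by (simp add: scaleC_one)
    show "L p q * L i j - L i j * L p q = (s - r) *: (L i q * L p j)" if "i < p" "j < q"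
      using rllD[OF R I(3,4,1,2)] that by (simp add: scaleC_one)
  qed
next
  assume Q: "qmatrix n r s L"
  show "rll n r s L L"
    unfolding rll_def
  proof (intro ballI)
    fix i j p q assume I: "i \<in> {1..n}" "j \<in> {1..n}" "p \<in> {1..n}" "q \<in> {1..n}"
    show "wt r s i p *: (L i j * L p q) + (if i < p then (s - r) *: (L p j * L i q) else 0)
      = wt r s j q *: (L p q * L i j) + (if q < j then (s - r) *: (L p j * L i q) else 0)"
    proof (rule linorder_cases[of i p]; rule linorder_cases[of j q])
      assume c: "i < p" "j < q"
      have "(r * s) *: (L p q * L i j - L i j * L p q) = (s - r) *: (L p j * L i q)"
        unfolding qmatrixD(4)[OF Q I c] qmatrixD(3)[OF Q I c] by (simp add: scaleC_push mult_ac)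
      then show ?thesis using c by (simp add: scaleC_diff_right algebra_simps)
    next
      assume c: "i < p" "j = q"
      have "r *: (s *: (L i j * L p j)) = r *: (L p j * L i j)"
        unfolding qmatrixD(2)[OF Q I(1,2,3,2) c(1)] ..
      then show ?thesis using c by (simp add: scaleC_push scaleC_diff_left)
    next
      assume c: "i < p" "q < j"
      show ?thesis using qmatrixD(3)[OF Q I(1,4,3,2) c] c by (simp add: scaleC_one)
    next
      assume c: "i = p" "j < q"
      show ?thesis using qmatrixD(1)[OF Q I c(2)] c by (simp add: scaleC_push mult_ac)
    next
      assume c: "i = p" "q < j"
      show ?thesis using qmatrixD(1)[OF Q I(1,4,1,2) c(2)] c
        by (simp add: scaleC_push scaleC_diff_left)
    next
      assume c: "p < i" "j < q"
      show ?thesis using qmatrixD(3)[OF Q I(3,2,1,4) c] c by (simp add: scaleC_one)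
    next
      assume c: "p < i" "j = q"
      show ?thesis using qmatrixD(2)[OF Q I(3,2,1,2) c(1)] c by (simp add: scaleC_one)
    next
      assume c: "p < i" "q < j"
      show ?thesis using qmatrixD(4)[OF Q I(3,4,1,2) c] c by (simp add: scaleC_one algebra_simps)
    qed auto
  qed
qed

context double_torus
begin

text \<open>
  All relative positions of the two intervals.  Of the overlapping ones, those where \<open>F\<close> extends further to the right, and those
  where only the right ends coincide with \<open>E\<close> the longer one, are the mirror images of the others.
\<close>

lemma commutator:
  assumes "kE = r / (r - s)" "kF = r * s / (r - s)" "\<eta> = (s - r) / (r * s)"
    and I: "i \<in> {1..n}" "j \<in> {1..n}" "l \<in> {1..n}" "p \<in> {1..n}" "i \<le> j" "l \<le> p"
  shows "E i j * F l p - F l p * E i j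
    = (if i \<le> l \<and> l < j \<and> j \<le> p then \<eta> *: (F j p * E i l * (M j * M' l)) else 0)
    - (if l \<le> i \<and> i < p \<and> p \<le> j then (\<eta> * wt r s p j / wt r s i l) *: (E p j * F l i * (K p * K' i)) else 0)"
proof -
  have neg: "u - v = c *: w" if "v - u = (- c) *: w" for u v w :: 'a and c
    using arg_cong[OF that, of uminus] by (simp add: scaleC_minus_left)
  have rs': "r - s \<noteq> 0" using rs by simp
  have k1: "- (kE * (r - s) * \<eta>) = - (\<eta> * r)" using rs' by (simp add: assms(1))
  have k2: "- (kF * (r - s) / r * \<eta>) = - (\<eta> * s)" using rs' nz by (simp add: assms(2))
  have ri: "inverse s - inverse r = (r - s) / (r * s)" using nz by (simp add: field_simps)
  have k3: "- (kF * (inverse s - inverse r) * \<eta>) = - \<eta>" unfolding ri using rs' nz by (simp add: assms(2))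
  have k4: "- (kE * (inverse s - inverse r) / inverse s * \<eta>) = - \<eta>" unfolding ri using rs' nz by (simp add: assms(1))
  have k5: "inverse s - inverse r = - \<eta>" unfolding ri assms(3) using nz by (simp add: field_simps)
  have k6: "\<eta> * (r * s) = - (r - s)" using nz by (simp add: assms(3))
  consider "i = j \<or> l = p" | "i < j" "l < p" "i = l" | "i < j" "l < p" "i < l" | "i < j" "l < p" "l < i"
    using I by linarith
  then show ?thesis
  proof cases
    case 1
    then show ?thesis by auto
  next
    case 2
    consider "p < j" | "p = j" | "j < p" by linarith
    then show ?thesis
    proof cases
      case 1
      then show ?thesis using same_left[of i p j] 2 I nz unfolding k1 by (simp add: scaleC_minus_left)
    next
      case p: 2
      then show ?thesis using same[of i j] 2 I nz by (simp add: scaleC_diff_right)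
    next
      case 3
      then show ?thesis
        using neg[OF double_torus.same_left[OF swap, of i j p, unfolded inverse_inverse_eq k3]] 2 I by simp
    qed
  next
    case 3
    consider "j \<le> l" | "l < j" "p < j" | "l < j" "p = j" | "l < j" "j < p" by linarith
    then show ?thesis
    proof cases
      case 1
      then show ?thesis using disjoint[of i j l p] 3 I by (simp add: qcomm_1_iff)
    next
      case 2
      then show ?thesis using nested[of i l p j] 3 I by (simp add: qcomm_1_iff)
    next
      case p: 3
      then show ?thesis
        using neg[OF double_torus.same_right[OF swap, of i l j, unfolded inverse_inverse_eq k4]] 3 I by simp
    next
      case 4
      then show ?thesis
        using neg[OF double_torus.crossing[OF swap, of i l j p, unfolded inverse_inverse_eq k5]] 3 I by simp
    qed
  next
    case 4
    consider "p \<le> i" | "i < p" "p < j" | "i < p" "p = j" | "i < p" "j < p" by linarith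
    then show ?thesis
    proof cases
      case 1
      then show ?thesis using disjoint[of i j l p] 4 I by (simp add: qcomm_1_iff)
    next
      case 2
      then show ?thesis using crossing[of l i p j] 4 I nz by (simp add: k6 scaleC_minus_left[symmetric])
    next
      case 3
      then show ?thesis using same_right[of l i j] 4 I nz unfolding k2 by (simp add: scaleC_minus_left)
    next
      case p: 4
      then show ?thesis using double_torus.nested[OF swap, of l i j p] 4 I by (simp add: qcomm_1_iff)
    qed
  qed
qed

text \<open>
  Moving the diagonal elements to the right multiplies the two leading terms by the same scalar \<open>c\<close>, and
  the relation becomes a multiple of \<open>commutator\<close>.
\<close>

lemma rll_mixed:
  assumes "kE = r / (r - s)" "kF = r * s / (r - s)" "\<eta> = (s - r) / (r * s)"
  shows "rll n r s (\<lambda>i j. K i * E i j) (\<lambda>p q. F q p * M q)"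
  unfolding rll_def
proof (intro ballI)
  fix i j p l assume I: "i \<in> {1..n}" "j \<in> {1..n}" "p \<in> {1..n}" "l \<in> {1..n}"
  let ?d = "wt r s"
  define X where "X = E i j * F l p"
  define Y where "Y = F l p * E i j"
  define C where "C = K i * M l"
  define c where "c = ?d i j * ?d i l / s"
  define B where "B = (if i \<le> l \<and> l < j \<and> j \<le> p then (s - r) *: (F j p * M j * (K i * E i l)) else 0)"
  define A where "A = (if l \<le> i \<and> i < p \<and> p \<le> j then (s - r) *: (K p * E p j * (F l i * M l)) else 0)"
  have A': "(if i < p then (s - r) *: (K p * E p j * (F l i * M l)) else 0) = A"
    by (auto simp: A_def rootv_below)
  have B': "(if l < j then (s - r) *: (F j p * M j * (K i * E i l)) else 0) = B"
    by (auto simp: B_def rootv_below)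
  have through: "K a * E a b * (F f g * M f) = (?d a b / s * (?d a f / ?d a g)) *: (E a b * F f g * (K a * M f))"
    if "a \<in> {1..n}" "b \<in> {1..n}" "f \<in> {1..n}" "g \<in> {1..n}" "a \<le> b" "f \<le> g" for a b f g
  proof -
    have "K a * (E a b * F f g) = (?d a b / s * (?d a f / ?d a g)) *: (E a b * F f g * K a)"
      using qcomm_mult_right[OF K_qcomm_E[of a a b] K_qcomm_F[of a f g]] that by (simp add: qcomm_def)
    then have "K a * (E a b * F f g) * M f = (?d a b / s * (?d a f / ?d a g)) *: (E a b * F f g * K a) * M f"
      by simp
    then show ?thesis by (simp add: mult.assoc scaleC_push)
  qed
  have through': "F f g * M f * (K a * E a b) = (?d a f / ?d b f * (?d a b / s)) *: (F f g * E a b * (K a * M f))"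
    if "a \<in> {1..n}" "b \<in> {1..n}" "f \<in> {1..n}" "a \<le> b" for a b f g
  proof -
    have "(M f * K a) * E a b = (?d a f / ?d b f * (?d a b / s)) *: (E a b * (M f * K a))"
      using qcomm_mult_left[OF M_qcomm_E[of f a b] K_qcomm_E[of a a b]] that by (simp add: qcomm_def)
    then have "F f g * ((M f * K a) * E a b) = F f g * ((?d a f / ?d b f * (?d a b / s)) *: (E a b * (M f * K a)))"
      by simp
    then show ?thesis using KM[of a f] that by (simp add: mult.assoc scaleC_push)
  qed
  show "?d i p *: (K i * E i j * (F l p * M l)) + (if i < p then (s - r) *: (K p * E p j * (F l i * M l)) else 0)
    = ?d j l *: (F l p * M l * (K i * E i j)) + (if l < j then (s - r) *: (F j p * M j * (K i * E i l)) else 0)"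
  proof (cases "i \<le> j \<and> l \<le> p")
    case False
    then show ?thesis by (auto simp: rootv_below)
  next
    case True
    have 1: "?d i p *: (K i * E i j * (F l p * M l)) = c *: (X * C)"
      using through[of i j l p] I True nz by (simp add: X_def C_def c_def scaleC_push)
    have 2: "?d j l *: (F l p * M l * (K i * E i j)) = c *: (Y * C)"
      using through'[of i j l p] I True nz by (simp add: Y_def C_def c_def scaleC_push mult_ac)
    have M: "(M j * M' l) * C = K i * M j"
    proof -
      have "(M j * M' l) * (K i * M l) = M j * (M' l * K i) * M l" by (simp only: mult.assoc)
      also have "\<dots> = (M j * K i) * (M' l * M l)"
        unfolding commute_inverses(2)[OF I(1,4), symmetric] by (simp only: mult.assoc)
      finally show ?thesis using KM[OF I(1,2)] inv(4)[OF I(4)] by (simp add: C_def)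
    qed
    have K: "(K p * K' i) * C = K p * M l"
      using inv(2)[OF I(1)] by (simp add: C_def mult.assoc) (simp add: mult.assoc[symmetric])
    have "c *: (X * C) - c *: (Y * C) = B - A"
    proof -
      have b: "(c * \<eta>) *: (F j p * E i l * (M j * M' l) * C) = (s - r) *: (F j p * M j * (K i * E i l))"
        if "i \<le> l" "l < j" "j \<le> p"
      proof -
        have "c * \<eta> = (s - r) * (?d i l / s)" using that nz by (simp add: c_def assms(3))
        then show ?thesis using through'[of i l j p] that I nz by (simp add: mult.assoc M[unfolded mult.assoc] scaleC_push)
      qed
      have a: "(c * (\<eta> * ?d p j / ?d i l)) *: (E p j * F l i * (K p * K' i) * C) = (s - r) *: (K p * E p j * (F l i * M l))"
        if "l \<le> i" "i < p" "p \<le> j"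
      proof -
        have "c * (\<eta> * ?d p j / ?d i l) = (s - r) * (?d p j / s)" using that nz by (simp add: c_def assms(3))
        then show ?thesis using through[of p j l i] that I nz by (simp add: mult.assoc K[unfolded mult.assoc] scaleC_push)
      qed
      have "c *: (X * C) - c *: (Y * C) = c *: ((X - Y) * C)" by (simp add: left_diff_distrib scaleC_diff_right)
      also have "\<dots> = B - A"
        unfolding X_def Y_def commutator[OF assms I(1,2,4,3) conjunct1[OF True] conjunct2[OF True]]
        unfolding left_diff_distrib scaleC_diff_right A_def B_def using a b
        by (auto simp: scaleC_push)
      finally show ?thesis .
    qed
    then show ?thesis unfolding A' B' 1 2 by (simp add: algebra_simps)
  qed
qed

end

section \<open>Evaluation of noncommutative polynomials\<close>

instantiation complex :: calg
begin
definition "scaleC_complex c (x::complex) = c * x"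
instance by standard (simp_all add: scaleC_complex_def algebra_simps)
end

definition peval :: "('g \<Rightarrow> 'a::calg) \<Rightarrow> 'g ncpoly \<Rightarrow> 'a"
  where "peval G p = (\<Sum>w\<in>Poly_Mapping.keys p. Poly_Mapping.lookup p w *: prod_list (map G (letters w)))"

lemma peval_superset:
  assumes "finite S" "Poly_Mapping.keys p \<subseteq> S"
  shows "peval G p = (\<Sum>w\<in>S. Poly_Mapping.lookup p w *: prod_list (map G (letters w)))"
  unfolding peval_def using assms by (intro sum.mono_neutral_left) (auto simp: in_keys_iff)

lemma peval_add: "peval G (p + q) = peval G p + peval G q"
proof -
  let ?S = "Poly_Mapping.keys p \<union> Poly_Mapping.keys q"
  have "Poly_Mapping.keys (p + q) \<subseteq> ?S" by (rule Poly_Mapping.keys_add)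
  then show ?thesis
    by (simp add: peval_superset[of ?S] lookup_add scaleC_add_left sum.distrib)
qed

lemma peval_single: "peval G (Poly_Mapping.single w c) = c *: prod_list (map G (letters w))"
  by (simp add: peval_superset[of "{w}"])

lemma peval_zero [simp]: "peval G 0 = 0"
  by (simp add: peval_def)

lemma ncpoly_induct [case_names zero single add]:
  fixes p :: "'g ncpoly"
  assumes "P 0" "\<And>w c. w \<in> Poly_Mapping.keys p \<Longrightarrow> P (Poly_Mapping.single w c)" "\<And>p q. P p \<Longrightarrow> P q \<Longrightarrow> P (p + q)"
  shows "P p"
proof -
  have "P (\<Sum>w\<in>S. Poly_Mapping.single w (Poly_Mapping.lookup p w))" if "finite S" "S \<subseteq> Poly_Mapping.keys p" for S
    using that by (induction S) (auto intro: assms)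
  moreover have "p = (\<Sum>w\<in>Poly_Mapping.keys p. Poly_Mapping.single w (Poly_Mapping.lookup p w))"
    by (rule poly_mapping_eqI) (auto simp: lookup_sum lookup_single when_def in_keys_iff)
  ultimately show ?thesis by (metis finite_keys order_refl)
qed

lemma peval_mult: "peval G (p * q) = peval G p * peval G q"
proof (induction p rule: ncpoly_induct)
  case (single w c)
  show ?case
  proof (induction q rule: ncpoly_induct)
    case (single v d)
    show ?case by (simp add: mult_single peval_single plus_fword_def scaleC_push mult.commute)
  qed (simp_all add: peval_add distrib_left)
qed (simp_all add: peval_add distrib_right)

lemma peval_minus: "peval G (- p) = - peval G p"
  using peval_add[of G p "- p"] by (simp add: eq_neg_iff_add_eq_0 add.commute)

lemma peval_diff: "peval G (p - q) = peval G p - peval G q"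
  using peval_add[of G p "- q"] by (simp add: peval_minus)

lemma peval_gen: "peval G (gen x) = G x"
  by (simp add: gen_def peval_single scaleC_one)

lemma peval_scal: "peval G (scal c) = c *: 1"
  by (simp add: scal_def peval_single zero_fword_def)

lemma scal_one: "scal 1 = 1"
  by (simp add: scal_def)

lemma peval_one: "peval G 1 = 1"
  using peval_scal[of G 1] by (simp add: scaleC_one scal_one)

lemma peval_sum: "peval G (sum f S) = (\<Sum>i\<in>S. peval G (f i))"
  by (induction S rule: infinite_finite_induct) (simp_all add: peval_add)

lemma peval_power: "peval G (p ^ k) = peval G p ^ k"
  by (induction k) (simp_all add: peval_one peval_mult)

lemmas peval_simps = peval_add peval_mult peval_minus peval_diff peval_gen peval_scal peval_one peval_power

lemma scal_mult: "scal c * scal d = scal (c * d)"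
  by (simp add: scal_def mult_single)

lemma free_alg_induct [consumes 1, case_names scal gen add mult]:
  assumes "p \<in> carrier (free_alg X)"
    and "\<And>c. P (scal c)" and "\<And>x. x \<in> X \<Longrightarrow> P (gen x)"
    and "\<And>p q. p \<in> carrier (free_alg X) \<Longrightarrow> q \<in> carrier (free_alg X) \<Longrightarrow> P p \<Longrightarrow> P q \<Longrightarrow> P (p + q)"
    and "\<And>p q. p \<in> carrier (free_alg X) \<Longrightarrow> q \<in> carrier (free_alg X) \<Longrightarrow> P p \<Longrightarrow> P q \<Longrightarrow> P (p * q)"
  shows "P p"
proof -
  have "p \<in> carrier (free_alg X) \<and> P p"
  proof (induction p rule: ncpoly_induct)
    case zero
    then show ?case using assms(2)[of 0] by (simp add: scal_def)
  next
    case (single w c)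
    have "Poly_Mapping.single (FWord xs) c \<in> carrier (free_alg X) \<and> P (Poly_Mapping.single (FWord xs) c)"
      if "set xs \<subseteq> X" for xs
      using that
    proof (induction xs)
      case Nil
      then show ?case using assms(2)[of c] free_alg_scal[of c X] by (simp add: scal_def zero_fword_def)
    next
      case (Cons x xs)
      have "Poly_Mapping.single (FWord (x # xs)) c = gen x * Poly_Mapping.single (FWord xs) c"
        by (simp add: gen_def mult_single plus_fword_def)
      then show ?case using Cons assms(3,5) by simp
    qed
    moreover have "set (letters w) \<subseteq> X" using single assms(1) by (auto simp: carrier_free_alg)
    ultimately show ?case by (metis fword.collapse)
  qed (auto intro: assms(4))
  then show ?thesis ..
qed

section \<open>The product of all algebras with a given carrier type\<close>

definition calgebra :: "(complex, 'b) module \<Rightarrow> bool"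
  where "calgebra A \<longleftrightarrow> ring A
    \<and> (\<forall>c. \<forall>x\<in>carrier A. c \<odot>\<^bsub>A\<^esub> x \<in> carrier A)
    \<and> (\<forall>c. \<forall>x\<in>carrier A. \<forall>y\<in>carrier A. c \<odot>\<^bsub>A\<^esub> (x \<oplus>\<^bsub>A\<^esub> y) = c \<odot>\<^bsub>A\<^esub> x \<oplus>\<^bsub>A\<^esub> c \<odot>\<^bsub>A\<^esub> y)
    \<and> (\<forall>c d. \<forall>x\<in>carrier A. (c + d) \<odot>\<^bsub>A\<^esub> x = c \<odot>\<^bsub>A\<^esub> x \<oplus>\<^bsub>A\<^esub> d \<odot>\<^bsub>A\<^esub> x)
    \<and> (\<forall>c d. \<forall>x\<in>carrier A. c \<odot>\<^bsub>A\<^esub> (d \<odot>\<^bsub>A\<^esub> x) = (c * d) \<odot>\<^bsub>A\<^esub> x)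
    \<and> (\<forall>x\<in>carrier A. 1 \<odot>\<^bsub>A\<^esub> x = x)
    \<and> (\<forall>c. \<forall>x\<in>carrier A. \<forall>y\<in>carrier A. (c \<odot>\<^bsub>A\<^esub> x) \<otimes>\<^bsub>A\<^esub> y = c \<odot>\<^bsub>A\<^esub> (x \<otimes>\<^bsub>A\<^esub> y))
    \<and> (\<forall>c. \<forall>x\<in>carrier A. \<forall>y\<in>carrier A. x \<otimes>\<^bsub>A\<^esub> (c \<odot>\<^bsub>A\<^esub> y) = c \<odot>\<^bsub>A\<^esub> (x \<otimes>\<^bsub>A\<^esub> y))"

text \<open>
  The product of all complex algebras with carrier in \<open>'b\<close>: a type of class \<open>calg\<close> which has every such algebra
  as a quotient.  Outside of the algebras the value is fixed, so that equality is decided by the components.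
\<close>

typedef 'b fam = "{f :: (complex, 'b) module \<Rightarrow> 'b. \<forall>A. if calgebra A then f A \<in> carrier A else f A = undefined}"
  morphisms at_fam Abs_fam
  by (rule exI[of _ "\<lambda>A. if calgebra A then \<zero>\<^bsub>A\<^esub> else undefined"])
    (auto simp: calgebra_def intro: abelian_monoid.zero_closed abelian_group.axioms ring.is_abelian_group)

definition mk_fam :: "((complex, 'b) module \<Rightarrow> 'b) \<Rightarrow> 'b fam"
  where "mk_fam f = Abs_fam (\<lambda>A. if calgebra A then f A else undefined)"

lemma at_mk_fam:
  assumes "calgebra A" and "\<And>A. calgebra A \<Longrightarrow> f A \<in> carrier A"
  shows "at_fam (mk_fam f) A = f A"
  unfolding mk_fam_def using assms by (subst Abs_fam_inverse) auto

lemma at_fam_closed: "calgebra A \<Longrightarrow> at_fam f A \<in> carrier A"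
  using at_fam[of f] by auto

lemma fam_eqI:
  assumes "\<And>A. calgebra A \<Longrightarrow> at_fam f A = at_fam g A"
  shows "f = g"
proof -
  have "at_fam f A = at_fam g A" for A
    using assms at_fam[of f] at_fam[of g] by (cases "calgebra A") auto
  then show ?thesis by (simp add: at_fam_inject[symmetric] fun_eq_iff)
qed

lemma calgebra_ring: "calgebra A \<Longrightarrow> ring A"
  by (simp add: calgebra_def)

lemma calgebra_ops:
  assumes "calgebra A"
  shows "\<zero>\<^bsub>A\<^esub> \<in> carrier A" "\<one>\<^bsub>A\<^esub> \<in> carrier A"
    "\<And>x y. \<lbrakk>x \<in> carrier A; y \<in> carrier A\<rbrakk> \<Longrightarrow> x \<oplus>\<^bsub>A\<^esub> y \<in> carrier A"
    "\<And>x y. \<lbrakk>x \<in> carrier A; y \<in> carrier A\<rbrakk> \<Longrightarrow> x \<otimes>\<^bsub>A\<^esub> y \<in> carrier A"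
    "\<And>x. x \<in> carrier A \<Longrightarrow> \<ominus>\<^bsub>A\<^esub> x \<in> carrier A"
    "\<And>x c. x \<in> carrier A \<Longrightarrow> c \<odot>\<^bsub>A\<^esub> x \<in> carrier A"
proof -
  interpret ring A by (rule calgebra_ring[OF assms])
  show "\<zero>\<^bsub>A\<^esub> \<in> carrier A" "\<one>\<^bsub>A\<^esub> \<in> carrier A"
    "\<And>x y. \<lbrakk>x \<in> carrier A; y \<in> carrier A\<rbrakk> \<Longrightarrow> x \<oplus>\<^bsub>A\<^esub> y \<in> carrier A"
    "\<And>x y. \<lbrakk>x \<in> carrier A; y \<in> carrier A\<rbrakk> \<Longrightarrow> x \<otimes>\<^bsub>A\<^esub> y \<in> carrier A"
    "\<And>x. x \<in> carrier A \<Longrightarrow> \<ominus>\<^bsub>A\<^esub> x \<in> carrier A"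
    by simp_all
  show "\<And>x c. x \<in> carrier A \<Longrightarrow> c \<odot>\<^bsub>A\<^esub> x \<in> carrier A" using assms by (simp add: calgebra_def)
qed

instantiation fam :: (type) calg
begin

definition "0 = mk_fam (\<lambda>A. \<zero>\<^bsub>A\<^esub>)"
definition "1 = mk_fam (\<lambda>A. \<one>\<^bsub>A\<^esub>)"
definition "f + g = mk_fam (\<lambda>A. at_fam f A \<oplus>\<^bsub>A\<^esub> at_fam g A)"
definition "- f = mk_fam (\<lambda>A. \<ominus>\<^bsub>A\<^esub> at_fam f A)"
definition "f - g = mk_fam (\<lambda>A. at_fam f A \<oplus>\<^bsub>A\<^esub> (\<ominus>\<^bsub>A\<^esub> at_fam g A))"
definition "f * g = mk_fam (\<lambda>A. at_fam f A \<otimes>\<^bsub>A\<^esub> at_fam g A)"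
definition "scaleC_fam c f = mk_fam (\<lambda>A. c \<odot>\<^bsub>A\<^esub> at_fam f A)"

lemma at_fam_ops:
  assumes "calgebra A"
  shows "at_fam 0 A = \<zero>\<^bsub>A\<^esub>" "at_fam 1 A = \<one>\<^bsub>A\<^esub>"
    "at_fam (f + g) A = at_fam f A \<oplus>\<^bsub>A\<^esub> at_fam g A"
    "at_fam (- f) A = \<ominus>\<^bsub>A\<^esub> at_fam f A"
    "at_fam (f - g) A = at_fam f A \<oplus>\<^bsub>A\<^esub> (\<ominus>\<^bsub>A\<^esub> at_fam g A)"
    "at_fam (f * g) A = at_fam f A \<otimes>\<^bsub>A\<^esub> at_fam g A"
    "at_fam (c *: f) A = c \<odot>\<^bsub>A\<^esub> at_fam f A"
  using assms
  by (simp_all add: zero_fam_def one_fam_def plus_fam_def uminus_fam_def minus_fam_def times_fam_def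
      scaleC_fam_def at_mk_fam calgebra_ops at_fam_closed)

instance
proof
  fix f g h :: "'a fam" and c d :: complex
  note ops = at_fam_ops at_fam_closed calgebra_ops
  note ax = ring.ring_simprules[OF calgebra_ring]
  show "f + g + h = f + (g + h)" "f + g = g + f" "0 + f = f" "- f + f = 0" "f - g = f + - g"
    "f * g * h = f * (g * h)" "1 * f = f" "f * 1 = f"
    "(f + g) * h = f * h + g * h" "f * (g + h) = f * g + f * h"
    by (rule fam_eqI; simp add: ops ax ring.ring_simprules(9)[OF calgebra_ring] monoid.l_one[OF ring.is_monoid[OF calgebra_ring]]
          monoid.r_one[OF ring.is_monoid[OF calgebra_ring]] monoid.m_assoc[OF ring.is_monoid[OF calgebra_ring]])+
  show "c *: (f + g) = c *: f + c *: g" "(c + d) *: f = c *: f + d *: f"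
    "c *: d *: f = (c * d) *: f" "1 *: f = f"
    "(c *: f) * g = c *: (f * g)" "f * (c *: g) = c *: (f * g)"
    by (rule fam_eqI; simp add: ops, simp add: calgebra_def at_fam_closed)+
qed

end

lemma at_fam_diff_eq: "calgebra A \<Longrightarrow> at_fam (f - g) A = \<zero>\<^bsub>A\<^esub> \<Longrightarrow> at_fam f A = at_fam g A"
proof -
  assume A: "calgebra A" and e: "at_fam (f - g) A = \<zero>\<^bsub>A\<^esub>"
  interpret ring A by (rule calgebra_ring[OF A])
  have "at_fam f A = at_fam (f - g + g) A" by simp
  also have "\<dots> = at_fam (f - g) A \<oplus>\<^bsub>A\<^esub> at_fam g A" by (rule at_fam_ops(3)[OF A])
  finally show ?thesis using e A by (simp add: at_fam_closed)
qed

definition satisfies :: "('g ncpoly \<times> 'g ncpoly) set \<Rightarrow> ('g \<Rightarrow> 'a::calg) \<Rightarrow> bool"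
  where "satisfies Rels G \<longleftrightarrow> (\<forall>(p, q)\<in>Rels. peval G p = peval G q)"

lemma scal_central: "scal c * p = p * scal c"
  by (induction p rule: ncpoly_induct)
    (simp_all add: scal_def mult_single distrib_left distrib_right mult.commute)

lemma scal_left_commute: "p * (scal c * q) = scal c * (p * q)"
  by (simp only: mult.assoc[symmetric] scal_central[of c p])

lemma scal_add: "scal (c + d) = scal c + scal d"
  by (simp add: scal_def single_add)

section \<open>Homomorphisms between presented algebras\<close>

context presentation
begin

abbreviation "\<A> \<equiv> presented_alg X Rels"
abbreviation "cls \<equiv> rel_class X Rels"

lemma carrier_presented: "carrier \<A> = cls ` carrier (free_alg X)"
  unfolding presented_alg_def Let_def FactRing_def rel_class_def A_RCOSETS_def' by auto

lemma rel_class_add: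
  "\<lbrakk>p \<in> carrier (free_alg X); q \<in> carrier (free_alg X)\<rbrakk> \<Longrightarrow>
    cls (p + q) = cls p \<oplus>\<^bsub>\<A>\<^esub> cls q"
  using ring_hom_add[OF rel_class_hom] by simp

lemma calgebra_presented: "calgebra \<A>"
proof -
  note sm = rel_class_smult[symmetric] rel_class_mult[symmetric] rel_class_add[symmetric]
  show ?thesis
    unfolding calgebra_def carrier_presented
  proof (intro conjI ring_presented_alg ballI allI; elim imageE; hypsubst)
    fix c d and p q :: "'g ncpoly"
    assume pq: "p \<in> carrier (free_alg X)" "q \<in> carrier (free_alg X)"
    show "cls p \<otimes>\<^bsub>\<A>\<^esub> (c \<odot>\<^bsub>\<A>\<^esub> cls q)
        = c \<odot>\<^bsub>\<A>\<^esub> (cls p \<otimes>\<^bsub>\<A>\<^esub> cls q)"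
      using pq by (simp add: sm scal_left_commute)
  qed (simp_all add: sm distrib_left distrib_right scal_add mult.assoc scal_mult[symmetric] scal_one)
qed

lemma rel_class_eqD:
  assumes "p \<in> carrier (free_alg X)" "q \<in> carrier (free_alg X)" "cls p = cls q"
  shows "p - q \<in> rel_ideal X Rels"
proof -
  interpret ideal "rel_ideal X Rels" "free_alg X" by (rule ideal_rel_ideal)
  have "p \<in> rel_ideal X Rels +>\<^bsub>free_alg X\<^esub> q"
    using a_rcos_self[OF assms(1)] assms(3) unfolding rel_class_def by simp
  then obtain a where "a \<in> rel_ideal X Rels" "p = a + q" unfolding a_r_coset_def' by auto
  then show ?thesis by simp
qed

text \<open>
  The evaluation at \<open>H\<close> followed by the projection to \<open>A\<close> has a kernel that contains the relations, hence
  the ideal generated by them.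
\<close>

lemma universal:
  fixes A :: "(complex, 'b) module" and H :: "'g \<Rightarrow> 'b fam"
  assumes A: "calgebra A" and H: "\<And>p q. (p, q) \<in> Rels \<Longrightarrow> at_fam (peval H p) A = at_fam (peval H q) A"
  obtains h where "h \<in> ring_hom \<A> A"
    and "\<And>c x. x \<in> carrier \<A> \<Longrightarrow> h (c \<odot>\<^bsub>\<A>\<^esub> x) = c \<odot>\<^bsub>A\<^esub> h x"
    and "\<And>p. p \<in> carrier (free_alg X) \<Longrightarrow> h (cls p) = at_fam (peval H p) A"
proof -
  interpret A: ring A by (rule calgebra_ring[OF A])
  interpret F: ring "free_alg X" by (rule ring_free_alg)
  let ?e = "\<lambda>p. at_fam (peval H p) A"
  note ops = at_fam_ops[OF A] at_fam_closed[OF A]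
  have hom: "ring_hom_ring (free_alg X) A ?e"
    by (rule ring_hom_ringI) (simp_all add: F.ring_axioms A.ring_axioms ops peval_simps)
  have ker: "ideal (a_kernel (free_alg X) A ?e) (free_alg X)"
    by (rule ring_hom_ring.kernel_is_ideal[OF hom])
  have "{p - q | p q. (p, q) \<in> Rels} \<subseteq> a_kernel (free_alg X) A ?e"
    using rels_closed H by (auto simp: a_kernel_def' ops peval_diff A.r_neg)
  then have sub: "rel_ideal X Rels \<subseteq> a_kernel (free_alg X) A ?e"
    unfolding rel_ideal_def by (rule F.genideal_minimal[OF ker])
  have wd: "?e p = ?e q" if "p \<in> carrier (free_alg X)" "q \<in> carrier (free_alg X)"
    "cls p = cls q" for p q
    using rel_class_eqD[OF that] sub at_fam_diff_eq[OF A, of "peval H p" "peval H q"]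
    by (auto simp: a_kernel_def' peval_diff)
  define h where "h C = ?e (SOME p. p \<in> carrier (free_alg X) \<and> cls p = C)" for C
  have h: "h (cls p) = ?e p" if "p \<in> carrier (free_alg X)" for p
  proof -
    let ?q = "SOME q. q \<in> carrier (free_alg X) \<and> cls q = cls p"
    have "?q \<in> carrier (free_alg X) \<and> cls ?q = cls p"
      by (rule someI[of _ p]) (use that in simp)
    then show ?thesis unfolding h_def using wd[of ?q p] that by simp
  qed
  show ?thesis
  proof (rule that)
    show "h \<in> ring_hom \<A> A"
      by (rule ring_hom_memI)
        (auto simp: carrier_presented h ops peval_simps rel_class_mult[symmetric] rel_class_add[symmetric] rel_class_one[symmetric])
    show "h (c \<odot>\<^bsub>\<A>\<^esub> x) = c \<odot>\<^bsub>A\<^esub> h x" if "x \<in> carrier \<A>" for c x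
      using that by (auto simp: carrier_presented h rel_class_smult[symmetric] peval_simps scaleC_push ops)
    show "h (cls p) = ?e p" if "p \<in> carrier (free_alg X)" for p by (rule h[OF that])
  qed
qed

text \<open>
  The link between the presented algebra and the class \<open>calg\<close>.  The generators can be placed in the component
  of the presented algebra, but a family that is zero elsewhere need not satisfy the relations there.  A
  one-dimensional representation \<open>d\<close>, which makes sense in every algebra, fills the other components.
\<close>

lemma generic_point:
  fixes d :: "'g \<Rightarrow> complex"
  assumes "satisfies Rels d"
  obtains G :: "'g \<Rightarrow> 'g ncpoly set fam" where "satisfies Rels G"
    "\<And>p. p \<in> carrier (free_alg X) \<Longrightarrow> at_fam (peval G p) \<A> = cls p"
proof -
  define G where "G x = mk_fam (\<lambda>B. if B = \<A> \<and> x \<in> X then cls (gen x) else d x \<odot>\<^bsub>B\<^esub> \<one>\<^bsub>B\<^esub>)" for x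
  have closed: "(if B = \<A> \<and> x \<in> X then cls (gen x) else d x \<odot>\<^bsub>B\<^esub> \<one>\<^bsub>B\<^esub>) \<in> carrier B"
    if "calgebra B" for B x
    using that by (auto simp: rel_class_closed calgebra_ops)
  have G: "at_fam (G x) B = (if B = \<A> \<and> x \<in> X then cls (gen x) else d x \<odot>\<^bsub>B\<^esub> \<one>\<^bsub>B\<^esub>)"
    if "calgebra B" for B x
    unfolding G_def by (rule at_mk_fam[OF that closed])
  have A: "at_fam (peval G p) \<A> = cls p" if "p \<in> carrier (free_alg X)" for p
    using that
  proof (induction p rule: free_alg_induct)
    case (scal c)
    have "cls (scal c * 1) = c \<odot>\<^bsub>\<A>\<^esub> cls 1" by (rule rel_class_smult) simp
    then show ?case
      by (simp add: peval_scal at_fam_ops[OF calgebra_presented] rel_class_one)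
  qed (simp_all add: peval_simps G at_fam_ops calgebra_presented rel_class_add rel_class_mult)
  have B: "at_fam (peval G p) B = peval d p \<odot>\<^bsub>B\<^esub> \<one>\<^bsub>B\<^esub>" if "calgebra B" "B \<noteq> \<A>" for p B
  proof -
    interpret ring B by (rule calgebra_ring[OF that(1)])
    have "p \<in> carrier (free_alg UNIV)" by (simp add: carrier_free_alg)
    then show ?thesis
    proof (induction p rule: free_alg_induct)
      case (mult p q)
      then show ?case
        using that(1) by (simp add: peval_simps at_fam_ops) (simp add: calgebra_def mult.commute)
    next
      case (add p q)
      then show ?case
        using that(1) by (simp add: peval_simps at_fam_ops) (simp add: calgebra_def)
    qed (use that in \<open>simp_all add: peval_simps at_fam_ops G scaleC_complex_def\<close>)
  qed
  have "satisfies Rels G"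
    unfolding satisfies_def
  proof clarify
    fix p q assume pq: "(p, q) \<in> Rels"
    show "peval G p = peval G q"
    proof (rule fam_eqI)
      fix B :: "(complex, 'g ncpoly set) module" assume "calgebra B"
      then show "at_fam (peval G p) B = at_fam (peval G q) B"
        using assms pq rels_closed[OF pq] rel_class_rel[OF pq]
        by (cases "B = \<A>") (auto simp: A B satisfies_def)
    qed
  qed
  with A that show ?thesis by blast
qed

lemma hom_eqI:
  assumes A: "calgebra A" and f: "f \<in> ring_hom \<A> A" and g: "g \<in> ring_hom \<A> A"
    and fs: "\<And>c x. x \<in> carrier \<A> \<Longrightarrow> f (c \<odot>\<^bsub>\<A>\<^esub> x) = c \<odot>\<^bsub>A\<^esub> f x"
    and gs: "\<And>c x. x \<in> carrier \<A> \<Longrightarrow> g (c \<odot>\<^bsub>\<A>\<^esub> x) = c \<odot>\<^bsub>A\<^esub> g x"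
    and eq: "\<And>x. x \<in> X \<Longrightarrow> f (cls (gen x)) = g (cls (gen x))"
    and u: "u \<in> carrier \<A>"
  shows "f u = g u"
proof -
  have "f (cls p) = g (cls p)" if "p \<in> carrier (free_alg X)" for p
    using that
  proof (induction p rule: free_alg_induct)
    case (scal c)
    have "cls (scal c * 1) = c \<odot>\<^bsub>\<A>\<^esub> \<one>\<^bsub>\<A>\<^esub>"
      by (subst rel_class_smult) (simp_all add: rel_class_one)
    then show ?case
      using fs[of "\<one>\<^bsub>\<A>\<^esub>"] gs[of "\<one>\<^bsub>\<A>\<^esub>"] ring_hom_one[OF f] ring_hom_one[OF g]
        calgebra_ops(2)[OF calgebra_presented] by simp
  qed (use eq in \<open>simp_all add: rel_class_add rel_class_mult rel_class_closed ring_hom_add[OF f] ring_hom_add[OF g]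
      ring_hom_mult[OF f] ring_hom_mult[OF g]\<close>)
  with u show ?thesis by (auto simp: carrier_presented)
qed

end

text \<open>
  Polynomials \<open>t\<close> and \<open>t'\<close> for the images of the generators define mutually inverse isomorphisms if they do so
  for the solutions of the relations in the product algebra, where the computations of the class \<open>calg\<close>
  are available.
\<close>

lemma presented_alg_iso:
  fixes t :: "'x \<Rightarrow> 'y ncpoly" and t' :: "'y \<Rightarrow> 'x ncpoly" and d :: "'x \<Rightarrow> complex" and d' :: "'y \<Rightarrow> complex"
  assumes X: "presentation X R" and Y: "presentation Y S"
    and d: "satisfies R d" and d': "satisfies S d'"
    and t: "\<And>x. x \<in> X \<Longrightarrow> t x \<in> carrier (free_alg Y)" and t': "\<And>y. y \<in> Y \<Longrightarrow> t' y \<in> carrier (free_alg X)"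
    and tR: "\<And>G :: 'y \<Rightarrow> 'y ncpoly set fam. satisfies S G \<Longrightarrow> satisfies R (\<lambda>x. peval G (t x))"
    and t'S: "\<And>G :: 'x \<Rightarrow> 'x ncpoly set fam. satisfies R G \<Longrightarrow> satisfies S (\<lambda>y. peval G (t' y))"
    and t't: "\<And>(G :: 'x \<Rightarrow> 'x ncpoly set fam) x. satisfies R G \<Longrightarrow> x \<in> X \<Longrightarrow> peval (\<lambda>y. peval G (t' y)) (t x) = G x"
    and tt': "\<And>(G :: 'y \<Rightarrow> 'y ncpoly set fam) y. satisfies S G \<Longrightarrow> y \<in> Y \<Longrightarrow> peval (\<lambda>x. peval G (t x)) (t' y) = G y"
  shows "\<exists>\<psi>\<in>alg_iso (presented_alg X R) (presented_alg Y S).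
    \<forall>x\<in>X. \<psi> (rel_class X R (gen x)) = rel_class Y S (t x)"
proof -
  interpret X: presentation X R by (rule X)
  interpret Y: presentation Y S by (rule Y)
  let ?A = "presented_alg X R" and ?B = "presented_alg Y S"
  obtain GA :: "'x \<Rightarrow> 'x ncpoly set fam" where GA: "satisfies R GA"
    "\<And>p. p \<in> carrier (free_alg X) \<Longrightarrow> at_fam (peval GA p) ?A = rel_class X R p"
    by (rule X.generic_point[OF d]) (blast intro: that)
  obtain GB :: "'y \<Rightarrow> 'y ncpoly set fam" where GB: "satisfies S GB"
    "\<And>p. p \<in> carrier (free_alg Y) \<Longrightarrow> at_fam (peval GB p) ?B = rel_class Y S p"
    by (rule Y.generic_point[OF d']) (blast intro: that)
  have e1: "at_fam (peval (\<lambda>x. peval GB (t x)) p) ?B = at_fam (peval (\<lambda>x. peval GB (t x)) q) ?B" if "(p, q) \<in> R" for p q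
    using tR[OF GB(1)] that by (auto simp: satisfies_def)
  obtain f where f: "f \<in> ring_hom ?A ?B" "\<And>c x. x \<in> carrier ?A \<Longrightarrow> f (c \<odot>\<^bsub>?A\<^esub> x) = c \<odot>\<^bsub>?B\<^esub> f x"
    "\<And>p. p \<in> carrier (free_alg X) \<Longrightarrow> f (rel_class X R p) = at_fam (peval (\<lambda>x. peval GB (t x)) p) ?B"
    using X.universal[OF Y.calgebra_presented e1] by blast
  have e2: "at_fam (peval (\<lambda>y. peval GA (t' y)) p) ?A = at_fam (peval (\<lambda>y. peval GA (t' y)) q) ?A" if "(p, q) \<in> S" for p q
    using t'S[OF GA(1)] that by (auto simp: satisfies_def)
  obtain g where g: "g \<in> ring_hom ?B ?A" "\<And>c x. x \<in> carrier ?B \<Longrightarrow> g (c \<odot>\<^bsub>?B\<^esub> x) = c \<odot>\<^bsub>?A\<^esub> g x"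
    "\<And>p. p \<in> carrier (free_alg Y) \<Longrightarrow> g (rel_class Y S p) = at_fam (peval (\<lambda>y. peval GA (t' y)) p) ?A"
    using Y.universal[OF X.calgebra_presented e2] by blast
  have f_gen: "f (rel_class X R (gen x)) = rel_class Y S (t x)" if "x \<in> X" for x
    using f(3)[of "gen x"] GB(2)[of "t x"] t that by (simp add: peval_gen)
  have g_gen: "g (rel_class Y S (gen y)) = rel_class X R (t' y)" if "y \<in> Y" for y
    using g(3)[of "gen y"] GA(2)[of "t' y"] t' that by (simp add: peval_gen)
  have gf: "g (f u) = u" if "u \<in> carrier ?A" for u
  proof -
    have "(g \<circ> f) u = id u"
    proof (rule X.hom_eqI[OF X.calgebra_presented _ _ _ _ _ that])
      show "g \<circ> f \<in> ring_hom ?A ?A" by (rule ring_hom_trans[OF f(1) g(1)])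
      show "id \<in> ring_hom ?A ?A" by (auto simp: ring_hom_def)
      fix x assume x: "x \<in> X"
      have "g (rel_class Y S (t x)) = at_fam (GA x) ?A"
        using g(3)[OF t[OF x]] t't[OF GA(1) x] by simp
      also have "\<dots> = rel_class X R (gen x)" using GA(2)[of "gen x"] x by (simp add: peval_gen)
      finally show "(g \<circ> f) (rel_class X R (gen x)) = id (rel_class X R (gen x))" by (simp add: f_gen x)
    qed (use f(2) g(2) ring_hom_closed[OF f(1)] in auto)
    then show ?thesis by simp
  qed
  have fg: "f (g u) = u" if "u \<in> carrier ?B" for u
  proof -
    have "(f \<circ> g) u = id u"
    proof (rule Y.hom_eqI[OF Y.calgebra_presented _ _ _ _ _ that])
      show "f \<circ> g \<in> ring_hom ?B ?B" by (rule ring_hom_trans[OF g(1) f(1)])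
      show "id \<in> ring_hom ?B ?B" by (auto simp: ring_hom_def)
      fix y assume y: "y \<in> Y"
      have "f (rel_class X R (t' y)) = at_fam (GB y) ?B"
        using f(3)[OF t'[OF y]] tt'[OF GB(1) y] by simp
      also have "\<dots> = rel_class Y S (gen y)" using GB(2)[of "gen y"] y by (simp add: peval_gen)
      finally show "(f \<circ> g) (rel_class Y S (gen y)) = id (rel_class Y S (gen y))" by (simp add: g_gen y)
    qed (use f(2) g(2) ring_hom_closed[OF g(1)] in auto)
    then show ?thesis by simp
  qed
  have "bij_betw f (carrier ?A) (carrier ?B)"
    using gf fg ring_hom_closed[OF f(1)] ring_hom_closed[OF g(1)] by (intro bij_betwI[where g = g]) auto
  then have "f \<in> alg_iso ?A ?B"
    using f(1,2) by (simp add: alg_iso_def ring_iso_def)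
  with f_gen show ?thesis by blast
qed

section \<open>The relations of \<open>U(R)\<close> in an algebra\<close>

lemma Rmat_entry:
  assumes "i \<in> {1..n}" "k \<in> {1..n}" "j \<in> {1..n}" "l \<in> {1..n}"
  shows "Rmat n r s (i, k) (j, l)
    = (if i = j \<and> k = l then wt r s i k else 0) + (if i < k \<and> j = k \<and> l = i then s - r else 0)"
proof -
  have 1: "(\<Sum>a\<in>{1..n}. tens (munit a a) (munit a a) (i, k) (j, l)) = (of_bool (i = j \<and> k = l \<and> i = k) :: complex)"
  proof -
    have "(\<Sum>a\<in>{1..n}. tens (munit a a) (munit a a) (i, k) (j, l))
      = (\<Sum>a\<in>{1..n}. if a = i then of_bool (i = j \<and> k = l \<and> i = k) else (0::complex))"
      by (intro sum.cong) (auto simp: tens_def munit_def)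
    then show ?thesis using assms by simp
  qed
  have 2: "(\<Sum>(a, b)\<in>S. tens (munit a a) (munit b b) (i, k) (j, l)) = (of_bool (i = j \<and> k = l \<and> (i, k) \<in> S) :: complex)"
    if "S \<subseteq> {1..n} \<times> {1..n}" for S
  proof -
    have "(\<Sum>(a, b)\<in>S. tens (munit a a) (munit b b) (i, k) (j, l))
      = (\<Sum>x\<in>S. if x = (i, k) then of_bool (i = j \<and> k = l) else (0::complex))"
      by (intro sum.cong) (auto simp: tens_def munit_def)
    then show ?thesis using finite_subset[OF that] by (auto simp: sum.delta)
  qed
  have 3: "(\<Sum>(a, b)\<in>S. tens (munit a b) (munit b a) (i, k) (j, l)) = (of_bool (j = k \<and> l = i \<and> (i, k) \<in> S) :: complex)"
    if "S \<subseteq> {1..n} \<times> {1..n}" for S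
  proof -
    have "(\<Sum>(a, b)\<in>S. tens (munit a b) (munit b a) (i, k) (j, l))
      = (\<Sum>x\<in>S. if x = (i, k) then of_bool (j = k \<and> l = i) else (0::complex))"
      by (intro sum.cong) (auto simp: tens_def munit_def)
    then show ?thesis using finite_subset[OF that] by (auto simp: sum.delta)
  qed
  have S: "{(i, j). 1 \<le> i \<and> i < j \<and> j \<le> n} \<subseteq> {1..n} \<times> {1..n}" "{(i, j). 1 \<le> j \<and> j < i \<and> i \<le> n} \<subseteq> {1..n} \<times> {1..n}"
    by auto
  show ?thesis
    unfolding Rmat_def 1 2[OF S(1)] 2[OF S(2)] 3[OF S(1)] using assms by (auto simp: wt_def)
qed

lemma tmult_pair: "tmult n A B x y = (\<Sum>a\<in>{1..n}. \<Sum>b\<in>{1..n}. A x (a, b) * B (a, b) y)"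
  by (simp add: tmult_def sum.cartesian_product)

lemma tens_mone_right: "tens L mone (a, b) (c, d) = (if b = d then L a c else (0 :: 'a::semiring_1))"
  by (simp add: tens_def mone_def)

lemma tens_mone_left: "tens mone L (a, b) (c, d) = (if a = c then L b d else (0 :: 'a::semiring_1))"
  by (simp add: tens_def mone_def)

lemma sum_if_zero: "(\<Sum>a\<in>A. if c then f a else 0) = (if c then sum f A else (0::'a::comm_monoid_add))"
  by simp

lemma tmult_RLM:
  fixes L M :: "nat \<Rightarrow> nat \<Rightarrow> 'a::ring_1"
  assumes "i \<in> {1..n}" "k \<in> {1..n}" "j \<in> {1..n}" "l \<in> {1..n}"
  shows "tmult n (tmult n R (tens L mone)) (tens mone M) (i, k) (j, l)
      = (\<Sum>a\<in>{1..n}. \<Sum>b\<in>{1..n}. R (i, k) (a, b) * L a j * M b l)"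
proof -
  have 1: "tmult n R (tens L mone) (i, k) (c, d) = (\<Sum>a\<in>{1..n}. R (i, k) (a, d) * L a c)" if "d \<in> {1..n}" for c d
    using that by (simp add: tmult_pair tens_mone_right if_distrib cong: if_cong)
  have "tmult n (tmult n R (tens L mone)) (tens mone M) (i, k) (j, l)
     = (\<Sum>c\<in>{1..n}. \<Sum>d\<in>{1..n}. if c = j then (\<Sum>a\<in>{1..n}. R (i, k) (a, d) * L a j) * M d l else 0)"
    unfolding tmult_pair[of n "tmult n R (tens L mone)"] by (intro sum.cong) (auto simp: 1 tens_mone_left)
  also have "\<dots> = (\<Sum>d\<in>{1..n}. (\<Sum>a\<in>{1..n}. R (i, k) (a, d) * L a j) * M d l)"
    unfolding sum_if_zero using assms by simp
  also have "\<dots> = (\<Sum>a\<in>{1..n}. \<Sum>b\<in>{1..n}. R (i, k) (a, b) * L a j * M b l)"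
    by (subst sum.swap) (simp add: sum_distrib_right)
  finally show ?thesis .
qed

lemma tmult_MLR:
  fixes L M :: "nat \<Rightarrow> nat \<Rightarrow> 'a::ring_1"
  assumes "i \<in> {1..n}" "k \<in> {1..n}" "j \<in> {1..n}" "l \<in> {1..n}"
  shows "tmult n (tmult n (tens mone M) (tens L mone)) R (i, k) (j, l)
      = (\<Sum>a\<in>{1..n}. \<Sum>b\<in>{1..n}. M k b * L i a * R (a, b) (j, l))"
proof -
  have 1: "tmult n (tens mone M) (tens L mone) (i, k) (c, d) = M k d * L i c" if "d \<in> {1..n}" for c d
  proof -
    have "tmult n (tens mone M) (tens L mone) (i, k) (c, d) = (\<Sum>a\<in>{1..n}. \<Sum>b\<in>{1..n}. if a = i then (if b = d then M k d * L i c else 0) else 0)"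
      unfolding tmult_pair by (intro sum.cong) (auto simp: tens_mone_right tens_mone_left)
    then show ?thesis unfolding sum_if_zero using that assms by simp
  qed
  show ?thesis
    unfolding tmult_pair[of n "tmult n (tens mone M) (tens L mone)"] by (intro sum.cong) (auto simp: 1)
qed

lemma sum_two_deltas:
  fixes f :: "nat \<Rightarrow> nat \<Rightarrow> 'a::calg"
  assumes "i \<in> {1..n}" "k \<in> {1..n}"
    and R: "\<And>a b. a \<in> {1..n} \<Longrightarrow> b \<in> {1..n} \<Longrightarrow>
      R a b = (if a = i \<and> b = k then u else 0) + (if c \<and> a = k \<and> b = i then v else 0)"
  shows "(\<Sum>a\<in>{1..n}. \<Sum>b\<in>{1..n}. R a b *: f a b) = u *: f i k + (if c then v *: f k i else 0)"
proof -
  have "(\<Sum>a\<in>{1..n}. \<Sum>b\<in>{1..n}. R a b *: f a b)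
    = (\<Sum>a\<in>{1..n}. \<Sum>b\<in>{1..n}. if a = i then (if b = k then u *: f i k else 0) else 0)
    + (\<Sum>a\<in>{1..n}. \<Sum>b\<in>{1..n}. if a = k then (if b = i then (if c then v *: f k i else 0) else 0) else 0)"
    unfolding sum.distrib[symmetric] by (intro sum.cong) (auto simp: R scaleC_add_left)
  also have "\<dots> = u *: f i k + (if c then v *: f k i else 0)"
    unfolding sum_if_zero using assms(1,2) by simp
  finally show ?thesis .
qed

text \<open>
  Each row and each column of \<open>R\<close> has at most two entries, so that the matrix products collapse.
\<close>

lemma satisfies_RLL_iff:
  "satisfies (RLL_rels n r s A B) G \<longleftrightarrow> rll n r s (\<lambda>i j. peval G (A i j)) (\<lambda>i j. peval G (B i j))"
proof -
  let ?L = "\<lambda>i j. peval G (A i j)" and ?N = "\<lambda>i j. peval G (B i j)"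
  let ?R = "\<lambda>x y. scal (Rmat n r s x y)"
  have lhs: "peval G (tmult n (tmult n ?R (tens A mone)) (tens mone B) (i, k) (j, l))
      = wt r s i k *: (?L i j * ?N k l) + (if i < k then (s - r) *: (?L k j * ?N i l) else 0)"
    if I: "i \<in> {1..n}" "k \<in> {1..n}" "j \<in> {1..n}" "l \<in> {1..n}" for i j k l
    unfolding tmult_RLM[OF that] peval_sum peval_simps scaleC_push mult_1_left
    by (rule sum_two_deltas[where f = "\<lambda>a b. ?L a j * ?N b l" and R = "\<lambda>a b. Rmat n r s (i, k) (a, b)"])
       (use I in \<open>auto simp: Rmat_entry\<close>)
  have rhs: "peval G (tmult n (tmult n (tens mone B) (tens A mone)) ?R (i, k) (j, l))
      = wt r s j l *: (?N k l * ?L i j) + (if l < j then (s - r) *: (?N k j * ?L i l) else 0)"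
    if I: "i \<in> {1..n}" "k \<in> {1..n}" "j \<in> {1..n}" "l \<in> {1..n}" for i j k l
    unfolding tmult_MLR[OF that] peval_sum peval_simps scaleC_push mult_1_right
  proof (rule sum_two_deltas[where f = "\<lambda>a b. ?N k b * ?L i a" and R = "\<lambda>a b. Rmat n r s (a, b) (j, l)", OF I(3,4)])
    fix a b assume ab: "a \<in> {1..n}" "b \<in> {1..n}"
    show "Rmat n r s (a, b) (j, l) = (if a = j \<and> b = l then wt r s j l else 0) + (if l < j \<and> a = l \<and> b = j then s - r else 0)"
    proof -
      have "(if a = j \<and> b = l then wt r s a b else 0) = (if a = j \<and> b = l then wt r s j l else 0)"
        by (rule if_cong) simp_all
      moreover have "(a < b \<and> j = b \<and> l = a) = (l < j \<and> a = l \<and> b = j)" by metis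
      ultimately show ?thesis unfolding Rmat_entry[OF ab I(3,4)] by (simp only:)
    qed
  qed
  let ?left = "\<lambda>i k j l. peval G (tmult n (tmult n ?R (tens A mone)) (tens mone B) (i, k) (j, l))"
  let ?right = "\<lambda>i k j l. peval G (tmult n (tmult n (tens mone B) (tens A mone)) ?R (i, k) (j, l))"
  let ?eqs = "\<forall>i\<in>{1..n}. \<forall>k\<in>{1..n}. \<forall>j\<in>{1..n}. \<forall>l\<in>{1..n}. ?left i k j l = ?right i k j l"
  have "satisfies (RLL_rels n r s A B) G \<longleftrightarrow> ?eqs"
    unfolding satisfies_def RLL_rels_def Let_def by fast
  also have "\<dots> \<longleftrightarrow> rll n r s ?L ?N"
  proof
    assume H: ?eqs
    show "rll n r s ?L ?N"
      unfolding rll_def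
    proof (intro ballI)
      fix i j k l assume I: "i \<in> {1..n}" "j \<in> {1..n}" "k \<in> {1..n}" "l \<in> {1..n}"
      show "wt r s i k *: (?L i j * ?N k l) + (if i < k then (s - r) *: (?L k j * ?N i l) else 0)
        = wt r s j l *: (?N k l * ?L i j) + (if l < j then (s - r) *: (?N k j * ?L i l) else 0)"
        using H[rule_format, OF I(1,3,2,4)] unfolding lhs[OF I(1,3,2,4)] rhs[OF I(1,3,2,4)] .
    qed
  next
    assume H: "rll n r s ?L ?N"
    show ?eqs
    proof (intro ballI)
      fix i j k l assume I: "i \<in> {1..n}" "k \<in> {1..n}" "j \<in> {1..n}" "l \<in> {1..n}"
      show "?left i k j l = ?right i k j l"
        unfolding lhs[OF I] rhs[OF I] by (rule rllD[OF H I(1,3,2,4)])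
    qed
  qed
  finally show ?thesis .
qed

lemma satisfies_Un [simp]: "satisfies (A \<union> B) G \<longleftrightarrow> satisfies A G \<and> satisfies B G"
  by (auto simp: satisfies_def)

lemma satisfies_UR_iff:
  "satisfies (UR_rels n r s) G \<longleftrightarrow>
    rll n r s (\<lambda>i j. peval G (Lplus i j)) (\<lambda>i j. peval G (Lplus i j))
    \<and> rll n r s (\<lambda>i j. peval G (Lminus i j)) (\<lambda>i j. peval G (Lminus i j))
    \<and> rll n r s (\<lambda>i j. peval G (Lplus i j)) (\<lambda>i j. peval G (Lminus i j))
    \<and> (\<forall>i\<in>{1..n}. G (LP i i) * G (LPinv i) = 1 \<and> G (LPinv i) * G (LP i i) = 1
        \<and> G (LM i i) * G (LMinv i) = 1 \<and> G (LMinv i) * G (LM i i) = 1)"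
proof -
  have "satisfies (\<Union>i\<in>{1..n}. {(gen (LP i i) * gen (LPinv i), 1), (gen (LPinv i) * gen (LP i i), 1),
                     (gen (LM i i) * gen (LMinv i), 1), (gen (LMinv i) * gen (LM i i), 1)}) G
    \<longleftrightarrow> (\<forall>i\<in>{1..n}. G (LP i i) * G (LPinv i) = 1 \<and> G (LPinv i) * G (LP i i) = 1
        \<and> G (LM i i) * G (LMinv i) = 1 \<and> G (LMinv i) * G (LM i i) = 1)"
    unfolding satisfies_def by (simp add: ball_UN peval_simps)
  then show ?thesis
    unfolding UR_rels_def satisfies_Un satisfies_RLL_iff by blast
qed

section \<open>Gauss decomposition of a triangular quantum matrix\<close>

lemma rootv_scale:
  assumes "i < j" "c \<noteq> 0"
  shows "rootv (k / c) s (\<lambda>m. c *: x m) i j = c *: rootv k s x i j"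
  using assms(1)
proof (induction rule: rootv_induct)
  case (step j)
  have "rootv (k / c) s (\<lambda>m. c *: x m) i (Suc j)
     = ((k / c) * (c * c)) *: (rootv k s x i j * x j - s *: (x j * rootv k s x i j))"
    unfolding rootv_step[OF step(1)] step(2) by (simp add: scaleC_linear mult_ac)
  also have "(k / c) * (c * c) = c * k" using assms(2) by simp
  finally show ?case unfolding rootv_step[OF step(1)] by (simp add: scaleC_push)
qed simp


text \<open>
  The converse of locale \<open>serre_torus\<close>: the entries \<open>E = K\<^sup>-\<^sup>1 L\<close> next to the diagonal satisfy the Serre
  relations, and the others are the root vectors made from them.
\<close>

locale qtriangular =
  fixes n :: nat and r s :: complex and L :: "nat \<Rightarrow> nat \<Rightarrow> 'a::calg" and K' :: "nat \<Rightarrow> 'a"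
  assumes r0: "r \<noteq> 0" and s0: "s \<noteq> 0" and rs: "r \<noteq> s" and rs0: "r + s \<noteq> 0"
    and L: "qmatrix n r s L" and upper: "j < i \<Longrightarrow> L i j = 0"
    and inv: "i \<in> {1..n} \<Longrightarrow> L i i * K' i = 1" "i \<in> {1..n} \<Longrightarrow> K' i * L i i = 1"
begin

definition E where "E i j = K' i * L i j"

lemmas nz = r0 s0 wt_nonzero[OF r0 s0]

lemma L_eq: "i \<in> {1..n} \<Longrightarrow> L i j = L i i * E i j"
  by (simp add: E_def inv mult.assoc[symmetric])

lemma E_refl: "i \<in> {1..n} \<Longrightarrow> E i i = 1"
  by (simp add: E_def inv)

lemma diagonal_commute:
  assumes "a \<in> {1..n}" "b \<in> {1..n}"
  shows "L a a * L b b = L b b * L a a"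
proof -
  have "L b b * L a a = L a a * L b b" if "a < b" "a \<in> {1..n}" "b \<in> {1..n}" for a b
    using qmatrixD(4)[OF L, of a a b b] that by (simp add: upper)
  then show ?thesis using assms by (metis linorder_neqE_nat)
qed

lemma diagonal_qcomm_L:
  assumes I: "a \<in> {1..n}" "b \<in> {1..n}" "c \<in> {1..n}" "b < c"
  shows "qcomm (wt r s a c / wt r s a b) (L a a) (L b c)"
proof -
  consider "a < b" | "a = b" | "b < a" "a < c" | "a = c" | "c < a" by linarith
  then show ?thesis
  proof cases
    case 1
    then show ?thesis using qmatrixD(4)[OF L, of a a b c] I nz by (simp add: upper qcomm_def scaleC_one)
  next
    case 2
    then show ?thesis using qmatrixD(1)[OF L, of a a a c] I nz by (simp add: qcomm_def)
  next
    case 3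
    then show ?thesis using qmatrixD(3)[OF L, of b a a c] I nz by (simp add: qcomm_def)
  next
    case 4
    then show ?thesis using qmatrixD(2)[OF L, of b a a a] I nz by (simp add: qcomm_def)
  next
    case 5
    then show ?thesis using qmatrixD(4)[OF L, of b c a a] I nz by (simp add: upper qcomm_def scaleC_one)
  qed
qed

lemma diagonal_qcomm:
  assumes I: "a \<in> {1..n}" "b \<in> {1..n}" "c \<in> {1..n}" "b \<le> c"
  shows "qcomm (wt r s a c / wt r s a b) (L a a) (E b c)"
proof (cases "b = c")
  case False
  have "qcomm 1 (L a a) (K' b)"
    using commute_inverse[OF inv[OF I(2)] diagonal_commute[OF I(1,2)]] by (simp add: qcomm_1_iff)
  then show ?thesis
    using qcomm_mult_right[OF _ diagonal_qcomm_L[OF I(1,2,3)], of 1 "K' b"] False I by (simp add: E_def)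
qed (use I nz in \<open>simp add: E_refl\<close>)

lemma L_mult:
  assumes "i \<in> {1..n}" "j \<in> {1..n}" "p \<in> {1..n}" "q \<in> {1..n}" "i \<le> j"
  shows "L i j * L p q = (wt r s p i / wt r s p j) *: (L i i * (L p p * (E i j * E p q)))"
proof -
  have "qcomm (inverse (wt r s p j / wt r s p i)) (E i j) (L p p)"
    using diagonal_qcomm[of p i j] assms by (intro qcomm_sym) (auto simp: nz)
  from qcommD2[OF this, of "E p q"] show ?thesis
    unfolding L_eq[OF assms(1), of j] L_eq[OF assms(3), of q]
    by (simp add: mult.assoc scaleC_push)
qed

lemma cancel_diagonal:
  assumes "i \<in> {1..n}" "p \<in> {1..n}" "L i i * (L p p * u) = L i i * (L p p * v)"
  shows "u = v"
proof -
  have "K' p * (K' i * (L i i * (L p p * u))) = K' p * (K' i * (L i i * (L p p * v)))"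
    by (simp only: assms(3))
  moreover have "K' p * (K' i * (L i i * (L p p * z))) = z" for z
  proof -
    have "K' i * (L i i * (L p p * z)) = L p p * z"
      by (simp only: mult.assoc[symmetric] inv[OF assms(1)] mult_1_left)
    then show ?thesis by (simp only: mult.assoc[symmetric] inv[OF assms(2)] mult_1_left)
  qed
  ultimately show ?thesis by simp
qed

text \<open>
  The diagonal relation for the rows \<open>i, j\<close> and the columns \<open>j, l\<close>, in which \<open>L\<^sub>j\<^sub>j\<close> is invertible.
\<close>

lemma E_split:
  assumes I: "i \<in> {1..n}" "l \<in> {1..n}" "i < j" "j < l"
  shows "E i l = (r / (r - s)) *: (E i j * E j l - s *: (E j l * E i j))"
proof -
  have j: "j \<in> {1..n}" using I by auto
  have D: "L j j * (L i i * z) = L i i * (L j j * z)" for z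
    using diagonal_commute[OF j I(1)] by (simp add: mult.assoc[symmetric])
  have "L j l * L i j - L i j * L j l = (s - r) *: (L i l * L j j)"
    using qmatrixD(4)[OF L I(1) j j I(2)] I by simp
  then have "L i i * (L j j * (E j l * E i j - (1 / s) *: (E i j * E j l)))
      = L i i * (L j j * (((s - r) / (r * s)) *: E i l))"
    using L_mult[of j l i j] L_mult[of i j j l] L_mult[of i l j j] I j nz
    by (simp add: D right_diff_distrib scaleC_push E_refl)
  then have *: "E j l * E i j - (1 / s) *: (E i j * E j l) = ((s - r) / (r * s)) *: E i l"
    by (rule cancel_diagonal[OF I(1) j])
  have "(r / (r - s)) *: (E i j * E j l - s *: (E j l * E i j))
    = (- (r * s / (r - s))) *: (E j l * E i j - (1 / s) *: (E i j * E j l))"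
    using nz by (simp add: scaleC_diff_right scaleC_push scaleC_minus_left)
  also have "\<dots> = (- (r * s / (r - s)) * ((s - r) / (r * s))) *: E i l"
    unfolding * scaleC_scaleC ..
  also have "- (r * s / (r - s)) * ((s - r) / (r * s)) = 1"
    using nz rs by (simp add: field_simps)
  finally show ?thesis by (simp add: scaleC_one)
qed

lemma E_rootv:
  assumes "i \<in> {1..n}" "j \<in> {1..n}"
  shows "E i j = rootv (r / (r - s)) s (\<lambda>m. E m (Suc m)) i j"
proof -
  consider "j < i" | "i = j" | "i < j" by linarith
  then show ?thesis
  proof cases
    case 1
    then show ?thesis by (simp add: E_def upper rootv_below)
  next
    case 2
    then show ?thesis using assms by (simp add: E_refl)
  next
    case 3
    then show ?thesis using assms(2)
    proof (induction rule: rootv_induct)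
      case (step j)
      then show ?case using E_split[of i "Suc j" j] assms by (simp add: rootv_step)
    qed simp
  qed
qed

lemma E_row:
  assumes "i \<in> {1..n}" "l \<in> {1..n}" "i < j" "j < l"
  shows "E i j * E i l = r *: (E i l * E i j)"
proof (rule cancel_diagonal[OF assms(1,1)])
  have j: "j \<in> {1..n}" using assms by auto
  have "L i j * L i l = r *: (L i l * L i j)" using qmatrixD(1)[OF L, of i j i l] assms j by simp
  then have "(1 / r) *: (L i i * (L i i * (E i j * E i l))) = (1 / r) *: (L i i * (L i i * (r *: (E i l * E i j))))"
    using L_mult[of i j i l] L_mult[of i l i j] assms j nz by (simp add: scaleC_push)
  then show "L i i * (L i i * (E i j * E i l)) = L i i * (L i i * (r *: (E i l * E i j)))"
    using nz by (subst (asm) scaleC_cancel) simp_all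
qed

lemma E_column:
  assumes "i \<in> {1..n}" "j \<in> {1..n}" "i < p" "p < j"
  shows "E i j * E p j = r *: (E p j * E i j)"
proof (rule cancel_diagonal[OF assms(1)])
  show p: "p \<in> {1..n}" using assms by auto
  have D: "L p p * (L i i * z) = L i i * (L p p * z)" for z
    using diagonal_commute[OF p assms(1)] by (simp add: mult.assoc[symmetric])
  have "s *: (L i j * L p j) = L p j * L i j" using qmatrixD(2)[OF L, of i j p j] assms p by simp
  then have "(1 / r) *: (L i i * (L p p * (E i j * E p j))) = (1 / r) *: (L i i * (L p p * (r *: (E p j * E i j))))"
    using L_mult[of i j p j] L_mult[of p j i j] assms p nz by (simp add: D scaleC_push)
  then show "L i i * (L p p * (E i j * E p j)) = L i i * (L p p * (r *: (E p j * E i j)))"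
    using nz by (subst (asm) scaleC_cancel) simp_all
qed

lemma E_far:
  assumes "i \<in> {1..n}" "Suc p \<in> {1..n}" "Suc i < p"
  shows "E i (Suc i) * E p (Suc p) = E p (Suc p) * E i (Suc i)"
proof (rule cancel_diagonal[OF assms(1)])
  show p: "p \<in> {1..n}" using assms by auto
  have D: "L p p * (L i i * z) = L i i * (L p p * z)" for z
    using diagonal_commute[OF p assms(1)] by (simp add: mult.assoc[symmetric])
  have "L p (Suc p) * L i (Suc i) = L i (Suc i) * L p (Suc p)"
    using qmatrixD(4)[OF L, of i "Suc i" p "Suc p"] assms p by (simp add: upper)
  then show "L i i * (L p p * (E i (Suc i) * E p (Suc p))) = L i i * (L p p * (E p (Suc p) * E i (Suc i)))"
    using L_mult[of i "Suc i" p "Suc p"] L_mult[of p "Suc p" i "Suc i"] assms p nz by (simp add: D scaleC_one)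
qed

text \<open>
  By \<open>E_split\<close> the root vector of length two is a \<open>q\<close>-commutator of simple ones, and the Serre relations
  are its row and column relations with them.
\<close>

lemma serre: "serre n r s (\<lambda>m. E m (Suc m))"
proof
  fix i assume i: "1 \<le> i" "i + 1 < n"
  define X Y Z where d: "X = E i (Suc i)" "Y = E (Suc i) (Suc (Suc i))" "Z = E i (Suc (Suc i))"
  have Z: "X * Y - s *: (Y * X) = ((r - s) / r) *: Z"
    using E_split[of i "Suc (Suc i)" "Suc i"] i nz rs by (simp add: d scaleC_push)
  have X: "X * Z = r *: (Z * X)" using E_row[of i "Suc (Suc i)" "Suc i"] i by (simp add: d)
  have Y: "Z * Y = r *: (Y * Z)" using E_column[of i "Suc (Suc i)" "Suc i"] i by (simp add: d)
  have "X * (X * Y) - (r + s) *: (X * (Y * X)) + (r * s) *: (Y * (X * X))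
      = X * (X * Y - s *: (Y * X)) - r *: ((X * Y - s *: (Y * X)) * X)"
    by (simp add: algebra_simps scaleC_linear)
  also have "\<dots> = 0" unfolding Z by (simp add: scaleC_push X mult_ac)
  finally show "E i (Suc i) * (E i (Suc i) * E (i + 1) (Suc (i + 1))) - (r + s) *: (E i (Suc i) * (E (i + 1) (Suc (i + 1)) * E i (Suc i)))
      + (r * s) *: (E (i + 1) (Suc (i + 1)) * (E i (Suc i) * E i (Suc i))) = 0"
    by (simp add: d)
  have "X * (Y * Y) - (r + s) *: (Y * (X * Y)) + (r * s) *: (Y * (Y * X))
      = (X * Y - s *: (Y * X)) * Y - r *: (Y * (X * Y - s *: (Y * X)))"
    by (simp add: algebra_simps scaleC_linear)
  also have "\<dots> = 0" unfolding Z by (simp add: scaleC_push Y mult_ac)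
  finally show "E i (Suc i) * (E (i + 1) (Suc (i + 1)) * E (i + 1) (Suc (i + 1))) - (r + s) *: (E (i + 1) (Suc (i + 1)) * (E i (Suc i) * E (i + 1) (Suc (i + 1))))
      + (r * s) *: (E (i + 1) (Suc (i + 1)) * (E (i + 1) (Suc (i + 1)) * E i (Suc i))) = 0"
    by (simp add: d)
next
  fix i j assume "1 \<le> i" "i + 1 < j" "j < n"
  then show "E i (Suc i) * E j (Suc j) = E j (Suc j) * E i (Suc i)" by (intro E_far) auto
qed (use s0 r0 rs0 in auto)

end

text \<open>
  The values of the scalings and of \<open>\<eta>\<close> that come from the RLL relations fulfil the condition of
  locale \<open>double_torus\<close>.
\<close>

lemma structure_constant:
  fixes r s :: complex
  assumes "r \<noteq> 0" "s \<noteq> 0" "r \<noteq> s"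
  shows "r / (r - s) * (r * s / (r - s)) * ((s - r) / (r * s)) * (r - s) = - r"
proof -
  have "r / d * (r * s / d) * (- d / (r * s)) * d = - r" if "d \<noteq> 0" for d
    using that assms by (simp add: field_simps)
  from this[of "r - s"] show ?thesis using assms by simp
qed

lemma serre_scale:
  assumes "serre n r s x"
  shows "serre n r s (\<lambda>m. c *: x m)"
proof -
  interpret serre n r s 0 x by (rule assms)
  have 3: "c *: u * (c *: v * c *: w) = (c * c * c) *: (u * (v * w))" for u v w :: 'a
    by (simp add: scaleC_push mult_ac)
  have 4: "A *: B *: y = B *: A *: y" for A B and y :: 'a
    by (simp add: scaleC_push mult.commute)
  have lin: "d *: u - a *: d *: v + b *: d *: w = d *: (u - a *: v + b *: w)"
    for a b d and u v w :: 'a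
    by (simp add: scaleC_add_right scaleC_diff_right 4[of _ d])
  show ?thesis
  proof
    fix i assume i: "1 \<le> i" "i + 1 < n"
    show "c *: x i * (c *: x i * c *: x (i + 1)) - (r + s) *: (c *: x i * (c *: x (i + 1) * c *: x i))
        + (r * s) *: (c *: x (i + 1) * (c *: x i * c *: x i)) = 0"
      unfolding 3 lin serre1[OF i] by simp
    show "c *: x i * (c *: x (i + 1) * c *: x (i + 1)) - (r + s) *: (c *: x (i + 1) * (c *: x i * c *: x (i + 1)))
        + (r * s) *: (c *: x (i + 1) * (c *: x (i + 1) * c *: x i)) = 0"
      unfolding 3 lin serre2[OF i] by simp
  next
    fix i j assume "1 \<le> i" "i + 1 < j" "j < n"
    then show "c *: x i * c *: x j = c *: x j * c *: x i" using far[of i j] by (simp add: scaleC_push)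
  qed (use r0 s0 rs0 in auto)
qed

lemma serre_cong:
  assumes "serre n r s x" "\<And>m. m \<in> {1..<n} \<Longrightarrow> y m = x m"
  shows "serre n r s y"
proof -
  interpret serre n r s 0 x by (rule assms)
  show ?thesis using r0 s0 rs0 far serre1 serre2 by unfold_locales (auto simp: assms(2))
qed

lemma rootv_cong:
  assumes "\<And>m. i \<le> m \<Longrightarrow> m < j \<Longrightarrow> x m = y m" "k = k'"
  shows "rootv k s x i j = rootv k' s y i j"
  using assms by (induction j) (auto simp: rootv.simps)

text \<open>
  The half of \<open>N\<close> is obtained from \<open>qtriangular\<close> for the transpose of \<open>N\<close> with parameters \<open>1/s, 1/r\<close>.  There
  the diagonal is split off on the left, whereas \<open>y\<close> has it on the right; this accounts for the factor
  \<open>1/s\<close> between \<open>y\<close> and \<open>Q.E\<close>, and for the scaling \<open>r s / (r - s)\<close> in place of \<open>r / (r - s)\<close>.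
\<close>

lemma rll_triangular_to_double_torus:
  fixes L N :: "nat \<Rightarrow> nat \<Rightarrow> 'a::calg"
  assumes rs: "r \<noteq> 0" "s \<noteq> 0" "r \<noteq> s" "r + s \<noteq> 0"
    and LL: "rll n r s L L" and NN: "rll n r s N N" and LN: "rll n r s L N"
    and up: "\<And>i j. j < i \<Longrightarrow> L i j = 0" and low: "\<And>i j. i < j \<Longrightarrow> N i j = 0"
    and inv: "\<And>i. i \<in> {1..n} \<Longrightarrow> L i i * K' i = 1" "\<And>i. i \<in> {1..n} \<Longrightarrow> K' i * L i i = 1"
      "\<And>i. i \<in> {1..n} \<Longrightarrow> N i i * M' i = 1" "\<And>i. i \<in> {1..n} \<Longrightarrow> M' i * N i i = 1"
  defines "x \<equiv> \<lambda>m. K' m * L m (Suc m)" and "y \<equiv> \<lambda>m. N (Suc m) m * M' m"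
  shows "double_torus n r s (r / (r - s)) (r * s / (r - s)) ((s - r) / (r * s)) x y (\<lambda>i. L i i) K' (\<lambda>i. N i i) M'"
    and "\<And>i j. i \<in> {1..n} \<Longrightarrow> j \<in> {1..n} \<Longrightarrow> L i j = L i i * rootv (r / (r - s)) s x i j"
    and "\<And>i j. i \<in> {1..n} \<Longrightarrow> j \<in> {1..n} \<Longrightarrow> N j i = rootv (r * s / (r - s)) (inverse r) y i j * N i i"
proof -
  note nz = rs(1,2) wt_nonzero[OF rs(1,2)]
  interpret P: qtriangular n r s L K'
    using rs LL rll_iff_qmatrix[OF rs(1,2)] up inv by unfold_locales auto
  have "inverse s + inverse r = (r + s) / (r * s)" using rs by (simp add: field_simps)
  then have "inverse s + inverse r \<noteq> 0" using rs by simp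
  then interpret Q: qtriangular n "inverse s" "inverse r" "\<lambda>i j. N j i" M'
    using rs NN rll_iff_qmatrix[OF rs(1,2)] qmatrix_transpose[OF rs(1,2), of n N] low inv
    by unfold_locales auto
  have x: "x = (\<lambda>m. P.E m (Suc m))" by (simp add: x_def P.E_def)
  have Ninv: "N j i * M' i = (if i = j then 1 else inverse s) *: Q.E i j"
    if "i \<in> {1..n}" "j \<in> {1..n}" "i \<le> j" for i j
  proof (cases "i = j")
    case True
    then show ?thesis using that inv by (simp add: Q.E_refl scaleC_one)
  next
    case False
    have "N i i * Q.E i j = inverse s *: (Q.E i j * N i i)"
      using Q.diagonal_qcomm[OF that(1,1,2)] that False rs
      by (simp add: qcomm_def)
    then have "N j i = inverse s *: (Q.E i j * N i i)" using Q.L_eq[OF that(1), of j] by simp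
    then show ?thesis using False inv that by (simp add: scaleC_push mult.assoc)
  qed
  have y_eq: "y m = inverse s *: Q.E m (Suc m)" if "m \<in> {1..<n}" for m
    using Ninv[of m "Suc m"] that by (simp add: y_def)
  have k: "inverse s / (inverse s - inverse r) = r / (r - s)"
    using rs by (simp add: field_simps)
  have KN: "qcomm (wt r s a c / wt r s a b) (L a a) (N b c)"
    if "a \<in> {1..n}" "b \<in> {1..n}" "c \<in> {1..n}" for a b c
  proof -
    have "wt r s a b *: (L a a * N b c) = wt r s a c *: (N b c * L a a)"
      using rllD[OF LN that(1,1,2,3)] up low
      by (cases "a < b"; cases "c < a") (auto simp: up)
    then have "L a a * N b c = (inverse (wt r s a b) * wt r s a c) *: (N b c * L a a)"
      unfolding scaleC_eq_move[OF nz(3)] scaleC_scaleC .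
    then show ?thesis by (simp add: qcomm_def divide_inverse mult.commute)
  qed
  have NL: "qcomm (wt r s b a / wt r s c a) (N a a) (L b c)"
    if "a \<in> {1..n}" "b \<in> {1..n}" "c \<in> {1..n}" for a b c
  proof -
    have "wt r s c a *: (N a a * L b c) = wt r s b a *: (L b c * N a a)"
      using rllD[OF LN that(2,3,1,1)] up low
      by (cases "b < a"; cases "a < c") (auto simp: low)
    then have "N a a * L b c = (inverse (wt r s c a) * wt r s b a) *: (L b c * N a a)"
      unfolding scaleC_eq_move[OF nz(3)] scaleC_scaleC .
    then show ?thesis by (simp add: qcomm_def divide_inverse mult.commute)
  qed
  have KM: "L a a * N b b = N b b * L a a" if "a \<in> {1..n}" "b \<in> {1..n}" for a b
    using KN[OF that(1,2,2)] nz by (simp add: qcomm_def scaleC_one)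
  have K'N: "K' a * N b b = N b b * K' a" if "a \<in> {1..n}" "b \<in> {1..n}" for a b
    using commute_inverse[OF inv(1,2)[OF that(1)] KM[OF that, symmetric]] by simp
  have LM': "L a a * M' b = M' b * L a a" if "a \<in> {1..n}" "b \<in> {1..n}" for a b
    using commute_inverse[OF inv(3,4)[OF that(2)] KM[OF that]] .
  have K'M': "K' a * M' b = M' b * K' a" if "a \<in> {1..n}" "b \<in> {1..n}" for a b
    using commute_inverse[OF inv(3,4)[OF that(2)] K'N[OF that]] .
  have K_x: "qcomm (wt r s a (Suc m) / wt r s a m) (L a a) (x m)" if "a \<in> {1..n}" "m \<in> {1..<n}" for a m
    unfolding x using P.diagonal_qcomm[of a m "Suc m"] that by simp
  have K_y: "qcomm (wt r s a m / wt r s a (Suc m)) (L a a) (y m)" if "a \<in> {1..n}" "m \<in> {1..<n}" for a m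
    using qcomm_mult_right[OF KN[of a "Suc m" m], of 1 "M' m"] LM'[of a m] that
    by (simp add: y_def qcomm_1_iff)
  have M_x: "qcomm (wt r s m a / wt r s (Suc m) a) (N a a) (x m)" if "a \<in> {1..n}" "m \<in> {1..<n}" for a m
    using qcomm_mult_right[OF _ NL[of a m "Suc m"], of 1 "K' m"] K'N[of m a] that
    by (simp add: x_def qcomm_1_iff)
  have M_y: "qcomm (wt r s (Suc m) a / wt r s m a) (N a a) (y m)" if "a \<in> {1..n}" "m \<in> {1..<n}" for a m
    unfolding y_eq[OF that(2)] using Q.diagonal_qcomm[of a m "Suc m"] that nz
    by (intro qcomm_scale) (simp add: wt_swap[OF rs(1,2)])
  have bracket: "wt r s i (Suc j) *: (x i * y j - y j * x i)
      = K' i * (wt r s i (Suc j) *: (L i (Suc i) * N (Suc j) j) - wt r s (Suc i) j *: (N (Suc j) j * L i (Suc i))) * M' j"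
    if "i \<in> {1..<n}" "j \<in> {1..<n}" for i j
  proof -
    have I: "i \<in> {1..n}" "j \<in> {1..n}" "Suc i \<in> {1..n}" "Suc j \<in> {1..n}" using that by auto
    have "qcomm (inverse (inverse (wt r s i j / wt r s i (Suc j)))) (N (Suc j) j) (K' i)"
      using qcomm_sym[OF qcomm_inverse[OF KN[OF I(1,4,2)] _ inv(1,2)[OF I(1)]]] nz by simp
    then have 1: "N (Suc j) j * (K' i * z) = (wt r s i j / wt r s i (Suc j)) *: (K' i * (N (Suc j) j * z))" for z
      by (intro qcommD2) simp
    have "qcomm (inverse (wt r s i j / wt r s (Suc i) j)) (M' j) (L i (Suc i))"
      using qcomm_inverse[OF NL[OF I(2,1,3)] _ inv(3,4)[OF I(2)]] nz by simp
    then have 2: "M' j * L i (Suc i) = (wt r s (Suc i) j / wt r s i j) *: (L i (Suc i) * M' j)"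
      by (simp add: qcomm_def)
    have "y j * x i = N (Suc j) j * (K' i * (M' j * L i (Suc i)))"
      unfolding x_def y_def using K'M'[OF I(1,2)] by (simp add: mult.assoc) (simp add: mult.assoc[symmetric])
    also have "\<dots> = (wt r s (Suc i) j / wt r s i (Suc j)) *: (K' i * (N (Suc j) j * L i (Suc i)) * M' j)"
      unfolding 1 2 using nz by (simp add: scaleC_push mult.assoc)
    finally have yx: "wt r s i (Suc j) *: (y j * x i) = wt r s (Suc i) j *: (K' i * (N (Suc j) j * L i (Suc i)) * M' j)"
      using nz by (simp add: scaleC_push)
    show ?thesis
      unfolding scaleC_diff_right yx
      by (simp add: x_def y_def left_diff_distrib right_diff_distrib scaleC_push mult.assoc)
  qed
  have xy: "x i * y j = y j * x i" if "i \<in> {1..<n}" "j \<in> {1..<n}" "i \<noteq> j" for i j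
  proof -
    have "wt r s i (Suc j) *: (L i (Suc i) * N (Suc j) j) = wt r s (Suc i) j *: (N (Suc j) j * L i (Suc i))"
      using rllD[OF LN, of i "Suc i" "Suc j" j] that by (cases "i < j") (auto simp: up low)
    then have "wt r s i (Suc j) *: (x i * y j - y j * x i) = wt r s i (Suc j) *: 0"
      unfolding bracket[OF that(1,2)] by simp
    then show ?thesis unfolding scaleC_cancel[OF nz(3)] by simp
  qed
  have xy_same: "x i * y i - y i * x i = ((s - r) / (r * s)) *: (N (Suc i) (Suc i) * M' i - L (Suc i) (Suc i) * K' i)"
    if "i \<in> {1..<n}" for i
  proof -
    have I: "i \<in> {1..n}" "Suc i \<in> {1..n}" using that by auto
    have "(r * s) *: (L i (Suc i) * N (Suc i) i) - N (Suc i) i * L i (Suc i)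
        = (s - r) *: (N (Suc i) (Suc i) * L i i - L (Suc i) (Suc i) * N i i)"
      using rllD[OF LN, of i "Suc i" "Suc i" i] I by (simp add: scaleC_diff_right scaleC_one algebra_simps)
    then have "(r * s) *: (x i * y i - y i * x i)
        = (s - r) *: (K' i * (N (Suc i) (Suc i) * L i i - L (Suc i) (Suc i) * N i i) * M' i)"
      using bracket[OF that that] by (simp add: scaleC_push)
    also have "K' i * (N (Suc i) (Suc i) * L i i - L (Suc i) (Suc i) * N i i) * M' i
        = N (Suc i) (Suc i) * M' i - L (Suc i) (Suc i) * K' i"
    proof -
      have "K' i * (N (Suc i) (Suc i) * L i i) = N (Suc i) (Suc i)"
        using K'N[OF I] inv(2)[OF I(1)] by (simp add: mult.assoc[symmetric]) (simp add: mult.assoc)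
      moreover have "K' i * (L (Suc i) (Suc i) * (N i i * M' i)) = L (Suc i) (Suc i) * K' i"
        using commute_inverse[OF inv(1,2)[OF I(1)] P.diagonal_commute[OF I(2,1)]] inv(3)[OF I(1)] by simp
      ultimately show ?thesis by (simp add: left_diff_distrib right_diff_distrib mult.assoc)
    qed
    finally have "(r * s) *: (x i * y i - y i * x i)
        = (r * s) *: ((s - r) / (r * s)) *: (N (Suc i) (Suc i) * M' i - L (Suc i) (Suc i) * K' i)"
      using rs by (simp add: scaleC_push)
    then show ?thesis using rs by (subst (asm) scaleC_cancel) simp_all
  qed
  have sx: "serre n r s x" unfolding x by (rule P.serre)
  have sy: "serre n (inverse s) (inverse r) y"
    by (rule serre_cong[OF serre_scale[OF Q.serre, of "inverse s"]]) (simp add: y_eq)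
  show "double_torus n r s (r / (r - s)) (r * s / (r - s)) ((s - r) / (r * s)) x y (\<lambda>i. L i i) K' (\<lambda>i. N i i) M'"
    by (intro double_torus.intro double_torus_axioms.intro sx sy rs(3) structure_constant[OF rs(1-3)] inv P.diagonal_commute KM Q.diagonal_commute
        K_x K_y M_x M_y xy xy_same)
  show "L i j = L i i * rootv (r / (r - s)) s x i j" if "i \<in> {1..n}" "j \<in> {1..n}" for i j
    using P.L_eq[OF that(1), of j] P.E_rootv[OF that] by (simp add: x)
  show "N j i = rootv (r * s / (r - s)) (inverse r) y i j * N i i" if "i \<in> {1..n}" "j \<in> {1..n}" for i j
  proof -
    consider "j < i" | "i = j" | "i < j" by linarith
    then show ?thesis
    proof cases
      case 3
      have "rootv (r * s / (r - s)) (inverse r) y i j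
        = rootv (r / (r - s) / inverse s) (inverse r) (\<lambda>m. inverse s *: Q.E m (Suc m)) i j"
        by (rule rootv_cong) (use y_eq that rs in \<open>auto simp: divide_simps\<close>)
      also have "\<dots> = inverse s *: Q.E i j"
        unfolding rootv_scale[OF 3 nonzero_imp_inverse_nonzero[OF rs(2)]] k[symmetric] Q.E_rootv[OF that, symmetric] ..
      also have "\<dots> = N j i * M' i" using Ninv[OF that] 3 by simp
      finally show ?thesis using inv that by (simp add: mult.assoc)
    qed (use low in \<open>simp_all add: rootv_below\<close>)
  qed
qed

context double_torus
begin

lemma rll_plus:
  assumes "kE = r / (r - s)"
  shows "rll n r s (\<lambda>i j. K i * E i j) (\<lambda>i j. K i * E i j)"
proof -
  interpret serre_torus n r s kE x K
    by (intro serre_torus.intro serre_torus_axioms.intro X.serre_axioms rs assms KK Kx)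
  show ?thesis using qmatrix rll_iff_qmatrix[OF r0 s0] by blast
qed

text \<open>
  \<open>L\<^sup>-\<close> is the transpose of an upper triangular matrix for \<open>1/s, 1/r\<close>; the factor \<open>s\<close> comes from moving
  the diagonal to the left of \<open>F\<close>.
\<close>

lemma rll_minus:
  assumes "kF = r * s / (r - s)"
  shows "rll n r s (\<lambda>p q. F q p * M q) (\<lambda>p q. F q p * M q)"
proof -
  have k: "kF / s = inverse s / (inverse s - inverse r)" unfolding assms using rs nz by (simp add: field_simps)
  have "qcomm (wt (inverse s) (inverse r) a (Suc m) / wt (inverse s) (inverse r) a m) (M a) (s *: y m)"
    if "a \<in> {1..n}" "m \<in> {1..<n}" for a m
    using My[OF that] nz by (intro qcomm_scale) (simp add: wt_swap)
  then interpret T: serre_torus n "inverse s" "inverse r" "kF / s" "\<lambda>m. s *: y m" M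
    using rs k by (intro serre_torus.intro serre_torus_axioms.intro serre_scale Y.serre_axioms MM) auto
  have eq: "M i * rootv (kF / s) (inverse r) (\<lambda>m. s *: y m) i j = F i j * M i"
    if "i \<in> {1..n}" "j \<in> {1..n}" for i j
  proof -
    consider "j < i" | "i = j" | "i < j" by linarith
    then show ?thesis
    proof cases
      case 3
      then show ?thesis
        using M_qcomm_F[of i i j] that nz by (simp add: rootv_scale qcomm_def scaleC_push)
    qed (simp_all add: rootv_below)
  qed
  have "qmatrix n (inverse s) (inverse r) (\<lambda>i j. F i j * M i)"
    using T.qmatrix unfolding qmatrix_def by (simp add: eq)
  then show ?thesis
    using qmatrix_transpose[OF r0 s0, of n "\<lambda>p q. F q p * M q"] rll_iff_qmatrix[OF r0 s0] by blast
qed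

end

section \<open>The Cartan part\<close>

inductive_set monoid_span :: "'a::monoid_mult set \<Rightarrow> 'a set" for S where
  base: "x \<in> S \<Longrightarrow> x \<in> monoid_span S"
| one: "1 \<in> monoid_span S"
| mult: "x \<in> monoid_span S \<Longrightarrow> y \<in> monoid_span S \<Longrightarrow> x * y \<in> monoid_span S"

lemma monoid_span_commute:
  assumes S: "\<And>x y. x \<in> S \<Longrightarrow> y \<in> S \<Longrightarrow> x * y = y * x"
    and u: "u \<in> monoid_span S" and v: "v \<in> monoid_span S"
  shows "u * v = v * (u :: 'a::monoid_mult)"
proof -
  have *: "x * v = v * x" if "x \<in> S" for x
    using v
  proof induction
    case (mult y z)
    have "x * (y * z) = y * (x * z)" using mult(3) by (simp only: mult.assoc[symmetric])
    then show ?case using mult(4) by (simp only: mult.assoc)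
  qed (use S that in auto)
  from u show ?thesis
  proof induction
    case (mult y z)
    have "y * z * v = y * (v * z)" using mult(4) by (simp only: mult.assoc)
    also have "\<dots> = v * (y * z)" using mult(3) by (simp only: mult.assoc[symmetric])
    finally show ?case .
  qed (use * in auto)
qed

lemma pairing_eps_alpha:
  assumes "i \<in> {1..n}"
  shows "pairing n (eps i) (alpha j) = of_bool (i = j) - of_bool (i = Suc j)"
proof -
  have "pairing n (eps i) (alpha j) = (\<Sum>k\<in>{1..n}. if k = i then alpha j i else 0)"
    unfolding pairing_def by (intro sum.cong) (auto simp: eps_def)
  also have "\<dots> = alpha j i" using assms by simp
  finally show ?thesis by (simp add: alpha_def eps_def)
qed

text \<open>
  \<open>P\<^sub>i\<close> is the alternating product \<open>\<Prod>\<^sub>l (K\<^sub>i\<^sub>-\<^sub>l M\<^sub>i\<^sub>-\<^sub>l)\<^bsup>(-1)^l\<^esup>\<close> and \<open>P'\<^sub>i\<close> its inverse.  Splitting off the factor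
  \<open>l = 1\<close> inverts the remaining ones, whence the two recursions.
\<close>

locale torus_products = double_torus +
  fixes P P' :: "nat \<Rightarrow> 'a"
  assumes P1: "P (Suc 0) = 1" "P' (Suc 0) = 1"
    and P_Suc: "1 \<le> i \<Longrightarrow> P (Suc i) = M' i * K' i * P' i" "1 \<le> i \<Longrightarrow> P' (Suc i) = K i * M i * P i"
begin

definition T where "T = monoid_span (\<Union>i\<in>{1..n}. {K i, K' i, M i, M' i})"

lemma base_commute:
  assumes "u \<in> (\<Union>i\<in>{1..n}. {K i, K' i, M i, M' i})" "v \<in> (\<Union>i\<in>{1..n}. {K i, K' i, M i, M' i})"
  shows "u * v = v * u"
proof -
  from assms obtain a b where ab: "a \<in> {1..n}" "b \<in> {1..n}" "u \<in> {K a, K' a, M a, M' a}" "v \<in> {K b, K' b, M b, M' b}"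
    by auto
  show ?thesis
    using ab(3,4) KK[OF ab(1,2)] KM[OF ab(1,2)] KM[OF ab(2,1)] MM[OF ab(1,2)]
      commute_inverses[OF ab(1,2)] commute_inverses[OF ab(2,1)] by auto
qed

lemma T_commute: "u \<in> T \<Longrightarrow> v \<in> T \<Longrightarrow> u * v = v * u"
  unfolding T_def by (rule monoid_span_commute) (rule base_commute)

lemma T_left_commute: "u \<in> T \<Longrightarrow> v \<in> T \<Longrightarrow> u * (v * z) = v * (u * z)"
  using T_commute by (simp add: mult.assoc[symmetric])

lemma T_base [simp]:
  assumes "i \<in> {1..n}"
  shows "K i \<in> T" "K' i \<in> T" "M i \<in> T" "M' i \<in> T"
  using assms unfolding T_def by (auto intro!: monoid_span.base)

lemma T_one [simp]: "1 \<in> T" and T_mult [simp]: "u \<in> T \<Longrightarrow> v \<in> T \<Longrightarrow> u * v \<in> T"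
  unfolding T_def by (auto intro: monoid_span.intros)

lemma P_in_T: "i \<in> {1..n} \<Longrightarrow> P i \<in> T \<and> P' i \<in> T"
proof (induction i)
  case (Suc i)
  then show ?case by (cases "i = 0") (simp_all add: P1 P_Suc)
qed simp

lemmas T_simps = T_commute T_left_commute mult.assoc

lemma P_inverse: "i \<in> {1..n} \<Longrightarrow> P i * P' i = 1"
proof (induction i)
  case (Suc i)
  show ?case
  proof (cases "i = 0")
    case False
    then have I: "i \<in> {1..n}" using Suc by auto
    then have "P (Suc i) * P' (Suc i) = (K i * K' i) * ((M i * M' i) * (P i * P' i))"
      using P_in_T[OF I] by (simp add: P_Suc T_simps)
    then show ?thesis using Suc I by (simp add: inv)
  qed (simp add: P1)
qed simp

text \<open>
  \<open>K\<^sub>i M\<^sub>i\<close> acts on the \<open>m\<close>-th generator nontrivially only for \<open>i = m\<close> and \<open>i = m + 1\<close>, with the same weight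
  \<open>t\<close>.  In the alternating product the two contributions cancel unless \<open>i = m + 1\<close>.
\<close>

lemma P_qcomm:
  assumes t: "t \<noteq> 0" and m: "m \<ge> 1"
    and z: "\<And>i. i \<in> {1..n} \<Longrightarrow> qcomm (if i = m \<or> i = Suc m then t else 1) (K i * M i) z"
    and i: "i \<in> {1..n}"
  shows "qcomm (if i = Suc m then inverse t else 1) (P i) z \<and> qcomm (if i = Suc m then t else 1) (P' i) z"
  using i
proof (induction i)
  case (Suc i)
  show ?case
  proof (cases "i = 0")
    case False
    then have I: "i \<in> {1..n}" using Suc by auto
    have u: "(K i * M i) * (M' i * K' i) = 1" "(M' i * K' i) * (K i * M i) = 1"
    proof -
      have "(K i * M i) * (M' i * K' i) = (K i * K' i) * (M i * M' i)" using I by (simp add: T_simps)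
      then show "(K i * M i) * (M' i * K' i) = 1" using I by (simp add: inv)
      then show "(M' i * K' i) * (K i * M i) = 1" using I T_commute[of "M' i * K' i" "K i * M i"] by simp
    qed
    have 1: "qcomm (if i = m \<or> i = Suc m then t else 1) (K i * M i) z" by (rule z[OF I])
    have 2: "qcomm (inverse (if i = m \<or> i = Suc m then t else 1)) (M' i * K' i) z"
      by (rule qcomm_inverse[OF 1 _ u]) (simp add: t)
    have IH: "qcomm (if i = Suc m then inverse t else 1) (P i) z" "qcomm (if i = Suc m then t else 1) (P' i) z"
      using Suc.IH I by auto
    show ?thesis
      using qcomm_mult_left[OF 1 IH(1)] qcomm_mult_left[OF 2 IH(2)] False t
      by (cases "i = m"; cases "i = Suc m") (simp_all add: P_Suc)
  qed (use m in \<open>simp add: P1\<close>)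
qed simp

lemma weights:
  assumes "i \<in> {1..n}" "m \<in> {1..<n}"
  shows "qcomm (r powi pairing n (eps i) (alpha m)) (K i * P i) (x m)"
    "qcomm (s powi pairing n (eps i) (alpha m)) (M i * P i) (x m)"
    "qcomm (r powi (- pairing n (eps i) (alpha m))) (K i * P i) (y m)"
    "qcomm (s powi (- pairing n (eps i) (alpha m))) (M i * P i) (y m)"
proof -
  have KMx: "qcomm (if i = m \<or> i = Suc m then r * s else 1) (K i * M i) (x m)" if "i \<in> {1..n}" for i
    using qcomm_mult_left[OF Kx[of i m] Mx[of i m]] that assms nz
    by (cases i m rule: linorder_cases) (auto simp: wt_def split: if_splits)
  have KMy: "qcomm (if i = m \<or> i = Suc m then inverse (r * s) else 1) (K i * M i) (y m)" if "i \<in> {1..n}" for i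
    using qcomm_mult_left[OF Ky[of i m] My[of i m]] that assms nz
    by (cases i m rule: linorder_cases) (auto simp: wt_def field_simps split: if_splits)
  have Px: "qcomm (if i = Suc m then inverse (r * s) else 1) (P i) (x m)"
    using P_qcomm[of "r * s" m "x m" i, OF _ _ KMx] assms nz by simp
  have Py: "qcomm (if i = Suc m then r * s else 1) (P i) (y m)"
    using P_qcomm[of "inverse (r * s)" m "y m" i, OF _ _ KMy] assms nz
    unfolding inverse_inverse_eq by simp
  note p = pairing_eps_alpha[OF assms(1)]
  consider "i = m" | "i = Suc m" | "i < m" | "Suc m < i" by linarith
  note cases = this
  show "qcomm (r powi pairing n (eps i) (alpha m)) (K i * P i) (x m)"
    using qcomm_mult_left[OF Kx[OF assms] Px] nz
    unfolding p by (cases rule: cases) (simp_all add: power_int_minus field_simps)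
  show "qcomm (s powi pairing n (eps i) (alpha m)) (M i * P i) (x m)"
    using qcomm_mult_left[OF Mx[OF assms] Px] nz
    unfolding p by (cases rule: cases) (simp_all add: power_int_minus field_simps)
  show "qcomm (r powi (- pairing n (eps i) (alpha m))) (K i * P i) (y m)"
    using qcomm_mult_left[OF Ky[OF assms] Py] nz
    unfolding p by (cases rule: cases) (simp_all add: power_int_minus field_simps)
  show "qcomm (s powi (- pairing n (eps i) (alpha m))) (M i * P i) (y m)"
    using qcomm_mult_left[OF My[OF assms] Py] nz
    unfolding p by (cases rule: cases) (simp_all add: power_int_minus field_simps)
qed

text \<open>
  \<open>P\<^sub>i P\<^sub>i\<^sub>+\<^sub>1 = (K\<^sub>i M\<^sub>i)\<^sup>-\<^sup>1\<close>: the products \<open>a\<^sub>i b\<^sub>i\<^sub>+\<^sub>1\<close> and \<open>a\<^sub>i\<^sub>+\<^sub>1 b\<^sub>i\<close> of the relation for \<open>[e\<^sub>i, f\<^sub>i]\<close> are the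
  ratios that occur in the commutator of root vectors.
\<close>

lemma cartan_products:
  assumes "i \<in> {1..<n}"
  shows "(K i * P i) * (M (Suc i) * P (Suc i)) = M (Suc i) * M' i"
    "(K (Suc i) * P (Suc i)) * (M i * P i) = K (Suc i) * K' i"
proof -
  have I: "i \<in> {1..n}" "Suc i \<in> {1..n}" using assms by auto
  have "(K i * P i) * (M (Suc i) * P (Suc i)) = (K i * K' i) * ((P i * P' i) * (M (Suc i) * M' i))"
    using P_in_T[OF I(1)] I by (simp add: P_Suc T_simps)
  then show "(K i * P i) * (M (Suc i) * P (Suc i)) = M (Suc i) * M' i" using I by (simp add: P_inverse inv)
  have "(K (Suc i) * P (Suc i)) * (M i * P i) = (M i * M' i) * ((P i * P' i) * (K (Suc i) * K' i))"
    using P_in_T[OF I(1)] I by (simp add: P_Suc T_simps)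
  then show "(K (Suc i) * P (Suc i)) * (M i * P i) = K (Suc i) * K' i" using I by (simp add: P_inverse inv)
qed

lemma satisfies_Urs:
  assumes \<eta>: "\<eta> = (s - r) / (r * s)"
    and H: "\<And>i. H (Ge i) = (r / (r - s)) *: x i" "\<And>i. H (Gf i) = (s / (s - r)) *: y i"
      "\<And>i. H (Ga i) = K i * P i" "\<And>i. H (Gainv i) = P' i * K' i"
      "\<And>i. H (Gb i) = M i * P i" "\<And>i. H (Gbinv i) = P' i * M' i"
  shows "satisfies (Urs_rels n r s) H"
proof -
  have TH: "H u \<in> T" if "u \<in> Urs_cartan_gens n" for u
    using that P_in_T by (auto simp: Urs_cartan_gens_def H)
  have ainv: "H (Ga i) * H (Gainv i) = 1" "H (Gb i) * H (Gbinv i) = 1" if "i \<in> {1..n}" for i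
  proof -
    have "u * P i * (P' i * v) = u * v" for u v
      using P_inverse[OF that] by (simp add: mult.assoc) (simp add: mult.assoc[symmetric])
    then show "H (Ga i) * H (Gainv i) = 1" "H (Gb i) * H (Gbinv i) = 1" unfolding H using inv that by auto
  qed
  have "serre n (inverse s) (inverse r) (\<lambda>i. H (Gf i))"
    unfolding H by (rule serre_scale[OF Y.serre_axioms])
  then interpret SF: serre n "inverse s" "inverse r" 0 "\<lambda>i. H (Gf i)" .
  have "serre n r s (\<lambda>i. H (Ge i))"
    unfolding H by (rule serre_scale[OF X.serre_axioms])
  then interpret SE: serre n r s 0 "\<lambda>i. H (Ge i)" .
  have far_E: "H (Ge i) * H (Ge j) = H (Ge j) * H (Ge i)" and far_F: "H (Gf i) * H (Gf j) = H (Gf j) * H (Gf i)"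
    if "i \<in> {1..<n}" "j \<in> {1..<n}" and dist: "\<bar>int i - int j\<bar> > 1" for i j
  proof -
    consider "i + 1 < j" | "j + 1 < i" using dist by linarith
    note cases = this
    show "H (Ge i) * H (Ge j) = H (Ge j) * H (Ge i)"
      using SE.far[of i j] SE.far[of j i] that(1,2) by (cases rule: cases) simp_all
    show "H (Gf i) * H (Gf j) = H (Gf j) * H (Gf i)"
      using SF.far[of i j] SF.far[of j i] that(1,2) by (cases rule: cases) simp_all
  qed
  have w: "H (Ga i) * H (Ge j) = (r powi pairing n (eps i) (alpha j)) *: (H (Ge j) * H (Ga i))"
     "H (Gb i) * H (Ge j) = (s powi pairing n (eps i) (alpha j)) *: (H (Ge j) * H (Gb i))"
     "H (Ga i) * H (Gf j) = (r powi (- pairing n (eps i) (alpha j))) *: (H (Gf j) * H (Ga i))"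
     "H (Gb i) * H (Gf j) = (s powi (- pairing n (eps i) (alpha j))) *: (H (Gf j) * H (Gb i))"
    if "i \<in> {1..n}" "j \<in> {1..<n}" for i j
    unfolding H using qcomm_scale[OF weights(1)[OF that]] qcomm_scale[OF weights(2)[OF that]]
      qcomm_scale[OF weights(3)[OF that]] qcomm_scale[OF weights(4)[OF that]] by (simp_all add: qcomm_def)
  have c: "(r / (r - s)) * (s / (s - r)) * \<eta> = 1 / (r - s)"
  proof -
    have "(r / d) * (s / - d) * (- d / (r * s)) = 1 / d" if "d \<noteq> 0" for d
      using that nz by (simp add: field_simps)
    from this[of "r - s"] show ?thesis unfolding \<eta> using rs by simp
  qed
  have sc: "a *: u * b *: v - b *: v * a *: u = (a * b) *: (u * v - v * u)" for a b and u v :: 'a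
    by (simp add: scaleC_linear mult.commute)
  have ef: "H (Ge i) * H (Gf j) - H (Gf j) * H (Ge i)
    = (of_bool (i = j) / (r - s)) *: (H (Ga i) * H (Gb (Suc i)) - H (Ga (Suc i)) * H (Gb i))"
    if "i \<in> {1..<n}" "j \<in> {1..<n}" for i j
  proof (cases "i = j")
    case True
    then show ?thesis
      unfolding True[symmetric] H sc xy_same[OF that(1)] scaleC_scaleC c cartan_products[OF that(1)]
      by (simp add: True[symmetric])
  next
    case False
    then show ?thesis unfolding H sc using xy[OF that False] by simp
  qed
  note monomials = peval_simps scaleC_push power2_eq_square mult.assoc
    add.commute[of "inverse r"] mult.commute[of "inverse r"]
  show ?thesis
    unfolding satisfies_def
  proof clarify
    fix p q assume "(p, q) \<in> Urs_rels n r s"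
    then show "peval H p = peval H q"
    proof cases
      case (R1_comm u v)
      then show ?thesis using T_commute[OF TH TH] by (simp add: peval_simps)
    next
      case (R6_1 i)
      then show ?thesis using SE.serre1[of i] by (simp add: monomials)
    next
      case (R6_2 i)
      then show ?thesis using SE.serre2[of i] by (simp add: monomials)
    next
      case (R7_1 i)
      then show ?thesis using SF.serre1[of i] by (simp add: monomials)
    next
      case (R7_2 i)
      then show ?thesis using SF.serre2[of i] by (simp add: monomials)
    qed (use ainv w ef far_E far_F in \<open>simp_all add: peval_simps scaleC_push\<close>)
  qed
qed

end

section \<open>The two assignments on generators\<close>

text \<open>\<open>rootv\<close> at the level of noncommutative polynomials.\<close>

primrec rootp :: "complex \<Rightarrow> complex \<Rightarrow> (nat \<Rightarrow> 'g ncpoly) \<Rightarrow> nat \<Rightarrow> nat \<Rightarrow> 'g ncpoly" where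
  "rootp k s p i 0 = (if i = 0 then 1 else 0)"
| "rootp k s p i (Suc j) =
    (if j < i then (if Suc j = i then 1 else 0)
     else if j = i then p i
     else scal k * (rootp k s p i j * p j - scal s * (p j * rootp k s p i j)))"

lemma peval_rootp: "peval G (rootp k s p i j) = rootv k s (\<lambda>m. peval G (p m)) i j"
  by (induction j) (simp_all add: rootv.simps peval_simps scaleC_push)

lemma rootp_closed:
  "(\<And>m. i \<le> m \<Longrightarrow> m < j \<Longrightarrow> p m \<in> carrier (free_alg X)) \<Longrightarrow> rootp k s p i j \<in> carrier (free_alg X)"
  by (induction j) auto

definition kfactor :: "bool \<Rightarrow> nat \<Rightarrow> lgen ncpoly" where
  "kfactor b i = (if b then gen (LMinv i) * gen (LPinv i) else gen (LP i i) * gen (LM i i))"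

lemma peval_kfactor:
  "peval G (kfactor b i) = (if b then G (LMinv i) * G (LPinv i) else G (LP i i) * G (LM i i))"
  by (simp add: kfactor_def peval_mult peval_gen)

text \<open>
  For \<open>b = True\<close> the alternating product by which \<open>\<psi>\<close> multiplies \<open>K\<^sup>\<plusminus>\<^sub>i\<close>, for \<open>b = False\<close> its inverse.
\<close>

primrec kprod :: "bool \<Rightarrow> nat \<Rightarrow> lgen ncpoly" where
  "kprod b 0 = 1"
| "kprod b (Suc i) = (if i = 0 then 1 else kfactor b i * kprod (\<not> b) i)"

text \<open>
  Written in \<open>a\<close> and \<open>b\<close>, the alternating product is the inverse of \<open>a\<^sub>1 b\<^sub>1 \<cdots> a\<^sub>i\<^sub>-\<^sub>1 b\<^sub>i\<^sub>-\<^sub>1\<close>, so that the inverse of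
  \<open>\<psi>\<close> maps \<open>K\<^sup>+\<^sub>i\<close> to \<open>a\<^sub>i\<close> times this product.  The index \<open>0\<close> does not occur among the generators.
\<close>

primrec qprod :: "nat \<Rightarrow> ugen ncpoly" where
  "qprod 0 = 1"
| "qprod (Suc i) = (if i = 0 then 1 else qprod i * (gen (Ga i) * gen (Gb i)))"

primrec qinv :: "nat \<Rightarrow> ugen ncpoly" where
  "qinv 0 = 1"
| "qinv (Suc i) = (if i = 0 then 1 else (gen (Gbinv i) * gen (Gainv i)) * qinv i)"

primrec psi_poly :: "complex \<Rightarrow> complex \<Rightarrow> ugen \<Rightarrow> lgen ncpoly" where
  "psi_poly r s (Ge i) = scal (r / (r - s)) * (gen (LPinv i) * gen (LP i (i + 1)))"
| "psi_poly r s (Gf i) = scal (s / (s - r)) * (gen (LM (i + 1) i) * gen (LMinv i))"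
| "psi_poly r s (Ga i) = gen (LP i i) * kprod True i"
| "psi_poly r s (Gainv i) = kprod False i * gen (LPinv i)"
| "psi_poly r s (Gb i) = gen (LM i i) * kprod True i"
| "psi_poly r s (Gbinv i) = kprod False i * gen (LMinv i)"

primrec phi_poly :: "complex \<Rightarrow> complex \<Rightarrow> lgen \<Rightarrow> ugen ncpoly" where
  "phi_poly r s (LP i j) = (gen (Ga i) * qprod i)
      * rootp (r / (r - s)) s (\<lambda>m. scal ((r - s) / r) * gen (Ge m)) i j"
| "phi_poly r s (LM j i) = rootp (r * s / (r - s)) (inverse r) (\<lambda>m. scal ((s - r) / s) * gen (Gf m)) i j
      * (gen (Gb i) * qprod i)"
| "phi_poly r s (LPinv i) = qinv i * gen (Gainv i)"
| "phi_poly r s (LMinv i) = qinv i * gen (Gbinv i)"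

lemma kprod_closed: "i \<in> {1..n} \<Longrightarrow> kprod b i \<in> carrier (free_alg (UR_gens n))"
proof (induction i arbitrary: b)
  case (Suc i)
  then show ?case
    by (cases "i = 0") (auto intro!: free_alg_mult free_alg_gen simp: UR_gens_def kfactor_def)
qed simp

lemma psi_poly_closed: "u \<in> Urs_gens n \<Longrightarrow> psi_poly r s u \<in> carrier (free_alg (UR_gens n))"
  unfolding Urs_gens_def Urs_cartan_gens_def
  by (elim UnE UN_E insertE emptyE; hypsubst; simp only: psi_poly.simps;
      intro free_alg_mult free_alg_scal free_alg_gen kprod_closed; auto simp: UR_gens_def)

lemma qprod_closed: "i \<in> {1..n} \<Longrightarrow> qprod i \<in> carrier (free_alg (Urs_gens n)) \<and> qinv i \<in> carrier (free_alg (Urs_gens n))"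
proof (induction i)
  case (Suc i)
  then show ?case
    by (cases "i = 0") (auto intro!: free_alg_mult free_alg_gen simp: Urs_gens_def Urs_cartan_gens_def)
qed simp

lemma phi_poly_closed: "v \<in> UR_gens n \<Longrightarrow> phi_poly r s v \<in> carrier (free_alg (Urs_gens n))"
  unfolding UR_gens_def
  by (elim UnE CollectE exE conjE; hypsubst; simp only: phi_poly.simps;
      intro free_alg_mult free_alg_scal free_alg_gen rootp_closed qprod_closed[THEN conjunct1] qprod_closed[THEN conjunct2];
      auto simp: Urs_gens_def Urs_cartan_gens_def)

section \<open>A solution of the RLL relations in \<open>U\<^sub>r\<^sub>,\<^sub>s(gl\<^sub>n)\<close>\<close>

locale urs_point =
  fixes n :: nat and r s :: complex and G :: "ugen \<Rightarrow> 'a::calg"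
  assumes r0: "r \<noteq> 0" and s0: "s \<noteq> 0" and rs: "r \<noteq> s" and rs0: "r + s \<noteq> 0"
    and sat: "satisfies (Urs_rels n r s) G"
begin

definition T where "T = monoid_span (G ` Urs_cartan_gens n)"
definition Q where "Q i = peval G (qprod i)"
definition Q' where "Q' i = peval G (qinv i)"
definition K where "K i = G (Ga i) * Q i"
definition K' where "K' i = Q' i * G (Gainv i)"
definition M where "M i = G (Gb i) * Q i"
definition M' where "M' i = Q' i * G (Gbinv i)"

lemma satD: "(p, q) \<in> Urs_rels n r s \<Longrightarrow> peval G p = peval G q"
  using sat by (auto simp: satisfies_def)

lemma T_commute: "u \<in> T \<Longrightarrow> v \<in> T \<Longrightarrow> u * v = v * u"
  unfolding T_def
proof (rule monoid_span_commute)
  fix u v assume "u \<in> G ` Urs_cartan_gens n" "v \<in> G ` Urs_cartan_gens n"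
  then show "u * v = v * u" using satD[OF Urs_rels.R1_comm] by (auto simp: peval_simps)
qed

lemma T_left_commute: "u \<in> T \<Longrightarrow> v \<in> T \<Longrightarrow> u * (v * z) = v * (u * z)"
  using T_commute by (simp add: mult.assoc[symmetric])

lemma T_base [simp]:
  assumes "i \<in> {1..n}"
  shows "G (Ga i) \<in> T" "G (Gainv i) \<in> T" "G (Gb i) \<in> T" "G (Gbinv i) \<in> T"
  using assms unfolding T_def Urs_cartan_gens_def by (auto intro!: monoid_span.base)

lemma T_one [simp]: "1 \<in> T" and T_mult [simp]: "u \<in> T \<Longrightarrow> v \<in> T \<Longrightarrow> u * v \<in> T"
  unfolding T_def by (auto intro: monoid_span.intros)

lemmas T_simps = T_commute T_left_commute mult.assoc

lemma Q_simps: "Q (Suc 0) = 1" "Q' (Suc 0) = 1"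
  "1 \<le> i \<Longrightarrow> Q (Suc i) = Q i * (G (Ga i) * G (Gb i))"
  "1 \<le> i \<Longrightarrow> Q' (Suc i) = (G (Gbinv i) * G (Gainv i)) * Q' i"
  by (simp_all add: Q_def Q'_def peval_simps)

lemma Q_in_T: "i \<in> {1..n} \<Longrightarrow> Q i \<in> T \<and> Q' i \<in> T"
proof (induction i)
  case (Suc i)
  then show ?case by (cases "i = 0") (simp_all add: Q_simps)
qed simp

lemma a_inv: "i \<in> {1..n} \<Longrightarrow> G (Ga i) * G (Gainv i) = 1" "i \<in> {1..n} \<Longrightarrow> G (Gb i) * G (Gbinv i) = 1"
  using satD[OF Urs_rels.R1_a] satD[OF Urs_rels.R1_b] by (auto simp: peval_simps)

lemma Q_inverse: "i \<in> {1..n} \<Longrightarrow> Q i * Q' i = 1"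
proof (induction i)
  case (Suc i)
  show ?case
  proof (cases "i = 0")
    case False
    then have I: "i \<in> {1..n}" using Suc by auto
    then have "Q (Suc i) * Q' (Suc i)
        = (G (Ga i) * G (Gainv i)) * ((G (Gb i) * G (Gbinv i)) * (Q i * Q' i))"
      using Q_in_T[OF I] by (simp add: Q_simps T_simps)
    then show ?thesis using Suc I by (simp add: a_inv)
  qed (simp add: Q_simps)
qed simp

lemma K_in_T: "i \<in> {1..n} \<Longrightarrow> K i \<in> T" "i \<in> {1..n} \<Longrightarrow> K' i \<in> T" "i \<in> {1..n} \<Longrightarrow> M i \<in> T" "i \<in> {1..n} \<Longrightarrow> M' i \<in> T"
  using Q_in_T by (simp_all add: K_def K'_def M_def M'_def)

lemma K_inv:
  assumes "i \<in> {1..n}"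
  shows "K i * K' i = 1" "K' i * K i = 1" "M i * M' i = 1" "M' i * M i = 1"
proof -
  have "K i * K' i = (G (Ga i) * G (Gainv i)) * (Q i * Q' i)" "M i * M' i = (G (Gb i) * G (Gbinv i)) * (Q i * Q' i)"
    using Q_in_T[OF assms] assms by (simp_all add: K_def K'_def M_def M'_def T_simps)
  then show "K i * K' i = 1" "M i * M' i = 1" using assms by (simp_all add: a_inv Q_inverse)
  then show "K' i * K i = 1" "M' i * M i = 1" using assms by (simp_all add: T_commute K_in_T)
qed

lemma ratios:
  assumes "i \<in> {1..<n}"
  shows "M (Suc i) * M' i = G (Ga i) * G (Gb (Suc i))" "K (Suc i) * K' i = G (Ga (Suc i)) * G (Gb i)"
proof -
  have I: "i \<in> {1..n}" "Suc i \<in> {1..n}" using assms by auto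
  have "M (Suc i) * M' i = (Q i * Q' i) * ((G (Gb i) * G (Gbinv i)) * (G (Ga i) * G (Gb (Suc i))))"
    using Q_in_T[OF I(1)] I by (simp add: M_def M'_def Q_simps T_simps)
  then show "M (Suc i) * M' i = G (Ga i) * G (Gb (Suc i))" using I by (simp add: a_inv Q_inverse)
  have "K (Suc i) * K' i = (Q i * Q' i) * ((G (Ga i) * G (Gainv i)) * (G (Ga (Suc i)) * G (Gb i)))"
    using Q_in_T[OF I(1)] I by (simp add: K_def K'_def Q_simps T_simps)
  then show "K (Suc i) * K' i = G (Ga (Suc i)) * G (Gb i)" using I by (simp add: a_inv Q_inverse)
qed

text \<open>
  The weights of \<open>a\<^sub>m b\<^sub>m\<close> and \<open>a\<^sub>m\<^sub>+\<^sub>1 b\<^sub>m\<^sub>+\<^sub>1\<close> on the \<open>m\<close>-th generator are inverse to each other, so that only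
  the product that ends between them has a weight.
\<close>

lemma Q_qcomm:
  assumes t: "t \<noteq> 0" and m: "m \<ge> 1"
    and z: "\<And>i. i \<in> {1..n} \<Longrightarrow> qcomm (if i = m then t else if i = Suc m then inverse t else 1) (G (Ga i) * G (Gb i)) z"
    and i: "i \<in> {1..n}"
  shows "qcomm (if i = Suc m then t else 1) (Q i) z"
  using i
proof (induction i)
  case (Suc i)
  show ?case
  proof (cases "i = 0")
    case False
    then have I: "i \<in> {1..n}" using Suc by auto
    show ?thesis
      using qcomm_mult_left[OF Suc.IH[OF I] z[OF I]] False t
      by (cases "i = m"; cases "i = Suc m") (simp_all add: Q_simps)
  qed (use m in \<open>simp add: Q_simps\<close>)
qed simp

lemma weights:
  assumes "i \<in> {1..n}" "m \<in> {1..<n}"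
  shows "qcomm (wt r s i (Suc m) / wt r s i m) (K i) (G (Ge m))"
    "qcomm (wt r s m i / wt r s (Suc m) i) (M i) (G (Ge m))"
    "qcomm (wt r s i m / wt r s i (Suc m)) (K i) (G (Gf m))"
    "qcomm (wt r s (Suc m) i / wt r s m i) (M i) (G (Gf m))"
proof -
  have nz: "r \<noteq> 0" "s \<noteq> 0" by (rule r0 s0)+
  have gen: "qcomm (if i = m then r else if i = Suc m then inverse r else 1) (G (Ga i)) (G (Ge m))"
    "qcomm (if i = m then s else if i = Suc m then inverse s else 1) (G (Gb i)) (G (Ge m))"
    "qcomm (if i = m then inverse r else if i = Suc m then r else 1) (G (Ga i)) (G (Gf m))"
    "qcomm (if i = m then inverse s else if i = Suc m then s else 1) (G (Gb i)) (G (Gf m))"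
    if "i \<in> {1..n}" for i
    using satD[OF Urs_rels.R2_e[OF that assms(2)]] satD[OF Urs_rels.R3_e[OF that assms(2)]]
      satD[OF Urs_rels.R2_f[OF that assms(2)]] satD[OF Urs_rels.R3_f[OF that assms(2)]]
    unfolding pairing_eps_alpha[OF that]
    by (simp_all add: peval_simps scaleC_push qcomm_def power_int_minus)
  have ab: "qcomm (if i = m then r * s else if i = Suc m then inverse (r * s) else 1) (G (Ga i) * G (Gb i)) (G (Ge m))"
    "qcomm (if i = m then inverse (r * s) else if i = Suc m then inverse (inverse (r * s)) else 1) (G (Ga i) * G (Gb i)) (G (Gf m))"
    if "i \<in> {1..n}" for i
    using qcomm_mult_left[OF gen(1,2)[OF that]] qcomm_mult_left[OF gen(3,4)[OF that]]
    by (auto split: if_splits simp: mult.commute)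
  have Qe: "qcomm (if i = Suc m then r * s else 1) (Q i) (G (Ge m))"
    using Q_qcomm[OF _ _ ab(1) assms(1)] assms nz by simp
  have Qf: "qcomm (if i = Suc m then inverse (r * s) else 1) (Q i) (G (Gf m))"
    using Q_qcomm[OF _ _ ab(2) assms(1)] assms nz by simp
  consider "i = m" | "i = Suc m" | "i < m" | "Suc m < i" by linarith
  note cases = this
  show "qcomm (wt r s i (Suc m) / wt r s i m) (K i) (G (Ge m))"
    using qcomm_mult_left[OF gen(1)[OF assms(1)] Qe] nz
    unfolding K_def by (cases rule: cases) (simp_all add: field_simps)
  show "qcomm (wt r s m i / wt r s (Suc m) i) (M i) (G (Ge m))"
    using qcomm_mult_left[OF gen(2)[OF assms(1)] Qe] nz
    unfolding M_def by (cases rule: cases) (simp_all add: field_simps)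
  show "qcomm (wt r s i m / wt r s i (Suc m)) (K i) (G (Gf m))"
    using qcomm_mult_left[OF gen(3)[OF assms(1)] Qf] nz
    unfolding K_def by (cases rule: cases) (simp_all add: field_simps)
  show "qcomm (wt r s (Suc m) i / wt r s m i) (M i) (G (Gf m))"
    using qcomm_mult_left[OF gen(4)[OF assms(1)] Qf] nz
    unfolding M_def by (cases rule: cases) (simp_all add: field_simps)
qed

lemma serre_e: "serre n r s (\<lambda>m. G (Ge m))"
proof
  fix i assume i: "1 \<le> i" "i + 1 < n"
  show "G (Ge i) * (G (Ge i) * G (Ge (i + 1))) - (r + s) *: (G (Ge i) * (G (Ge (i + 1)) * G (Ge i)))
      + (r * s) *: (G (Ge (i + 1)) * (G (Ge i) * G (Ge i))) = 0"
    using satD[OF Urs_rels.R6_1[OF i]] by (simp add: peval_simps scaleC_push power2_eq_square mult.assoc)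
  show "G (Ge i) * (G (Ge (i + 1)) * G (Ge (i + 1))) - (r + s) *: (G (Ge (i + 1)) * (G (Ge i) * G (Ge (i + 1))))
      + (r * s) *: (G (Ge (i + 1)) * (G (Ge (i + 1)) * G (Ge i))) = 0"
    using satD[OF Urs_rels.R6_2[OF i]] by (simp add: peval_simps scaleC_push power2_eq_square mult.assoc)
next
  fix i j assume "1 \<le> i" "i + 1 < j" "j < n"
  then show "G (Ge i) * G (Ge j) = G (Ge j) * G (Ge i)"
    using satD[OF Urs_rels.R5_e[of i n j]] by (simp add: peval_simps)
qed (rule r0 s0 rs0)+

lemma serre_f: "serre n (inverse s) (inverse r) (\<lambda>m. G (Gf m))"
proof
  fix i assume i: "1 \<le> i" "i + 1 < n"
  show "G (Gf i) * (G (Gf i) * G (Gf (i + 1))) - (inverse s + inverse r) *: (G (Gf i) * (G (Gf (i + 1)) * G (Gf i)))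
      + (inverse s * inverse r) *: (G (Gf (i + 1)) * (G (Gf i) * G (Gf i))) = 0"
    using satD[OF Urs_rels.R7_1[OF i]]
    by (simp add: peval_simps scaleC_push power2_eq_square mult.assoc add.commute[of "inverse s"] mult.commute[of "inverse s"])
  show "G (Gf i) * (G (Gf (i + 1)) * G (Gf (i + 1))) - (inverse s + inverse r) *: (G (Gf (i + 1)) * (G (Gf i) * G (Gf (i + 1))))
      + (inverse s * inverse r) *: (G (Gf (i + 1)) * (G (Gf (i + 1)) * G (Gf i))) = 0"
    using satD[OF Urs_rels.R7_2[OF i]]
    by (simp add: peval_simps scaleC_push power2_eq_square mult.assoc add.commute[of "inverse s"] mult.commute[of "inverse s"])
next
  fix i j assume "1 \<le> i" "i + 1 < j" "j < n"
  then show "G (Gf i) * G (Gf j) = G (Gf j) * G (Gf i)"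
    using satD[OF Urs_rels.R5_f[of i n j]] by (simp add: peval_simps)
next
  have "inverse s + inverse r = (r + s) / (r * s)" using r0 s0 by (simp add: field_simps)
  then show "inverse s + inverse r \<noteq> 0" using r0 s0 rs0 by simp
qed (use r0 s0 in auto)

text \<open>
  The factors are the inverses of those in the definition of \<open>\<psi>\<close>: with them the simple generators become the
  Gauss coordinates next to the diagonal.
\<close>

sublocale double_torus n r s "r / (r - s)" "r * s / (r - s)" "(s - r) / (r * s)"
  "\<lambda>m. ((r - s) / r) *: G (Ge m)" "\<lambda>m. ((s - r) / s) *: G (Gf m)" K K' M M'
proof (intro double_torus.intro double_torus_axioms.intro serre_scale serre_e serre_f rs K_inv qcomm_scale weights)
  show "r / (r - s) * (r * s / (r - s)) * ((s - r) / (r * s)) * (r - s) = - r"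
    by (rule structure_constant[OF r0 s0 rs])
  have sc: "a *: u * b *: v - b *: v * a *: u = (a * b) *: (u * v - v * u)" for a b and u v :: 'a
    by (simp add: scaleC_linear mult.commute)
  have ef: "G (Ge i) * G (Gf j) - G (Gf j) * G (Ge i)
    = (of_bool (i = j) / (r - s)) *: (G (Ga i) * G (Gb (Suc i)) - G (Ga (Suc i)) * G (Gb i))"
    if "i \<in> {1..<n}" "j \<in> {1..<n}" for i j
    using satD[OF Urs_rels.R4[OF that]] by (simp add: peval_simps scaleC_push)
  show "((r - s) / r) *: G (Ge i) * ((s - r) / s) *: G (Gf j) = ((s - r) / s) *: G (Gf j) * ((r - s) / r) *: G (Ge i)"
    if "i \<in> {1..<n}" "j \<in> {1..<n}" "i \<noteq> j" for i j
    using ef[OF that(1,2)] that(3) by (simp add: scaleC_push mult.commute)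
  fix i assume i: "i \<in> {1..<n}"
  have c: "((r - s) / r) * ((s - r) / s) * (of_bool (i = i) / (r - s)) = (s - r) / (r * s)"
    using rs by simp
  show "((r - s) / r) *: G (Ge i) * ((s - r) / s) *: G (Gf i) - ((s - r) / s) *: G (Gf i) * ((r - s) / r) *: G (Ge i)
      = ((s - r) / (r * s)) *: (M (Suc i) * M' i - K (Suc i) * K' i)"
    unfolding sc ef[OF i i] scaleC_scaleC c ratios[OF i] ..
qed (simp_all add: T_commute K_in_T)

lemma satisfies_UR: "satisfies (UR_rels n r s) (\<lambda>v. peval G (phi_poly r s v))"
proof -
  let ?H = "\<lambda>v. peval G (phi_poly r s v)"
  have LP: "?H (LP i j) = K i * E i j" and LM: "?H (LM j i) = F i j * M i"
    and inverses: "?H (LPinv i) = K' i" "?H (LMinv i) = M' i" for i j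
    by (simp_all add: peval_simps peval_rootp scaleC_push K_def K'_def M_def M'_def Q_def Q'_def)
  have plus: "peval ?H (Lplus i j) = K i * E i j" for i j
    unfolding Lplus_def using LP by (auto simp: peval_gen rootv_below)
  have minus: "peval ?H (Lminus p q) = F q p * M q" for p q
    unfolding Lminus_def using LM by (auto simp: peval_gen rootv_below)
  show ?thesis
    unfolding satisfies_UR_iff plus minus LP LM inverses
    using rll_plus rll_minus rll_mixed by (auto simp: inv)
qed

text \<open>
  The Cartan part reduces to the observation that the alternating product in \<open>K\<^sub>j = a\<^sub>j Q\<^sub>j\<close>, \<open>M\<^sub>j = b\<^sub>j Q\<^sub>j\<close> is the
  inverse of \<open>Q\<^sub>i\<close>.
\<close>

lemma psi_phi:
  assumes "u \<in> Urs_gens n"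
  shows "peval (\<lambda>v. peval G (phi_poly r s v)) (psi_poly r s u) = G u"
proof -
  let ?H = "\<lambda>v. peval G (phi_poly r s v)"
  have H: "?H (LP i i) = K i" "?H (LM i i) = M i" "?H (LPinv i) = K' i" "?H (LMinv i) = M' i"
     "?H (LP i (Suc i)) = K i * ((r - s) / r) *: G (Ge i)" "?H (LM (Suc i) i) = ((s - r) / s) *: G (Gf i) * M i" for i
    by (simp_all add: peval_simps peval_rootp scaleC_push K_def K'_def M_def M'_def Q_def Q'_def)
  have P: "peval ?H (kprod True i) = Q' i \<and> peval ?H (kprod False i) = Q i" if "i \<in> {1..n}" for i
    using that
  proof (induction i)
    case (Suc i)
    show ?case
    proof (cases "i = 0")
      case False
      then have I: "i \<in> {1..n}" using Suc by auto
      have "peval ?H (kprod True (Suc i)) = (M' i * K' i) * Q i" "peval ?H (kprod False (Suc i)) = (K i * M i) * Q' i"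
        using Suc.IH[OF I] False by (simp_all add: peval_mult peval_kfactor H del: phi_poly.simps)
      moreover have "(M' i * K' i) * Q i = (Q i * Q' i) * Q' (Suc i)" "(K i * M i) * Q' i = (Q i * Q' i) * Q (Suc i)"
        using Q_in_T[OF I] I False by (simp_all add: K_def K'_def M_def M'_def Q_simps T_simps)
      ultimately show ?thesis using Q_inverse[OF I] by simp
    qed (simp add: Q_simps peval_one)
  qed simp
  have Q'Q: "Q' i * Q i = 1" if "i \<in> {1..n}" for i using Q_inverse[OF that] Q_in_T[OF that] T_commute by simp
  from assms consider i where "i \<in> {1..<n}" "u = Ge i" | i where "i \<in> {1..<n}" "u = Gf i"
    | i where "i \<in> {1..n}" "u = Ga i" | i where "i \<in> {1..n}" "u = Gainv i"
    | i where "i \<in> {1..n}" "u = Gb i" | i where "i \<in> {1..n}" "u = Gbinv i"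
    unfolding Urs_gens_def Urs_cartan_gens_def by blast
  then show ?thesis
  proof cases
    case 1
    then have "K' i * (K i * z) = z" for z using K_inv(2)[of i] by (simp add: mult.assoc[symmetric])
    then show ?thesis using 1 r0 rs
      by (simp add: peval_simps H scaleC_push del: phi_poly.simps)
  next
    case 2
    then show ?thesis using K_inv(3)[of i] rs[symmetric] s0
      by (simp add: peval_simps H scaleC_push mult.assoc del: phi_poly.simps)
  qed (use P Q_inverse Q'Q in \<open>simp_all add: peval_mult peval_gen H K_def K'_def M_def M'_def mult.assoc del: phi_poly.simps\<close>,
      simp_all add: mult.assoc[symmetric])
qed

end

section \<open>A solution of the relations of \<open>U\<^sub>r\<^sub>,\<^sub>s(gl\<^sub>n)\<close> in \<open>U(R)\<close>\<close>

locale ur_point =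
  fixes n :: nat and r s :: complex and G :: "lgen \<Rightarrow> 'a::calg"
  assumes r0: "r \<noteq> 0" and s0: "s \<noteq> 0" and rs: "r \<noteq> s" and rs0: "r + s \<noteq> 0"
    and sat: "satisfies (UR_rels n r s) G"
begin

definition x where "x m = G (LPinv m) * G (LP m (Suc m))"
definition y where "y m = G (LM (Suc m) m) * G (LMinv m)"

lemma gauss:
  shows "double_torus n r s (r / (r - s)) (r * s / (r - s)) ((s - r) / (r * s)) x y
      (\<lambda>i. G (LP i i)) (\<lambda>i. G (LPinv i)) (\<lambda>i. G (LM i i)) (\<lambda>i. G (LMinv i))"
    and "\<And>i j. i \<in> {1..n} \<Longrightarrow> j \<in> {1..n} \<Longrightarrow> i \<le> j \<Longrightarrow> G (LP i j) = G (LP i i) * rootv (r / (r - s)) s x i j"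
    and "\<And>i j. i \<in> {1..n} \<Longrightarrow> j \<in> {1..n} \<Longrightarrow> i \<le> j \<Longrightarrow> G (LM j i) = rootv (r * s / (r - s)) (inverse r) y i j * G (LM i i)"
proof -
  let ?L = "\<lambda>i j. peval G (Lplus i j)" and ?N = "\<lambda>i j. peval G (Lminus i j)"
  have L: "?L i j = (if i \<le> j then G (LP i j) else 0)" "?N i j = (if j \<le> i then G (LM i j) else 0)" for i j
    by (simp_all add: Lplus_def Lminus_def peval_gen)
  have xy: "(\<lambda>m. G (LPinv m) * ?L m (Suc m)) = x" "(\<lambda>m. ?N (Suc m) m * G (LMinv m)) = y"
    by (simp_all add: fun_eq_iff x_def y_def L)
  note A = sat[unfolded satisfies_UR_iff]
  have up: "?L i j = 0" if "j < i" for i j using that by (simp add: L)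
  have low: "?N i j = 0" if "i < j" for i j using that by (simp add: L)
  have inv: "?L i i * G (LPinv i) = 1" "G (LPinv i) * ?L i i = 1" "?N i i * G (LMinv i) = 1" "G (LMinv i) * ?N i i = 1"
    if "i \<in> {1..n}" for i
    using A that by (simp_all add: L)
  note t = rll_triangular_to_double_torus[where L = ?L and N = ?N and K' = "\<lambda>i. G (LPinv i)" and M' = "\<lambda>i. G (LMinv i)",
      OF r0 s0 rs rs0 A[THEN conjunct1] A[THEN conjunct2, THEN conjunct1] A[THEN conjunct2, THEN conjunct2, THEN conjunct1],
      unfolded xy]
  show "double_torus n r s (r / (r - s)) (r * s / (r - s)) ((s - r) / (r * s)) x y
      (\<lambda>i. G (LP i i)) (\<lambda>i. G (LPinv i)) (\<lambda>i. G (LM i i)) (\<lambda>i. G (LMinv i))"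
    using t(1)[OF up low inv] by (simp add: L)
  show "G (LP i j) = G (LP i i) * rootv (r / (r - s)) s x i j" if "i \<in> {1..n}" "j \<in> {1..n}" "i \<le> j" for i j
    using t(2)[OF up low inv that(1,2)] that by (simp add: L)
  show "G (LM j i) = rootv (r * s / (r - s)) (inverse r) y i j * G (LM i i)" if "i \<in> {1..n}" "j \<in> {1..n}" "i \<le> j" for i j
    using t(3)[OF up low inv that(1,2)] that by (simp add: L)
qed

sublocale torus_products n r s "r / (r - s)" "r * s / (r - s)" "(s - r) / (r * s)" x y
  "\<lambda>i. G (LP i i)" "\<lambda>i. G (LPinv i)" "\<lambda>i. G (LM i i)" "\<lambda>i. G (LMinv i)"
  "\<lambda>i. peval G (kprod True i)" "\<lambda>i. peval G (kprod False i)"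
  by (intro torus_products.intro torus_products_axioms.intro gauss) (simp_all add: peval_simps peval_kfactor)

lemma psi_values:
  "peval G (psi_poly r s (Ge i)) = (r / (r - s)) *: x i" "peval G (psi_poly r s (Gf i)) = (s / (s - r)) *: y i"
  "peval G (psi_poly r s (Ga i)) = G (LP i i) * peval G (kprod True i)"
  "peval G (psi_poly r s (Gainv i)) = peval G (kprod False i) * G (LPinv i)"
  "peval G (psi_poly r s (Gb i)) = G (LM i i) * peval G (kprod True i)"
  "peval G (psi_poly r s (Gbinv i)) = peval G (kprod False i) * G (LMinv i)"
  by (simp_all add: peval_simps scaleC_push x_def y_def)

lemma satisfies_Urs_psi: "satisfies (Urs_rels n r s) (\<lambda>u. peval G (psi_poly r s u))"
  by (rule satisfies_Urs) (rule refl psi_values)+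

text \<open>
  Every entry of \<open>L\<^sup>\<plusminus>\<close> is determined by the diagonal and the entries next to it, by the second and
  third part of \<open>gauss\<close>.
\<close>

lemma phi_psi:
  assumes "v \<in> UR_gens n"
  shows "peval (\<lambda>u. peval G (psi_poly r s u)) (phi_poly r s v) = G v"
proof -
  let ?H = "\<lambda>u. peval G (psi_poly r s u)"
  let ?P = "\<lambda>i. peval G (kprod True i)" and ?P' = "\<lambda>i. peval G (kprod False i)"
  let ?K = "\<lambda>i. G (LP i i)" and ?K' = "\<lambda>i. G (LPinv i)" and ?M = "\<lambda>i. G (LM i i)" and ?M' = "\<lambda>i. G (LMinv i)"
  have Q: "peval ?H (qprod i) = ?P' i \<and> peval ?H (qinv i) = ?P i" if "i \<in> {1..n}" for i
    using that
  proof (induction i)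
    case (Suc i)
    show ?case
    proof (cases "i = 0")
      case False
      then have I: "i \<in> {1..n}" using Suc by auto
      have "peval ?H (qprod (Suc i)) = ?P' i * ((?K i * ?P i) * (?M i * ?P i))"
        "peval ?H (qinv (Suc i)) = (?P' i * ?M' i) * (?P' i * ?K' i) * ?P i"
        using Suc.IH[OF I] False by (simp_all add: peval_mult peval_gen psi_values del: psi_poly.simps kprod.simps)
      moreover have "?P' i * ((?K i * ?P i) * (?M i * ?P i)) = (?P i * ?P' i) * ?P' (Suc i)"
        "(?P' i * ?M' i) * (?P' i * ?K' i) * ?P i = (?P i * ?P' i) * ?P (Suc i)"
        using P_in_T[OF I] I False by (simp_all add: P_Suc T_simps del: kprod.simps)
      ultimately show ?thesis using P_inverse[OF I] by simp
    qed (simp add: peval_one)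
  qed simp
  have P'P: "?P' i * ?P i = 1" if "i \<in> {1..n}" for i using P_inverse[OF that] P_in_T[OF that] T_commute by simp
  have *: "a * ?P i * (?P' i * z) = a * z" "?P i * (?P' i * a) = a" if "i \<in> {1..n}" for a z i
    using P_inverse[OF that] by (simp_all add: mult.assoc) (simp_all add: mult.assoc[symmetric])
  have KP: "?K i * ?P i * ?P' i = ?K i" "?M i * ?P i * ?P' i = ?M i" if "i \<in> {1..n}" for i
    using P_inverse[OF that] by (simp_all add: mult.assoc)
  from assms consider i j where "i \<in> {1..n}" "j \<in> {1..n}" "i \<le> j" "v = LP i j"
    | i j where "i \<in> {1..n}" "j \<in> {1..n}" "i \<le> j" "v = LM j i"
    | i where "i \<in> {1..n}" "v = LPinv i" | i where "i \<in> {1..n}" "v = LMinv i"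
    unfolding UR_gens_def by force
  then show ?thesis
  proof cases
    case 1
    have "peval ?H (phi_poly r s v) = (?K i * ?P i * ?P' i) * rootv (r / (r - s)) s x i j"
      using Q[OF 1(1)] 1(4) r0 rs
      by (simp add: peval_mult peval_gen peval_scal scaleC_push peval_rootp psi_values del: psi_poly.simps)
    then show ?thesis using gauss(2)[OF 1(1-3)] KP[OF 1(1)] 1(4) by simp
  next
    case 2
    have "peval ?H (phi_poly r s v) = rootv (r * s / (r - s)) (inverse r) y i j * (?M i * ?P i * ?P' i)"
      using Q[OF 2(1)] 2(4) s0 rs
      by (simp add: peval_mult peval_gen peval_scal scaleC_push peval_rootp psi_values del: psi_poly.simps)
    then show ?thesis using gauss(3)[OF 2(1-3)] KP[OF 2(1)] 2(4) by simp
  next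
    case 3
    then show ?thesis using Q[OF 3(1)] * by (simp add: peval_mult peval_gen psi_values del: psi_poly.simps)
  next
    case 4
    then show ?thesis using Q[OF 4(1)] * by (simp add: peval_mult peval_gen psi_values del: psi_poly.simps)
  qed
qed

end

section \<open>The isomorphism\<close>

text \<open>
  One-dimensional representations for \<open>generic_point\<close>: here both matrices are the identity.
\<close>

lemma trivial_UR: "satisfies (UR_rels n r s) (\<lambda>v. case v of LP i j \<Rightarrow> of_bool (i = j) | LM i j \<Rightarrow> of_bool (i = j) | _ \<Rightarrow> (1 :: complex))"
  (is "satisfies _ ?d")
proof -
  have L: "peval ?d (Lplus i j) = of_bool (i = j)" "peval ?d (Lminus i j) = of_bool (i = j)" for i j
    by (simp_all add: Lplus_def Lminus_def peval_gen)
  show ?thesis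
    unfolding satisfies_UR_iff L rll_def by (auto simp: scaleC_complex_def)
qed

lemma trivial_Urs: "satisfies (Urs_rels n r s) (\<lambda>u. case u of Ge i \<Rightarrow> 0 | Gf i \<Rightarrow> 0 | _ \<Rightarrow> (1 :: complex))"
  unfolding satisfies_def
proof clarify
  fix p q assume "(p, q) \<in> Urs_rels n r s"
  then show "peval (\<lambda>u. case u of Ge i \<Rightarrow> 0 | Gf i \<Rightarrow> 0 | _ \<Rightarrow> (1 :: complex)) p = peval (\<lambda>u. case u of Ge i \<Rightarrow> 0 | Gf i \<Rightarrow> 0 | _ \<Rightarrow> 1) q"
    by cases (auto simp: peval_simps Urs_cartan_gens_def)
qed

lemma K_inverses:
  assumes "i \<in> {1..n}"
  shows "inv\<^bsub>UR n r s\<^esub> (Kplus n r s i) = UR_el n r s (LPinv i)"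
    "inv\<^bsub>UR n r s\<^esub> (Kminus n r s i) = UR_el n r s (LMinv i)"
proof -
  interpret P: presentation "UR_gens n" "UR_rels n r s" by (rule presentation_UR)
  interpret ring "UR n r s" by (rule ring_UR)
  have gens: "LP i i \<in> UR_gens n" "LM i i \<in> UR_gens n" "LPinv i \<in> UR_gens n" "LMinv i \<in> UR_gens n"
    using assms by (auto simp: UR_gens_def)
  have *: "UR_el n r s u \<otimes>\<^bsub>UR n r s\<^esub> UR_el n r s v = \<one>\<^bsub>UR n r s\<^esub>"
    if "(gen u * gen v, 1) \<in> UR_rels n r s" "u \<in> UR_gens n" "v \<in> UR_gens n" for u v
    using P.rel_class_rel[OF that(1)] that(2,3)
    by (simp add: P.rel_class_mult P.rel_class_one UR_el_def UR_def)
  have "(gen (LP i i) * gen (LPinv i), 1) \<in> UR_rels n r s" "(gen (LPinv i) * gen (LP i i), 1) \<in> UR_rels n r s"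
    "(gen (LM i i) * gen (LMinv i), 1) \<in> UR_rels n r s" "(gen (LMinv i) * gen (LM i i), 1) \<in> UR_rels n r s"
    using assms unfolding UR_rels_def by blast+
  then show "inv\<^bsub>UR n r s\<^esub> (Kplus n r s i) = UR_el n r s (LPinv i)"
    "inv\<^bsub>UR n r s\<^esub> (Kminus n r s i) = UR_el n r s (LMinv i)"
    unfolding Kplus_def Kminus_def using gens by (intro inv_char UR_el_closed *; simp)+
qed

lemma kprod_closed_form:
  "i \<ge> 1 \<Longrightarrow> kprod b i = foldr (*) (map (\<lambda>l. kfactor (b = odd l) (i - l)) [1..<i]) 1"
proof (induction i arbitrary: b)
  case (Suc i)
  show ?case
  proof (cases "i = 0")
    case False
    \<comment> \<open>The factor \<open>l = 1\<close> comes first; the others are those for \<open>i\<close>, with the parity of \<open>l\<close> changed.\<close>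
    have upt: "[1..<Suc i] = 1 # map Suc [1..<i]"
      using False by (simp add: upt_conv_Cons map_Suc_upt)
    have IH: "kprod (\<not> b) i = foldr (*) (map (\<lambda>l. kfactor ((\<not> b) = odd l) (i - l)) [1..<i]) 1"
      using Suc False by simp
    show ?thesis
      unfolding upt kprod.simps IH using False by (simp add: o_def)
  qed simp
qed simp

lemma (in monoid) inv_mult_Units:
  assumes "x \<in> Units G" "y \<in> Units G"
  shows "inv (x \<otimes> y) = inv y \<otimes> inv x"
proof (rule inv_char)
  note closed = Units_closed[OF assms(1)] Units_closed[OF assms(2)]
    Units_inv_closed[OF assms(1)] Units_inv_closed[OF assms(2)]
  have "x \<otimes> y \<otimes> (inv y \<otimes> inv x) = x \<otimes> (y \<otimes> inv y \<otimes> inv x)" using closed by (simp add: m_assoc)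
  then show "x \<otimes> y \<otimes> (inv y \<otimes> inv x) = \<one>" using closed assms by simp
  have "inv y \<otimes> inv x \<otimes> (x \<otimes> y) = inv y \<otimes> (inv x \<otimes> x \<otimes> y)" using closed by (simp add: m_assoc)
  then show "inv y \<otimes> inv x \<otimes> (x \<otimes> y) = \<one>" using closed assms by simp
qed (use assms in auto)

lemma Kprod_eq:
  assumes "i \<in> {1..n}"
  shows "rel_class (UR_gens n) (UR_rels n r s) (kprod True i) = Kprod n r s i"
proof -
  interpret P: presentation "UR_gens n" "UR_rels n r s" by (rule presentation_UR)
  interpret ring "UR n r s" by (rule ring_UR)
  let ?c = "rel_class (UR_gens n) (UR_rels n r s)"
  let ?fac = "\<lambda>l. kfactor (True = odd l) (i - l)"
  have gens: "LP j j \<in> UR_gens n" "LM j j \<in> UR_gens n" "LPinv j \<in> UR_gens n" "LMinv j \<in> UR_gens n" if "j \<in> {1..n}" for j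
    using that by (auto simp: UR_gens_def)
  have fac: "?fac l \<in> carrier (free_alg (UR_gens n))
      \<and> ?c (?fac l) = (Kplus n r s (i - l) \<otimes>\<^bsub>UR n r s\<^esub> Kminus n r s (i - l)) [^]\<^bsub>UR n r s\<^esub> ((-1) ^ l :: int)"
    if "l \<in> {1..<i}" for l
  proof -
    define j where "j = i - l"
    have j: "j \<in> {1..n}" using that assms by (auto simp: j_def)
    have K: "?c (gen (LP j j) * gen (LM j j)) = Kplus n r s j \<otimes>\<^bsub>UR n r s\<^esub> Kminus n r s j"
      using gens[OF j] by (simp add: P.rel_class_mult Kplus_def Kminus_def UR_el_def UR_def)
    have closed: "Kplus n r s j \<otimes>\<^bsub>UR n r s\<^esub> Kminus n r s j \<in> carrier (UR n r s)"
      using K_Units[OF j] by (intro m_closed Units_closed)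
    have "?c (gen (LMinv j) * gen (LPinv j)) = inv\<^bsub>UR n r s\<^esub> (?c (gen (LP j j) * gen (LM j j)))"
    proof -
      have "?c (gen (LMinv j) * gen (LPinv j))
          = inv\<^bsub>UR n r s\<^esub> (Kminus n r s j) \<otimes>\<^bsub>UR n r s\<^esub> inv\<^bsub>UR n r s\<^esub> (Kplus n r s j)"
        unfolding K_inverses[OF j] using gens[OF j] by (simp add: P.rel_class_mult UR_el_def UR_def)
      then show ?thesis unfolding K using K_Units[OF j] by (simp add: inv_mult_Units)
    qed
    then show ?thesis
      using gens[OF j] K closed
      by (cases "odd l") (simp_all add: j_def[symmetric] int_pow_def2 kfactor_def)
  qed
  have "foldr (*) (map ?fac ls) 1 \<in> carrier (free_alg (UR_gens n))
    \<and> ?c (foldr (*) (map ?fac ls) 1) = foldr (\<otimes>\<^bsub>UR n r s\<^esub>)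
      (map (\<lambda>l. (Kplus n r s (i - l) \<otimes>\<^bsub>UR n r s\<^esub> Kminus n r s (i - l)) [^]\<^bsub>UR n r s\<^esub> ((-1) ^ l :: int)) ls) \<one>\<^bsub>UR n r s\<^esub>"
    if "set ls \<subseteq> {1..<i}" for ls
    using that
  proof (induction ls)
    case Nil
    then show ?case by (simp add: P.rel_class_one UR_def)
  next
    case (Cons l ls)
    then show ?case using fac[of l] by (simp add: P.rel_class_mult UR_def del: One_nat_def)
  qed
  from this[of "[1..<i]"] show ?thesis
    using assms unfolding Kprod_def by (simp add: kprod_closed_form)
qed

theorem theorem5p3:
  fixes n :: nat and r s :: complex
  assumes "n \<ge> 2" and "r \<noteq> 0" and "s \<noteq> 0" and "r \<noteq> s" and "r + s \<noteq> 0"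
  shows "\<exists>\<psi> \<in> alg_iso (Urs n r s) (UR n r s).
      (\<forall>i\<in>{1..<n}.
          \<psi> (Urs_el n r s (Ge i)) = (r / (r - s)) \<odot>\<^bsub>UR n r s\<^esub> Egauss n r s i (i + 1)
        \<and> \<psi> (Urs_el n r s (Gf i)) = (s / (s - r)) \<odot>\<^bsub>UR n r s\<^esub> Fgauss n r s (i + 1) i)
    \<and> \<psi> (Urs_el n r s (Ga 1)) = Kplus n r s 1
    \<and> \<psi> (Urs_el n r s (Gb 1)) = Kminus n r s 1
    \<and> (\<forall>i\<in>{2..n}.
          \<psi> (Urs_el n r s (Ga i)) = Kplus n r s i \<otimes>\<^bsub>UR n r s\<^esub> Kprod n r s i
        \<and> \<psi> (Urs_el n r s (Gb i)) = Kminus n r s i \<otimes>\<^bsub>UR n r s\<^esub> Kprod n r s i)"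
proof -
  interpret P: presentation "UR_gens n" "UR_rels n r s" by (rule presentation_UR)
  note rs = assms(2-5)
  have urs: "urs_point n r s G" if "satisfies (Urs_rels n r s) G" for G :: "ugen \<Rightarrow> ugen ncpoly set fam"
    using rs that by unfold_locales
  have ur: "ur_point n r s G" if "satisfies (UR_rels n r s) G" for G :: "lgen \<Rightarrow> lgen ncpoly set fam"
    using rs that by unfold_locales
  have "\<exists>\<psi>\<in>alg_iso (Urs n r s) (UR n r s).
      \<forall>u\<in>Urs_gens n. \<psi> (Urs_el n r s u) = rel_class (UR_gens n) (UR_rels n r s) (psi_poly r s u)"
    unfolding Urs_def UR_def Urs_el_def
    by (rule presented_alg_iso[OF presentation_Urs presentation_UR trivial_Urs trivial_UR, where t' = "phi_poly r s"])
      (blast intro: psi_poly_closed phi_poly_closed ur_point.satisfies_Urs_psi[OF ur] urs_point.satisfies_UR[OF urs]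
        urs_point.psi_phi[OF urs] ur_point.phi_psi[OF ur])+
  then obtain \<psi> where iso: "\<psi> \<in> alg_iso (Urs n r s) (UR n r s)"
    and \<psi>: "\<And>u. u \<in> Urs_gens n \<Longrightarrow> \<psi> (Urs_el n r s u) = rel_class (UR_gens n) (UR_rels n r s) (psi_poly r s u)"
    by blast
  have gens: "LP i j \<in> UR_gens n" "LM j i \<in> UR_gens n" "LPinv i \<in> UR_gens n" "LMinv i \<in> UR_gens n"
    if "i \<in> {1..n}" "j \<in> {1..n}" "i \<le> j" for i j
    using that by (auto simp: UR_gens_def)
  have e: "\<psi> (Urs_el n r s (Ge i)) = (r / (r - s)) \<odot>\<^bsub>UR n r s\<^esub> Egauss n r s i (i + 1)"
    and f: "\<psi> (Urs_el n r s (Gf i)) = (s / (s - r)) \<odot>\<^bsub>UR n r s\<^esub> Fgauss n r s (i + 1) i" if "i \<in> {1..<n}" for i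
  proof -
    have I: "i \<in> {1..n}" "i + 1 \<in> {1..n}" "Ge i \<in> Urs_gens n" "Gf i \<in> Urs_gens n"
      using that by (auto simp: Urs_gens_def)
    show "\<psi> (Urs_el n r s (Ge i)) = (r / (r - s)) \<odot>\<^bsub>UR n r s\<^esub> Egauss n r s i (i + 1)"
      "\<psi> (Urs_el n r s (Gf i)) = (s / (s - r)) \<odot>\<^bsub>UR n r s\<^esub> Fgauss n r s (i + 1) i"
      unfolding \<psi>[OF I(3)] \<psi>[OF I(4)] psi_poly.simps Egauss_def Fgauss_def K_inverses[OF I(1)]
      unfolding UR_el_def UR_def
      using gens[OF I(1,2)] by (subst P.rel_class_smult; simp add: P.rel_class_mult)+
  qed
  have a: "\<psi> (Urs_el n r s (Ga i)) = Kplus n r s i \<otimes>\<^bsub>UR n r s\<^esub> Kprod n r s i"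
    and b: "\<psi> (Urs_el n r s (Gb i)) = Kminus n r s i \<otimes>\<^bsub>UR n r s\<^esub> Kprod n r s i" if "i \<in> {1..n}" for i
  proof -
    have I: "Ga i \<in> Urs_gens n" "Gb i \<in> Urs_gens n" using that by (auto simp: Urs_gens_def Urs_cartan_gens_def)
    show "\<psi> (Urs_el n r s (Ga i)) = Kplus n r s i \<otimes>\<^bsub>UR n r s\<^esub> Kprod n r s i"
      "\<psi> (Urs_el n r s (Gb i)) = Kminus n r s i \<otimes>\<^bsub>UR n r s\<^esub> Kprod n r s i"
      unfolding \<psi>[OF I(1)] \<psi>[OF I(2)] psi_poly.simps Kprod_eq[OF that, symmetric] Kplus_def Kminus_def UR_el_def UR_def
      using gens[OF that that] kprod_closed[OF that] by (simp_all add: P.rel_class_mult)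
  qed
  interpret ring "UR n r s" by (rule ring_UR)
  have "\<psi> (Urs_el n r s (Ga 1)) = Kplus n r s 1" "\<psi> (Urs_el n r s (Gb 1)) = Kminus n r s 1"
    using a[of 1] b[of 1] assms(1) K_Units[of 1 n r s] by (simp_all add: Kprod_def Units_closed)
  then show ?thesis
    using iso e f a b by (intro bexI[of _ \<psi>]) auto
qed

end
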